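(* For all $d,\beta>0$ (with $d$ the integer dimension) there exist constants $c=c(d,\beta)$ and $c'=c'(d,\beta)$ such that for all $\epsilon>0$ there exist probability density functions $p,q$ supported on the $d$-dimensional unit ball such that: 1. $\|p\|_{\beta,2}<c$ and $\|q\|_{\beta,2}<c$; 2. $\|p-q\|_1\asymp\|p-q\|_2\asymp\epsilon$; and 3. the expected test statistic satisfies $$\mathbb E\big[T_{d,0}(p_n,q_n)\big]\le\frac{c'}{\sqrt n}$$ for any $n\le\big(\log\frac1\epsilon\big)^{-d}\,\epsilon^{-\frac{2\beta+d+1}{\beta}}$.
   Context: $\|f\|_{\beta,2}^2=\int_{\mathbb R^d}\|\omega\|^{2\beta}|\widehat f(\omega)|^2\,d\omega$ with $\widehat f(\omega)=\int_{\mathbb R^d}e^{-i\langle x,\omega\rangle}f(x)\,dx$. $\|\cdot\|_1,\|\cdot\|_2$ are the $L^1(\mathbb R^d)$ and $L^2(\mathbb R^d)$ norms. The symbol $\asymp$ denotes equality up to multiplicative constants (not depending on $\epsilon$). $p_n=\frac1n\sum_{i=1}^n\delta_{X_i}$ and $q_n=\frac1n\sum_{i=1}^n\delta_{Y_i}$ are the empirical measures of the samples $(X,Y)\sim p^{\otimes n}\otimes q^{\otimes n}$. The test statistic is $$T_{d,0}(\mu,\nu)=\max_{(w,b)\in\mathbb S^{d-1}\times[0,\infty)}\Big|\mathbb E_{X\sim\mu}\mathbf 1\{w^\top X-b\ge0\}-\mathbb E_{Y\sim\nu}\mathbf 1\{w^\top Y-b\ge0\}\Big|,$$ where $\mathbb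 S^{d-1}$ is the unit sphere in $\mathbb R^d$; it equals the maximal halfspace discrepancy $\overline{d_H}(\mu,\nu)=\sup_{v\in\mathbb R^d,\,b\in\mathbb R}\{\mu(\{x:v^\top x\ge b\})-\nu(\{x:v^\top x\ge b\})\}$.
   Formalization: "For all ε>0" is false (‖p−q‖₁≤2 rules out large ε, log(1/ε)=0 at ε=1, and uniformity fails as ε→1); it is proved for all 0<ε≤δ, for every δ<1, with c and the constants of ≍ depending only on d,β, and c' also on δ. *)

theory Defs
  imports "HOL-Probability.Probability"
begin

(* All norms take values in ennreal, so that a divergent integral gives the value top (a
   Bochner integral would give 0). *)
definition ennreal_sqrt :: "ennreal \<Rightarrow> ennreal" where
  "ennreal_sqrt x = (if x = top then top else ennreal (sqrt (enn2real x)))"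

definition L1_norm :: "('a::euclidean_space \<Rightarrow> real) \<Rightarrow> ennreal" where
  "L1_norm f = (\<integral>\<^sup>+ x. ennreal \<bar>f x\<bar> \<partial>lborel)"

definition L2_norm :: "('a::euclidean_space \<Rightarrow> real) \<Rightarrow> ennreal" where
  "L2_norm f = ennreal_sqrt (\<integral>\<^sup>+ x. ennreal (\<bar>f x\<bar>\<^sup>2) \<partial>lborel)"

definition fourier_transform :: "('a::euclidean_space \<Rightarrow> real) \<Rightarrow> 'a \<Rightarrow> complex" where
  "fourier_transform f \<omega> = (LINT x|lborel. exp (- \<i> * of_real (x \<bullet> \<omega>)) * of_real (f x))"

definition sobolev_norm :: "real \<Rightarrow> ('a::euclidean_space \<Rightarrow> real) \<Rightarrow> ennreal" where
  "sobolev_norm \<beta> f =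
     ennreal_sqrt (\<integral>\<^sup>+ \<omega>. ennreal (norm \<omega> powr (2 * \<beta>) * (cmod (fourier_transform f \<omega>))\<^sup>2) \<partial>lborel)"

definition pdf_on_unit_ball :: "('a::euclidean_space \<Rightarrow> real) \<Rightarrow> bool" where
  "pdf_on_unit_ball p \<longleftrightarrow>
     p \<in> borel_measurable borel \<and> (\<forall>x. 0 \<le> p x) \<and> (\<integral>\<^sup>+ x. ennreal (p x) \<partial>lborel) = 1 \<and>
     (\<forall>x. x \<notin> cball 0 1 \<longrightarrow> p x = 0)"

definition comparable :: "real \<Rightarrow> ennreal \<Rightarrow> ennreal \<Rightarrow> bool" where
  "comparable K a b \<longleftrightarrow> a \<le> ennreal K * b \<and> b \<le> ennreal K * a"

(* The image of the uniform distribution on {..<n} under i \<mapsto> X i, i.e. the measure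
   (1/n) * (\<Sum>i<n. \<delta>_{X i}); meaningful for n > 0. *)
definition empirical_measure :: "nat \<Rightarrow> (nat \<Rightarrow> 'a::euclidean_space) \<Rightarrow> 'a measure" where
  "empirical_measure n X = distr (uniform_count_measure {..<n}) borel X"

definition halfspace_stat :: "'a::euclidean_space measure \<Rightarrow> 'a measure \<Rightarrow> real" where
  "halfspace_stat \<mu> \<nu> =
     (SUP (w, b) \<in> sphere 0 1 \<times> {0..}.
        \<bar>(LINT x|\<mu>. indicat_real {x. w \<bullet> x - b \<ge> 0} x) - (LINT y|\<nu>. indicat_real {y. w \<bullet> y - b \<ge> 0} y)\<bar>)"

definition sample_measure ::
    "nat \<Rightarrow> ('a::euclidean_space \<Rightarrow> real) \<Rightarrow> (nat \<Rightarrow> 'a) measure" where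
  "sample_measure n p = (\<Pi>\<^sub>M i\<in>{..<n}. density lborel (\<lambda>x. ennreal (p x)))"

(* The integrand is bounded and Borel measurable in the samples: it takes finitely many values,
   and the sets of samples that a closed halfspace can split in a prescribed way are F_sigma. *)
definition expected_halfspace_stat ::
    "nat \<Rightarrow> ('a::euclidean_space \<Rightarrow> real) \<Rightarrow> ('a \<Rightarrow> real) \<Rightarrow> real" where
  "expected_halfspace_stat n p q =
     (LINT (X, Y)|(sample_measure n p \<Otimes>\<^sub>M sample_measure n q).
        halfspace_stat (empirical_measure n X) (empirical_measure n Y))"

end

theory Submission
  imports Defs "HOL-Computational_Algebra.Polynomial" "HOL-Real_Asymp.Real_Asymp"
begin

text \<open>
  Let \<open>L\<close> be about \<open>\<epsilon> powr (- 1 / \<beta>)\<close>. Cut a small cube into \<open>L ^ d\<close> cells, put a scaled copy of one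
  mean-zero bump of height about \<open>\<epsilon>\<close> into each of them, and multiply the copies by independent random signs.
  The density \<open>q\<close> is a fixed bump \<open>p\<close> plus this perturbation. The \<open>L1\<close> and \<open>L2\<close> norms of the perturbation
  do not depend on the signs, and its Sobolev energy is bounded on average, because averaging over the signs
  removes the mixed terms of \<open>\<bar>\<Sum>j. \<sigma> j * F j\<bar>\<^sup>2\<close>.

  A halfspace sees only the cells cut by its boundary. There are about \<open>L ^ (d - 1)\<close> of them, each
  contributes at most \<open>\<epsilon> * L ^ (- d)\<close>, and the signs give square-root cancellation, so
  \<open>\<epsilon> * L powr (- (d + 1) / 2) * sqrt (1 + ln L)\<close> bounds the discrepancy on a net of polynomial size, hence
  on all halfspaces. This is \<open>O(1 / sqrt n)\<close> in the stated range of \<open>n\<close>.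

  The sampling error is \<open>O(1 / sqrt n)\<close> for all \<open>n\<close> by chaining. No entropy bound for VC classes is needed:
  both densities are bounded, so a halfspace is approximated by a member of a polynomial-size net up to a thin
  slab of small probability.
\<close>

section \<open>Chaining for the empirical process\<close>

text \<open>Origin of the exponent: height \<epsilon> on cells of side r costs Sobolev energy of
  order \<epsilon>^2 * r^(-2\<beta>), which is bounded as long as r is at least of order
  \<epsilon>^(1/\<beta>). At this r the squared discrepancy is of order \<epsilon>^2 * r^(d+1) * (1
  + ln L), and \<epsilon>^2 * r^(d+1) is the reciprocal of \<epsilon>^(-(2\<beta>+d+1)/\<beta>). The
  logarithm is the price of the union bound over the net; one factor of (log 1/\<epsilon>)^(-d) pays
  for it, since d >= 1.

  One choice of signs must meet two demands: the energy is controlled only on average, the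
  discrepancy only for most choices. Both enter a single potential function whose average is at most
  1.

  Since \<beta> is an arbitrary positive real, the Sobolev norm cannot be read off from derivatives.
  The bumps are therefore tensor products of polynomials that vanish to high order at both ends of
  an interval, with explicit Fourier decay.

  Suprema over halfspaces are handled through integrable dominating functions, so their
  measurability never enters the argument.\<close>

lemma exp_le_quadratic:
  fixes x :: real
  assumes "\<bar>x\<bar> \<le> 1"
  shows "exp x \<le> 1 + x + x\<^sup>2"
proof (cases "0 \<le> x")
  case True
  then show ?thesis using exp_bound[of x] assms by simp
next
  case False
  define y where "y = - x"
  have y: "0 < y" "y \<le> 1" using False assms by (auto simp: y_def)
  have "1 + y \<le> exp y" using exp_ge_add_one_self by (simp add: add.commute)
  then have "exp (-y) \<le> 1 / (1 + y)"
    using y by (simp add: exp_minus field_simps)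
  also have "\<dots> \<le> 1 - y + y\<^sup>2"
  proof -
    have "(1 - y + y\<^sup>2) * (1 + y) = 1 + y ^ 3" by (simp add: algebra_simps power2_eq_square power3_eq_cube)
    then have "1 \<le> (1 - y + y\<^sup>2) * (1 + y)" using y by simp
    then show ?thesis using y by (simp add: divide_le_eq)
  qed
  finally show ?thesis by (simp add: y_def)
qed

text \<open>The factor \<open>1 / sqrt (real n)\<close> turns the goal into a bound independent of
  \<open>n\<close>. The mean stands inside the sum, so that every summand is centred.\<close>

definition empirical_process :: "'a measure \<Rightarrow> nat \<Rightarrow> ('a \<Rightarrow> real) \<Rightarrow> (nat \<Rightarrow> 'a) \<Rightarrow> real" where
  "empirical_process M n g X = (\<Sum>i<n. g (X i) - (LINT x|M. g x)) / sqrt (real n)"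

context prob_space
begin

lemma bounded_integrable:
  fixes g :: "'a \<Rightarrow> real"
  assumes "g \<in> borel_measurable M" "\<And>x. x \<in> space M \<Longrightarrow> \<bar>g x\<bar> \<le> b"
  shows "integrable M g"
  by (rule integrable_const_bound[where B=b]) (use assms in auto)

text \<open>A Bernstein-type bound: the exponent contains the second moment \<open>v\<close> and not
  the range of \<open>g\<close>. This lets chaining profit from differences of sets that have small
  probability. The restriction on \<open>t\<close> is the range in which \<open>exp\<close> is
  dominated by a quadratic.\<close>

lemma centred_mgf_le:
  fixes g :: "'a \<Rightarrow> real"
  assumes g[measurable]: "g \<in> borel_measurable M"
    and bound: "\<And>x. x \<in> space M \<Longrightarrow> \<bar>g x\<bar> \<le> 1"
    and var: "expectation (\<lambda>x. (g x)\<^sup>2) \<le> v" and t: "\<bar>t\<bar> \<le> 1"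
  shows "integrable M (\<lambda>x. exp (t * (g x - expectation g)))"
    and "expectation (\<lambda>x. exp (t * (g x - expectation g))) \<le> exp (t\<^sup>2 * v)"
proof -
  have le1: "\<bar>t * g x\<bar> \<le> 1" if "x \<in> space M" for x
    using mult_mono[OF t bound[OF that]] by (simp add: abs_mult)
  have int_g: "integrable M g" by (rule bounded_integrable[OF g bound])
  have int_g2: "integrable M (\<lambda>x. (g x)\<^sup>2)"
    by (rule bounded_integrable[where b=1]) (use bound in \<open>auto simp: abs_square_le_1\<close>)
  have int_e: "integrable M (\<lambda>x. exp (t * g x))"
    by (rule bounded_integrable[where b="exp 1"]) (use le1 in \<open>auto simp: abs_le_iff\<close>)
  have split: "exp (t * (g x - expectation g)) = exp (- t * expectation g) * exp (t * g x)" for x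
    by (simp add: exp_add[symmetric] algebra_simps)
  show "integrable M (\<lambda>x. exp (t * (g x - expectation g)))"
    unfolding split using int_e by simp
  have "expectation (\<lambda>x. exp (t * g x)) \<le> expectation (\<lambda>x. 1 + t * g x + t\<^sup>2 * (g x)\<^sup>2)"
    by (rule integral_mono)
       (use int_g int_g2 int_e exp_le_quadratic[OF le1] in \<open>auto simp: power_mult_distrib\<close>)
  also have "\<dots> = 1 + t * expectation g + t\<^sup>2 * expectation (\<lambda>x. (g x)\<^sup>2)"
    using int_g int_g2 by (simp add: prob_space)
  also have "\<dots> \<le> 1 + (t * expectation g + t\<^sup>2 * v)"
    using var by (simp add: mult_left_mono)
  also have "\<dots> \<le> exp (t * expectation g + t\<^sup>2 * v)" by (rule exp_ge_add_one_self)
  finally have "exp (- t * expectation g) * expectation (\<lambda>x. exp (t * g x))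
      \<le> exp (- t * expectation g) * exp (t * expectation g + t\<^sup>2 * v)"
    by (intro mult_left_mono) auto
  also have "\<dots> = exp (t\<^sup>2 * v)" by (simp add: exp_add[symmetric])
  finally show "expectation (\<lambda>x. exp (t * (g x - expectation g))) \<le> exp (t\<^sup>2 * v)"
    unfolding split by simp
qed

text \<open>Independence makes the moment generating function a product of \<open>n\<close> equal
  factors with parameter \<open>l / sqrt n\<close>, and the exponents add up to
  \<open>n * (l / sqrt n)\<^sup>2 * v\<close>. The bound on \<open>l\<close> limits how fine a scale
  may be used for a given \<open>n\<close>.\<close>

lemma empirical_process_mgf_le:
  fixes g :: "'a \<Rightarrow> real"
  assumes n: "0 < n" and g[measurable]: "g \<in> borel_measurable M"
    and bound: "\<And>x. x \<in> space M \<Longrightarrow> \<bar>g x\<bar> \<le> 1"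
    and var: "expectation (\<lambda>x. (g x)\<^sup>2) \<le> v" and l: "\<bar>l\<bar> \<le> sqrt n"
  shows "integrable (\<Pi>\<^sub>M i\<in>{..<n}. M) (\<lambda>X. exp (l * empirical_process M n g X))"
    and "(LINT X|(\<Pi>\<^sub>M i\<in>{..<n}. M). exp (l * empirical_process M n g X)) \<le> exp (l\<^sup>2 * v)"
proof -
  interpret P: product_sigma_finite "\<lambda>_::nat. M" by standard
  define t where "t = l / sqrt n"
  have t: "\<bar>t\<bar> \<le> 1" using n l by (simp add: t_def)
  have eq: "exp (l * empirical_process M n g X) = (\<Prod>i<n. exp (t * (g (X i) - expectation g)))" for X
    unfolding empirical_process_def exp_sum[OF finite_lessThan, symmetric] t_def
    by (simp add: sum_distrib_left sum_divide_distrib)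
  note m = centred_mgf_le[OF g bound var t]
  show "integrable (\<Pi>\<^sub>M i\<in>{..<n}. M) (\<lambda>X. exp (l * empirical_process M n g X))"
    unfolding eq by (rule P.product_integrable_prod) (use m in auto)
  have "(LINT X|(\<Pi>\<^sub>M i\<in>{..<n}. M). exp (l * empirical_process M n g X))
      = (\<Prod>i<n. expectation (\<lambda>x. exp (t * (g x - expectation g))))"
    unfolding eq by (rule P.product_integral_prod) (use m in auto)
  also have "\<dots> \<le> (\<Prod>i<n. exp (t\<^sup>2 * v))"
    by (intro prod_mono conjI integral_nonneg m) auto
  also have "\<dots> = exp (l\<^sup>2 * v)"
    using n by (simp add: exp_of_nat_mult[symmetric] t_def power_divide)
  finally show "(LINT X|(\<Pi>\<^sub>M i\<in>{..<n}. M). exp (l * empirical_process M n g X)) \<le> exp (l\<^sup>2 * v)" .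
qed

text \<open>The envelope is read off from \<open>y \<le> ln B + exp y / B - 1\<close>, applied to
  \<open>y = l * \<bar>empirical_process M n g X\<bar>\<close>; this replaces Jensen's inequality for a maximum.\<close>

lemma empirical_process_finite_envelope:
  fixes N :: real and F :: "('a \<Rightarrow> real) set"
  assumes n: "0 < n" and F: "finite F" "real (card F) \<le> N" "1 \<le> N"
    and g[measurable]: "\<And>g. g \<in> F \<Longrightarrow> g \<in> borel_measurable M"
    and bound: "\<And>g x. g \<in> F \<Longrightarrow> x \<in> space M \<Longrightarrow> \<bar>g x\<bar> \<le> 1"
    and var: "\<And>g. g \<in> F \<Longrightarrow> expectation (\<lambda>x. (g x)\<^sup>2) \<le> v" and l: "0 < l" "l \<le> sqrt n"
  obtains D where "integrable (\<Pi>\<^sub>M i\<in>{..<n}. M) D"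
    "\<And>g X. g \<in> F \<Longrightarrow> \<bar>empirical_process M n g X\<bar> \<le> D X"
    "(LINT X|(\<Pi>\<^sub>M i\<in>{..<n}. M). D X) \<le> ln (2 * N) / l + l * v"
proof -
  let ?P = "\<Pi>\<^sub>M i\<in>{..<n}. M"
  interpret P: prob_space ?P by (rule prob_space_PiM) (rule prob_space_axioms)
  \<comment> \<open>\<open>B\<close> bounds the mean of the sum of all the exponentials, two for
    each member of \<open>F\<close>. Hence \<open>(\<Sum>g\<in>F. e g X) / B - 1\<close> has mean at
    most 0 and only \<open>ln B / l\<close> survives.\<close>
  define B where "B = 2 * N * exp (l\<^sup>2 * v)"
  have B: "0 < B" using F by (simp add: B_def)
  define e where "e g X = exp (l * empirical_process M n g X) + exp (- l * empirical_process M n g X)" for g X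
  define D where "D X = (ln B + (\<Sum>g\<in>F. e g X) / B - 1) / l" for X
  have e_nonneg: "0 \<le> e g X" for g X by (simp add: e_def)
  have mgf: "integrable ?P (e g)" "P.expectation (e g) \<le> 2 * exp (l\<^sup>2 * v)" if "g \<in> F" for g
  proof -
    note 1 = empirical_process_mgf_le[OF n g[OF that] bound[OF that] var[OF that], of l]
    note 2 = empirical_process_mgf_le[OF n g[OF that] bound[OF that] var[OF that], of "- l"]
    show "integrable ?P (e g)" unfolding e_def using 1 2 l by auto
    show "P.expectation (e g) \<le> 2 * exp (l\<^sup>2 * v)" unfolding e_def using 1 2 l by auto
  qed
  show thesis
  proof (rule that)
    show "integrable ?P D" unfolding D_def using mgf F by auto
    show "\<bar>empirical_process M n g X\<bar> \<le> D X" if "g \<in> F" for g X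
    proof -
      define y where "y = l * \<bar>empirical_process M n g X\<bar>"
      have "exp y \<le> e g X" unfolding y_def e_def using l by (auto simp: abs_if mult_minus_right)
      also have "\<dots> \<le> (\<Sum>g\<in>F. e g X)"
        by (rule member_le_sum) (use that F e_nonneg in auto)
      finally have "exp y / B \<le> (\<Sum>g\<in>F. e g X) / B" using B by (simp add: divide_right_mono)
      moreover have "1 + (y - ln B) \<le> exp (y - ln B)" by (rule exp_ge_add_one_self)
      then have "1 + (y - ln B) \<le> exp y / B" using B by (simp add: exp_diff)
      ultimately have "y \<le> l * D X" using l by (simp add: D_def)
      then show ?thesis using l by (simp add: y_def)
    qed
    have "(\<Sum>g\<in>F. P.expectation (e g)) \<le> (\<Sum>g\<in>F. 2 * exp (l\<^sup>2 * v))"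
      by (rule sum_mono) (rule mgf)
    also have "\<dots> = real (card F) * (2 * exp (l\<^sup>2 * v))" by simp
    also have "\<dots> \<le> N * (2 * exp (l\<^sup>2 * v))" by (rule mult_right_mono) (use F in auto)
    also have "\<dots> = B" by (simp add: B_def)
    finally have sum_le: "(\<Sum>g\<in>F. P.expectation (e g)) / B \<le> 1" using B by simp
    have "P.expectation D = (ln B + (\<Sum>g\<in>F. P.expectation (e g)) / B - 1) / l"
      unfolding D_def using mgf F P.prob_space by (simp add: Bochner_Integration.integral_sum)
    also have "\<dots> \<le> ln B / l" using sum_le l by (simp add: divide_right_mono)
    also have "ln B = ln (2 * N) + l\<^sup>2 * v" using F by (simp add: B_def ln_mult)
    also have "\<dots> / l = ln (2 * N) / l + l * v" using l by (simp add: field_simps power2_eq_square)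
    finally show "P.expectation D \<le> ln (2 * N) / l + l * v" .
  qed
qed

end

text \<open>The bound \<open>ln (2 * N) / l + l * v\<close> of the finite envelope at
  \<open>l = sqrt (2 ^ k)\<close>, \<open>v = 2 * c / 2 ^ k\<close> and
  \<open>N = (a * b ^ k) * (a * b ^ Suc k)\<close>, the number of pairs of neighbouring
  levels.\<close>

definition chaining_increment :: "real \<Rightarrow> real \<Rightarrow> real \<Rightarrow> nat \<Rightarrow> real" where
  "chaining_increment a b c k = sqrt (1/2) ^ k * (ln (2 * a\<^sup>2) + (2 * real k + 1) * ln b + 2 * c)"

text \<open>The first two terms are the coarsest level, taken with scale 1 and second moment 1. The
  series pays for the links and for the brackets of the last level, and \<open>4 * c\<close> for the
  deterministic part of the remainder.\<close>

definition chaining_constant :: "real \<Rightarrow> real \<Rightarrow> real \<Rightarrow> real" where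
  "chaining_constant a b c = ln (2 * a) + 1 + (\<Sum>k. chaining_increment a b c k) + 4 * c"

lemma summable_chaining_increment: "summable (chaining_increment a b c)"
proof -
  let ?q = "sqrt (1/2) :: real"
  have q: "norm ?q < 1" by (simp add: real_sqrt_lt_1_iff)
  have 1: "summable (\<lambda>k. ?q ^ k)" using q by (rule summable_geometric)
  have 2: "summable (\<lambda>k. of_nat k * ?q ^ k)"
  proof -
    \<comment> \<open>The termwise derivative of the geometric series: \<open>diffs\<close> of the
      constant sequence 1 has the coefficients \<open>Suc k\<close>.\<close>
    have "summable (\<lambda>k. diffs (\<lambda>_. 1) k * ?q ^ k)"
    proof (rule termdiff_converges[where K=1])
      show "norm ?q < 1" by (rule q)
      show "summable (\<lambda>n. 1 * x ^ n)" if "norm x < 1" for x :: real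
        using summable_geometric[OF that] by simp
    qed
    then have "summable (\<lambda>k. real (Suc k) * ?q ^ k)" by (simp add: diffs_def)
    then show ?thesis
      by (rule summable_comparison_test') (use q in \<open>auto simp: abs_mult mult_right_mono\<close>)
  qed
  have "chaining_increment a b c = (\<lambda>k. (ln (2 * a\<^sup>2) + ln b + 2 * c) * ?q ^ k + (2 * ln b) * (of_nat k * ?q ^ k))"
    by (auto simp: chaining_increment_def algebra_simps)
  then show ?thesis using summable_add[OF summable_mult[OF 1] summable_mult[OF 2]] by simp
qed

lemma chaining_increment_nonneg:
  assumes "1 \<le> a" "1 \<le> b" "0 \<le> c"
  shows "0 \<le> chaining_increment a b c k"
proof -
  have "1 \<le> a\<^sup>2" using assms by (simp add: one_le_power)
  then have "0 \<le> ln (2 * a\<^sup>2)" by simp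
  then show ?thesis using assms by (simp add: chaining_increment_def)
qed


lemma sqrt_half_power:
  "sqrt (1/2) ^ k * sqrt (2 ^ k) = 1" "sqrt (2 ^ k) * (c / 2 ^ k) = sqrt (1/2) ^ k * c"
proof -
  have r: "sqrt (2 ^ k) = sqrt 2 ^ k" by (simp add: real_sqrt_power)
  show 1: "sqrt (1/2) ^ k * sqrt (2 ^ k) = 1"
    unfolding r by (simp add: power_mult_distrib[symmetric] real_sqrt_mult[symmetric])
  have "sqrt (2 ^ k) * (c / 2 ^ k) = c / sqrt (2 ^ k)"
    by (simp add: field_simps)
  also have "\<dots> = sqrt (1/2) ^ k * c" using 1 by (simp add: field_simps)
  finally show "sqrt (2 ^ k) * (c / 2 ^ k) = sqrt (1/2) ^ k * c" .
qed

context prob_space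
begin

lemma empirical_process_add:
  assumes "integrable M f" "integrable M g"
  shows "empirical_process M n (\<lambda>x. f x + g x) X = empirical_process M n f X + empirical_process M n g X"
  using assms by (simp add: empirical_process_def sum.distrib add_divide_distrib sum_subtractf algebra_simps
      diff_divide_distrib)

text \<open>The levels \<open>k \<le> K\<close> are used, where \<open>2 ^ K\<close> is about \<open>sqrt n\<close>. At level \<open>K\<close> the
  deterministic part \<open>2 * sqrt n * measure M S\<close> of the bracketing error is bounded. The scale
  \<open>l = sqrt (2 ^ k)\<close> in the exponential moments is admissible since \<open>2 ^ k \<le> sqrt n\<close>.\<close>

theorem bracketing_chaining:
  fixes G :: "nat \<Rightarrow> ('a set \<times> 'a set) set" and a b c :: real
  assumes n: "0 < n" and ab: "1 \<le> a" "1 \<le> b" and c: "0 \<le> c"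
    and fin: "\<And>k. finite (G k)" and card: "\<And>k. real (card (G k)) \<le> a * b ^ k"
    and meas: "\<And>k A S. (A, S) \<in> G k \<Longrightarrow> A \<in> events \<and> S \<in> events \<and> prob S \<le> c / 2 ^ k"
    and H: "\<And>A. A \<in> \<H> \<Longrightarrow> A \<in> events"
    and approx: "\<And>k A. A \<in> \<H> \<Longrightarrow> \<exists>(A', S)\<in>G k. (A - A') \<union> (A' - A) \<subseteq> S"
  obtains D where "integrable (\<Pi>\<^sub>M i\<in>{..<n}. M) D"
    "\<And>A X. A \<in> \<H> \<Longrightarrow> \<bar>empirical_process M n (indicat_real A) X\<bar> \<le> D X"
    "(LINT X|(\<Pi>\<^sub>M i\<in>{..<n}. M). D X) \<le> chaining_constant a b c"
proof -
  let ?P = "\<Pi>\<^sub>M i\<in>{..<n}. M"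
  let ?\<nu> = "empirical_process M n"
  interpret P: prob_space ?P by (rule prob_space_PiM) (rule prob_space_axioms)
  \<comment> \<open>Thus \<open>2 ^ K\<close> lies between \<open>sqrt n / 2\<close> and
    \<open>sqrt n\<close>. The lower bound controls the remainder, the upper bound makes the scales
    admissible.\<close>
  obtain K where K: "4 ^ K \<le> n" "n < 4 ^ (K + 1)"
    using ex_power_ivl1[of 4 n] n by auto
  have pow4: "(4::real) ^ k = (2 ^ k)\<^sup>2" for k
    using power_mult[of "2::real" 2 k] power_mult[of "2::real" k 2] by (simp add: mult.commute)
  have K1: "2 ^ K \<le> sqrt n"
    using K(1) by (intro real_le_rsqrt) (simp add: pow4[symmetric] flip: of_nat_le_iff)
  have K2: "sqrt n \<le> 2 * 2 ^ K"
  proof (rule real_le_lsqrt)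
    have "real n \<le> real (4 ^ (K + 1))" using K(2) by (simp only: of_nat_le_iff less_imp_le)
    then have "real n \<le> 4 ^ (K + 1)" by simp
    then show "real n \<le> (2 * 2 ^ K)\<^sup>2" by (simp add: pow4 power_mult_distrib)
  qed auto
  have scale: "sqrt (2 ^ k) \<le> sqrt n" "0 < sqrt (2 ^ k :: real)" if "k \<le> K" for k
  proof -
    have "(2::real) ^ k \<le> 2 ^ K" using that by (rule power_increasing) auto
    also have "\<dots> \<le> sqrt n" by (rule K1)
    also have "\<dots> \<le> n" by (rule real_le_lsqrt) (use n in \<open>auto simp: power2_eq_square\<close>)
    finally show "sqrt (2 ^ k) \<le> sqrt n" by simp
  qed simp
  have pos: "1 \<le> a * b ^ k" for k using mult_mono[of 1 a 1 "b ^ k"] ab by (simp add: one_le_power)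

  define F0 where "F0 = (\<lambda>(A, S). indicat_real A) ` G 0"
  obtain D0 where D0: "integrable ?P D0" "\<And>g X. g \<in> F0 \<Longrightarrow> \<bar>?\<nu> g X\<bar> \<le> D0 X"
    "P.expectation D0 \<le> ln (2 * a) / 1 + 1 * 1"
  proof (rule empirical_process_finite_envelope[OF n, of F0 a 1 1])
    show "finite F0" using fin by (simp add: F0_def)
    show "real (card F0) \<le> a"
      using card_image_le[OF fin, of "\<lambda>(A, S). indicat_real A" 0] card[of 0] by (simp add: F0_def)
    show "1 \<le> a" by (rule ab)
    show "(1::real) \<le> sqrt n" using n by simp
    fix g assume "g \<in> F0"
    then obtain A S where g: "g = indicat_real A" "(A, S) \<in> G 0" by (auto simp: F0_def)
    show "g \<in> borel_measurable M" using meas[OF g(2)] g(1) by auto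
    show "\<bar>g x\<bar> \<le> 1" for x using g(1) by (auto simp: indicator_def)
    have "(\<lambda>x. (g x)\<^sup>2) = indicat_real A" using g(1) by (auto simp: indicator_def)
    then show "expectation (\<lambda>x. (g x)\<^sup>2) \<le> 1" using meas[OF g(2)] by simp
  qed auto

  \<comment> \<open>A set that is close to \<open>A\<close> up to \<open>S\<close> and close to
    \<open>A'\<close> up to \<open>S'\<close> forces \<open>A\<close> and \<open>A'\<close> to
    differ only inside \<open>S \<union> S'\<close>. Recording this inclusion in the class gives
    each link a second moment of order \<open>c / 2 ^ k\<close>; without it only the trivial bound 1
    would be available.\<close>
  define F where "F k = {g. \<exists>A S A' S'. (A, S) \<in> G k \<and> (A', S') \<in> G (Suc k) \<and>
      (A' - A) \<union> (A - A') \<subseteq> S \<union> S' \<and> g = (\<lambda>x. indicat_real A' x - indicat_real A x)}" for k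
  have "\<exists>D. integrable ?P D \<and> (\<forall>g X. g \<in> F k \<longrightarrow> \<bar>?\<nu> g X\<bar> \<le> D X) \<and>
      P.expectation D \<le> chaining_increment a b c k" if k: "k \<le> K" for k
  proof -
    define N where "N = (a * b ^ k) * (a * b ^ Suc k)"
    have N1: "1 \<le> N" unfolding N_def 
      using mult_mono[OF pos[of k] pos[of "Suc k"]] pos[of k] by simp
    have sub: "F k \<subseteq> (\<lambda>((A, S), (A', S')). (\<lambda>x. indicat_real A' x - indicat_real A x)) ` (G k \<times> G (Suc k))"
      unfolding F_def by force
    then have "card (F k) \<le> card (G k \<times> G (Suc k))"
      by (meson fin finite_SigmaI surj_card_le)
    then have "real (card (F k)) \<le> real (card (G k)) * real (card (G (Suc k)))"
      by (simp add: card_cartesian_product flip: of_nat_mult)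
    also have "\<dots> \<le> N" unfolding N_def by (intro mult_mono card) (use pos[of k] in auto)
    finally have cardF: "real (card (F k)) \<le> N" .
    obtain D where D: "integrable ?P D" "\<And>g X. g \<in> F k \<Longrightarrow> \<bar>?\<nu> g X\<bar> \<le> D X"
      "P.expectation D \<le> ln (2 * N) / sqrt (2 ^ k) + sqrt (2 ^ k) * (2 * c / 2 ^ k)"
    proof (rule empirical_process_finite_envelope[OF n, of "F k" N "2 * c / 2 ^ k" "sqrt (2 ^ k)"])
      show "finite (F k)" using finite_subset[OF sub] fin by auto
      fix g assume "g \<in> F k"
      then obtain A S A' S' where g: "g = (\<lambda>x. indicat_real A' x - indicat_real A x)"
        and G: "(A, S) \<in> G k" "(A', S') \<in> G (Suc k)" and sub: "(A' - A) \<union> (A - A') \<subseteq> S \<union> S'"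
        unfolding F_def by blast
      note [measurable] = meas[OF G(1), THEN conjunct1] meas[OF G(2), THEN conjunct1]
        meas[OF G(1), THEN conjunct2, THEN conjunct1] meas[OF G(2), THEN conjunct2, THEN conjunct1]
      show gm[measurable]: "g \<in> borel_measurable M" unfolding g by measurable
      show b: "\<bar>g x\<bar> \<le> 1" for x unfolding g by (auto simp: indicator_def)
      have "expectation (\<lambda>x. (g x)\<^sup>2) \<le> expectation (\<lambda>x. indicat_real S x + indicat_real S' x)"
      proof (rule integral_mono)
        show "integrable M (\<lambda>x. (g x)\<^sup>2)"
          by (rule bounded_integrable[where b=1]) (use b in \<open>auto simp: abs_square_le_1\<close>)
        show "integrable M (\<lambda>x. indicat_real S x + indicat_real S' x)"
          by (rule bounded_integrable[where b=2]) (auto simp: indicator_def)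
        show "(g x)\<^sup>2 \<le> indicat_real S x + indicat_real S' x" for x
          using sub unfolding g by (auto simp: indicator_def)
      qed
      also have "\<dots> = prob S + prob S'"
        by (subst Bochner_Integration.integral_add)
           (auto intro!: bounded_integrable[where b=1] simp: indicator_def)
      also have "\<dots> \<le> c / 2 ^ k + c / 2 ^ Suc k"
        using meas[OF G(1)] meas[OF G(2)] by (intro add_mono) auto
      also have "\<dots> \<le> 2 * c / 2 ^ k" using c by (simp add: field_simps)
      finally show "expectation (\<lambda>x. (g x)\<^sup>2) \<le> 2 * c / 2 ^ k" .
    qed (use cardF N1 scale[OF k] in auto)
    have lnN: "ln (2 * N) = ln (2 * a\<^sup>2) + (2 * real k + 1) * ln b"
    proof -
      have "2 * N = (2 * a\<^sup>2) * ((b ^ k)\<^sup>2 * b)"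
        unfolding N_def by (simp add: power2_eq_square power_mult power_mult_distrib mult_ac)
      then show ?thesis using ab by (simp add: ln_mult ln_realpow algebra_simps power2_eq_square)
    qed
    have "ln (2 * N) / sqrt (2 ^ k) = sqrt (1/2) ^ k * ln (2 * N)"
      using sqrt_half_power(1)[of k] by (simp add: field_simps)
    then have "ln (2 * N) / sqrt (2 ^ k) + sqrt (2 ^ k) * (2 * c / 2 ^ k) = chaining_increment a b c k"
      unfolding sqrt_half_power(2) chaining_increment_def lnN by (simp add: algebra_simps)
    then show ?thesis using D by auto
  qed
  then obtain D where D: "\<And>k. k \<le> K \<Longrightarrow> integrable ?P (D k)"
    "\<And>k g X. k \<le> K \<Longrightarrow> g \<in> F k \<Longrightarrow> \<bar>?\<nu> g X\<bar> \<le> D k X"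
    "\<And>k. k \<le> K \<Longrightarrow> P.expectation (D k) \<le> chaining_increment a b c k"
    by metis

  \<comment> \<open>The step from the finest net set to the target set leaves every finite class. It
    is controlled by the empirical mass of the bracket, so the finitely many brackets of level
    \<open>K\<close> get an envelope as well.\<close>
  define FS where "FS = (\<lambda>(A, S). indicat_real S) ` G K"
  obtain DS where DS: "integrable ?P DS" "\<And>g X. g \<in> FS \<Longrightarrow> \<bar>?\<nu> g X\<bar> \<le> DS X"
    "P.expectation DS \<le> ln (2 * (a * b ^ K)) / sqrt (2 ^ K) + sqrt (2 ^ K) * (c / 2 ^ K)"
  proof (rule empirical_process_finite_envelope[OF n, of FS "a * b ^ K" "c / 2 ^ K" "sqrt (2 ^ K)"])
    show "finite FS" using fin by (simp add: FS_def)
    have "real (card FS) \<le> real (card (G K))"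
      using card_image_le[OF fin, of "\<lambda>(A, S). indicat_real S" K] by (simp add: FS_def)
    then show "real (card FS) \<le> a * b ^ K" using card[of K] by simp
    fix g assume "g \<in> FS"
    then obtain A S where g: "g = indicat_real S" "(A, S) \<in> G K" by (auto simp: FS_def)
    show "g \<in> borel_measurable M" using meas[OF g(2)] g(1) by auto
    show "\<bar>g x\<bar> \<le> 1" for x using g(1) by (auto simp: indicator_def)
    have "(\<lambda>x. (g x)\<^sup>2) = indicat_real S" using g(1) by (auto simp: indicator_def)
    then show "expectation (\<lambda>x. (g x)\<^sup>2) \<le> c / 2 ^ K" using meas[OF g(2)] by simp
  qed (use pos scale in auto)
  \<comment> \<open>The bracket term fits under the increment of index \<open>K\<close>. The links
    use only the indices below \<open>K\<close>, so both together are a partial sum of the same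
    series.\<close>
  have DS_le: "P.expectation DS \<le> chaining_increment a b c K"
  proof -
    have "ln (2 * (a * b ^ K)) = ln 2 + ln a + K * ln b" using ab by (simp add: ln_mult ln_realpow)
    also have "\<dots> \<le> ln 2 + 2 * ln a + (2 * real K + 1) * ln b"
      using ab by (intro add_mono mult_right_mono) auto
    also have "\<dots> = ln (2 * a\<^sup>2) + (2 * real K + 1) * ln b" using ab by (simp add: ln_mult ln_realpow)
    finally have "ln (2 * (a * b ^ K)) + c \<le> ln (2 * a\<^sup>2) + (2 * real K + 1) * ln b + 2 * c"
      using c by simp
    then have "sqrt (1/2) ^ K * (ln (2 * (a * b ^ K)) + c) \<le> chaining_increment a b c K"
      unfolding chaining_increment_def by (rule mult_left_mono) simp
    moreover have "ln (2 * (a * b ^ K)) / sqrt (2 ^ K) = sqrt (1/2) ^ K * ln (2 * (a * b ^ K))"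
      using sqrt_half_power(1)[of K] by (simp add: field_simps)
    ultimately show ?thesis using DS(3) unfolding sqrt_half_power(2) by (simp add: distrib_left)
  qed

  have D_int: "\<And>k. k \<in> {..<K} \<Longrightarrow> integrable ?P (D k)" using D(1) by simp
  have sum_int: "integrable ?P (\<lambda>X. \<Sum>k<K. D k X)" by (rule Bochner_Integration.integrable_sum[OF D_int])
  have sum_eq: "P.expectation (\<lambda>X. \<Sum>k<K. D k X) = (\<Sum>k<K. P.expectation (D k))"
    by (rule Bochner_Integration.integral_sum[OF D_int])
  \<comment> \<open>A finite sum of integrable envelopes. It dominates the process simultaneously
    for all members of \<H>, which may be uncountable.\<close>
  define E where "E X = D0 X + (\<Sum>k<K. D k X) + DS X + 4 * c" for X
  show thesis
  proof (rule that)
    show "integrable ?P E" unfolding E_def using D0(1) sum_int DS(1) by simp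
    show "\<bar>?\<nu> (indicat_real A) X\<bar> \<le> E X" if A: "A \<in> \<H>" for A X
    proof -
      have "\<forall>k. \<exists>B S. (B, S) \<in> G k \<and> (A - B) \<union> (B - A) \<subseteq> S" using approx[OF A] by blast
      then obtain B S where BS: "\<And>k. (B k, S k) \<in> G k" "\<And>k. (A - B k) \<union> (B k - A) \<subseteq> S k"
        by metis
      have [measurable]: "B k \<in> events" "S k \<in> events" "A \<in> events" for k using meas[OF BS(1)] H[OF A] by auto
      have int: "integrable M (indicat_real (B k))" "integrable M (indicat_real (S k))"
        "integrable M (indicat_real A)" for k
        by (auto intro!: bounded_integrable[where b=1] simp: indicator_def)
      have telescope: "?\<nu> (indicat_real (B m)) X = ?\<nu> (indicat_real (B 0)) X
          + (\<Sum>k<m. ?\<nu> (\<lambda>x. indicat_real (B (Suc k)) x - indicat_real (B k) x) X)" for m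
      proof (induction m)
        case (Suc m)
        have "?\<nu> (indicat_real (B (Suc m))) X
            = ?\<nu> (\<lambda>x. indicat_real (B m) x + (indicat_real (B (Suc m)) x - indicat_real (B m) x)) X"
          by simp
        also have "\<dots> = ?\<nu> (indicat_real (B m)) X
            + ?\<nu> (\<lambda>x. indicat_real (B (Suc m)) x - indicat_real (B m) x) X"
          by (rule empirical_process_add) (use int in auto)
        finally show ?case using Suc by simp
      qed simp
      have "?\<nu> (indicat_real A) X = ?\<nu> (\<lambda>x. indicat_real (B K) x + (indicat_real A x - indicat_real (B K) x)) X"
        by simp
      also have "\<dots> = ?\<nu> (indicat_real (B K)) X + ?\<nu> (\<lambda>x. indicat_real A x - indicat_real (B K) x) X"
        by (rule empirical_process_add) (use int in auto)
      finally have split: "?\<nu> (indicat_real A) X = ?\<nu> (indicat_real (B 0)) X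
          + (\<Sum>k<K. ?\<nu> (\<lambda>x. indicat_real (B (Suc k)) x - indicat_real (B k) x) X)
          + ?\<nu> (\<lambda>x. indicat_real A x - indicat_real (B K) x) X"
        by (simp add: telescope[of K])
      have 0: "\<bar>?\<nu> (indicat_real (B 0)) X\<bar> \<le> D0 X"
        by (rule D0) (use BS(1)[of 0] in \<open>force simp: F0_def\<close>)
      have "\<bar>?\<nu> (\<lambda>x. indicat_real (B (Suc k)) x - indicat_real (B k) x) X\<bar> \<le> D k X" if "k < K" for k
      proof (rule D(2))
        show "(\<lambda>x. indicat_real (B (Suc k)) x - indicat_real (B k) x) \<in> F k"
          unfolding F_def using BS(1)[of k] BS(1)[of "Suc k"] BS(2)[of k] BS(2)[of "Suc k"] by blast
      qed (use that in simp)
      then have 1: "\<bar>\<Sum>k<K. ?\<nu> (\<lambda>x. indicat_real (B (Suc k)) x - indicat_real (B k) x) X\<bar> \<le> (\<Sum>k<K. D k X)"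
        by (intro order_trans[OF sum_abs] sum_mono) auto
      have 2: "\<bar>?\<nu> (\<lambda>x. indicat_real A x - indicat_real (B K) x) X\<bar> \<le> DS X + 4 * c"
      proof -
        let ?g = "\<lambda>x. indicat_real A x - indicat_real (B K) x"
        have g_le: "\<bar>?g x\<bar> \<le> indicat_real (S K) x" for x
          using BS(2)[of K] by (auto simp: indicator_def)
        have "\<bar>expectation ?g\<bar> \<le> expectation (\<lambda>x. \<bar>?g x\<bar>)"
          by (rule integral_abs_bound)
        also have "\<dots> \<le> expectation (indicat_real (S K))"
          by (rule integral_mono) (use int g_le in auto)
        finally have Eg: "\<bar>expectation ?g\<bar> \<le> prob (S K)" by simp
        \<comment> \<open>Monotonicity replaces \<open>?g\<close> by the indicator of its bracket.
          Centring that indicator costs its mean once more, hence the summand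
          \<open>2 * n * prob (S K)\<close>.\<close>
        have "\<bar>\<Sum>i<n. ?g (X i) - expectation ?g\<bar> \<le> (\<Sum>i<n. indicat_real (S K) (X i) + prob (S K))"
          by (intro order_trans[OF sum_abs] sum_mono order_trans[OF abs_triangle_ineq4] add_mono g_le Eg)
        also have "\<dots> = (\<Sum>i<n. indicat_real (S K) (X i) - expectation (indicat_real (S K))) + 2 * n * prob (S K)"
          by (simp add: sum.distrib sum_subtractf)
        finally have "\<bar>?\<nu> ?g X\<bar> \<le> ?\<nu> (indicat_real (S K)) X + 2 * n * prob (S K) / sqrt n"
          unfolding empirical_process_def
          by (simp add: add_divide_distrib[symmetric] divide_right_mono)
        also have "2 * n * prob (S K) / sqrt n = 2 * sqrt n * prob (S K)"
          using n by (simp add: field_simps)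
        also have "\<dots> \<le> 2 * (2 * 2 ^ K) * (c / 2 ^ K)"
          using K2 meas[OF BS(1)[of K]] by (intro mult_mono) auto
        also have "\<dots> = 4 * c" by simp
        also have "?\<nu> (indicat_real (S K)) X \<le> DS X"
          by (rule order_trans[OF abs_ge_self], rule DS) (use BS(1)[of K] in \<open>force simp: FS_def\<close>)
        finally show ?thesis by simp
      qed
      show ?thesis unfolding split E_def using 0 1 2 by linarith
    qed
    have "P.expectation E = P.expectation D0 + (\<Sum>k<K. P.expectation (D k)) + P.expectation DS + 4 * c"
      unfolding E_def using D0(1) sum_int DS(1) P.prob_space by (simp add: sum_eq)
    also have "\<dots> \<le> (ln (2 * a) + 1) + (\<Sum>k<K. chaining_increment a b c k) + chaining_increment a b c K + 4 * c"
      using D0(3) DS_le by (intro add_mono sum_mono D(3)) auto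
    also have "\<dots> \<le> (ln (2 * a) + 1) + (\<Sum>k. chaining_increment a b c k) + 4 * c"
    proof -
      have "(\<Sum>k<Suc K. chaining_increment a b c k) \<le> (\<Sum>k. chaining_increment a b c k)"
        by (rule sum_le_suminf) (use summable_chaining_increment chaining_increment_nonneg ab c in auto)
      then show ?thesis by simp
    qed
    finally show "P.expectation E \<le> chaining_constant a b c" by (simp add: chaining_constant_def)
  qed
qed

end

section \<open>Slabs and a finite net of halfspaces\<close>

lemma measure_lborel_translate:
  fixes S :: "'a::euclidean_space set"
  assumes [measurable]: "S \<in> sets borel"
  shows "{x. x - u \<in> S} \<in> sets borel" "measure lborel {x. x - u \<in> S} = measure lborel S"
proof -
  show *[measurable]: "{x. x - u \<in> S} \<in> sets borel" by measurable
  have "measure lborel {x. x - u \<in> S} = measure (distr lborel borel ((+) u)) {x. x - u \<in> S}"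
    by (simp add: lborel_distr_plus)
  also have "\<dots> = measure lborel S" by (subst measure_distr) (auto simp: vimage_def)
  finally show "measure lborel {x. x - u \<in> S} = measure lborel S" .
qed

definition slab :: "'a::euclidean_space \<Rightarrow> real \<Rightarrow> real \<Rightarrow> 'a set" where
  "slab w b r = {x. norm x \<le> 1 \<and> \<bar>w \<bullet> x - b\<bar> \<le> r}"

lemma sets_slab [measurable]: "slab w b r \<in> sets borel"
  unfolding slab_def by measurable

lemma slab_subset: "slab w b r \<subseteq> cball 0 1"
  by (auto simp: slab_def)

lemma fmeasurable_lborel_bounded:
  assumes "S \<in> sets borel" "bounded (S :: 'a::euclidean_space set)"
  shows "S \<in> fmeasurable lborel"
proof -
  obtain e where e: "S \<subseteq> cball 0 e" using assms(2) by (auto simp: bounded_iff subset_iff)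
  show ?thesis
    by (rule fmeasurableI2[of "cball 0 e"]) (use e assms emeasure_lborel_cball_finite in \<open>auto intro!: fmeasurableI\<close>)
qed

text \<open>About \<open>1 / r\<close> disjoint translates of the slab fit into a fixed ball.\<close>

lemma measure_slab_le:
  fixes w :: "'a::euclidean_space"
  assumes w: "1/2 \<le> norm w" and r: "0 < r"
  shows "measure lborel (slab w b r) \<le> measure lborel (cball (0::'a) 7) * r"
proof (cases "r < 1")
  case False
  have "measure lborel (slab w b r) \<le> measure lborel (cball (0::'a) 7)"
    by (rule measure_mono_fmeasurable)
       (auto simp: slab_def intro!: fmeasurable_lborel_bounded)
  also have "\<dots> \<le> measure lborel (cball (0::'a) 7) * r"
    using False mult_left_mono[of 1 r "measure lborel (cball (0::'a) 7)"] by simp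
  finally show ?thesis .
next
  case True
  define m where "m = nat \<lfloor>1 / r\<rfloor>"
  have m: "m * r \<le> 1" "1 \<le> (real m + 1) * r"
  proof -
    have "real m \<le> 1 / r" "1 / r \<le> real m + 1" using r unfolding m_def by auto
    then show "m * r \<le> 1" "1 \<le> (real m + 1) * r" using r by (simp_all add: field_simps)
  qed
  \<comment> \<open>The shifts satisfy \<open>w \<bullet> u i = 3 * r * i\<close>, while a slab has
    extent \<open>2 * r\<close> in this direction, so the translates are disjoint. Since
    \<open>m * r \<le> 1\<close> and \<open>norm w \<ge> 1/2\<close>, the shifts have norm at most
    6; this is the origin of the radius 7.\<close>
  define u where "u i = (3 * r * real i / (norm w)\<^sup>2) *\<^sub>R w" for i
  have w0: "0 < norm w" using w by linarith
  have wu: "w \<bullet> u i = 3 * r * i" for i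
    using w0 by (simp add: u_def power2_norm_eq_inner)
  have nu: "norm (u i) \<le> 6" if "i \<le> m" for i
  proof -
    have "norm (u i) = 3 * (i * r) / norm w" using w0 r by (simp add: u_def power2_eq_square)
    also have "\<dots> \<le> 3 * (m * r) / (1/2)"
      using that r w by (intro frac_le mult_left_mono mult_right_mono) auto
    also have "\<dots> \<le> 6" using m(1) by simp
    finally show ?thesis .
  qed
  define T where "T i = {x. x - u i \<in> slab w b r}" for i
  have disj: "disjoint_family_on T {..m}"
  proof (unfold disjoint_family_on_def, intro ballI impI)
    fix i j assume ij: "i \<in> {..m}" "j \<in> {..m}" "i \<noteq> j"
    show "T i \<inter> T j = {}"
    proof (rule ccontr)
      assume "T i \<inter> T j \<noteq> {}"
      then obtain x where "\<bar>w \<bullet> (x - u i) - b\<bar> \<le> r" "\<bar>w \<bullet> (x - u j) - b\<bar> \<le> r"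
        by (auto simp: T_def slab_def)
      then have "\<bar>3 * r * i - 3 * r * j\<bar> \<le> 2 * r"
        unfolding inner_diff_right wu by linarith
      also have "3 * r * i - 3 * r * j = 3 * r * (real i - real j)" by (simp add: algebra_simps)
      also have "\<bar>3 * r * (real i - real j)\<bar> = 3 * r * \<bar>real i - real j\<bar>" using r by (simp add: abs_mult)
      finally have "3 * \<bar>real i - real j\<bar> \<le> 2" using r by simp
      moreover have "i + 1 \<le> j \<or> j + 1 \<le> i" using ij(3) by auto
      then have "1 \<le> \<bar>real i - real j\<bar>" by auto
      then have "3 * 1 \<le> 3 * \<bar>real i - real j\<bar>" by (rule mult_left_mono) simp
      ultimately have "3 * 1 \<le> (2::real)" by (rule order_trans[rotated])
      then show False by simp
    qed
  qed
  have sub: "(\<Union>i\<in>{..m}. T i) \<subseteq> cball 0 7"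
  proof
    fix x assume "x \<in> (\<Union>i\<in>{..m}. T i)"
    then obtain i where i: "i \<le> m" "norm (x - u i) \<le> 1" by (auto simp: T_def slab_def)
    then show "x \<in> cball 0 7" using nu[OF i(1)] norm_triangle_sub[of x "u i"] by simp
  qed
  have T: "T i \<in> sets borel" "measure lborel (T i) = measure lborel (slab w b r)" for i
    unfolding T_def by (auto intro!: measure_lborel_translate)
  have fin: "T i \<in> fmeasurable lborel" if "i \<le> m" for i
  proof (rule fmeasurable_lborel_bounded[OF T(1)])
    show "bounded (T i)" by (rule bounded_subset[of "cball 0 7"]) (use sub that in auto)
  qed
  have "(real m + 1) * measure lborel (slab w b r) = (\<Sum>i\<in>{..m}. measure lborel (T i))"
    by (simp add: T)
  also have "\<dots> = measure lborel (\<Union>i\<in>{..m}. T i)"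
    by (rule measure_finite_Union[symmetric]) (use disj fin in \<open>auto simp: fmeasurable_def T less_top\<close>)
  also have "\<dots> \<le> measure lborel (cball (0::'a) 7)"
    by (rule measure_mono_fmeasurable) (use sub T in \<open>auto intro!: fmeasurable_lborel_bounded\<close>)
  finally have "(real m + 1) * measure lborel (slab w b r) * r \<le> measure lborel (cball (0::'a) 7) * r"
    using r by (simp add: mult_right_mono)
  moreover have "measure lborel (slab w b r) * 1 \<le> measure lborel (slab w b r) * ((real m + 1) * r)"
    by (rule mult_left_mono) (use m in auto)
  ultimately show ?thesis by (simp add: algebra_simps)
qed

definition halfspace :: "'a::euclidean_space \<Rightarrow> real \<Rightarrow> 'a set" where
  "halfspace w b = {x. b \<le> w \<bullet> x}"

lemma sets_halfspace [measurable]: "halfspace w b \<in> sets borel"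
  unfolding halfspace_def by measurable

text \<open>Directions are rounded coordinatewise and not renormalised; the condition on the norm
  keeps the slab estimate applicable. The mesh \<open>1 / (DIM('a) * m)\<close> makes the l1
  rounding error at most \<open>1 / m\<close>. Offsets stop at 1, since a halfspace with a unit
  normal and a larger offset misses the unit ball.\<close>

definition halfspace_net :: "nat \<Rightarrow> ('a::euclidean_space \<times> real) set" where
  "halfspace_net m = {(w, b). 1/2 \<le> norm w \<and> norm w \<le> 2 \<and> (w, b) \<in>
     (\<lambda>(v, i). (\<Sum>e\<in>Basis. (real_of_int (v e) / (DIM('a) * m)) *\<^sub>R e, real i / m)) `
       ((Basis \<rightarrow>\<^sub>E {- int (DIM('a) * m)..int (DIM('a) * m)}) \<times> {0..m})}"

lemma halfspace_net_card:
  assumes m: "1 \<le> m"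
  shows "finite (halfspace_net m :: ('a::euclidean_space \<times> real) set)"
    "card (halfspace_net m :: ('a \<times> real) set) \<le> (4 * DIM('a) * m) ^ (DIM('a) + 1)"
proof -
  let ?F = "\<lambda>(v, i). (\<Sum>e\<in>Basis. (real_of_int (v e) / (DIM('a) * m)) *\<^sub>R (e::'a), real i / m)"
  let ?V = "(Basis :: 'a set) \<rightarrow>\<^sub>E {- int (DIM('a) * m)..int (DIM('a) * m)}"
  have fin: "finite (?V \<times> {0..m})" by (auto intro!: finite_PiE)
  have sub: "halfspace_net m \<subseteq> ?F ` (?V \<times> {0..m})" unfolding halfspace_net_def by blast
  show "finite (halfspace_net m :: ('a \<times> real) set)"
    by (rule finite_subset[OF sub]) (use fin in auto)
  have d: "1 \<le> DIM('a) * m" using m DIM_positive[where 'a='a] by (simp add: Suc_le_eq)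
  have card_int: "card {- int N..int N} = 2 * N + 1" for N by simp
  have "card (halfspace_net m :: ('a \<times> real) set) \<le> card (?V \<times> {0..m})"
    using surj_card_le[OF fin sub] .
  also have "\<dots> = (2 * (DIM('a) * m) + 1) ^ DIM('a) * (m + 1)"
    by (simp only: card_cartesian_product card_PiE finite_Basis card_int prod_constant card_atLeastAtMost) simp
  also have "\<dots> \<le> (4 * DIM('a) * m) ^ DIM('a) * (4 * DIM('a) * m)"
  proof (intro mult_mono power_mono)
    have "m \<le> DIM('a) * m" by simp
    then show "m + 1 \<le> 4 * DIM('a) * m" using m by linarith
    show "2 * (DIM('a) * m) + 1 \<le> 4 * DIM('a) * m" using d by linarith
  qed auto
  finally show "card (halfspace_net m :: ('a \<times> real) set) \<le> (4 * DIM('a) * m) ^ (DIM('a) + 1)"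
    by (simp add: mult.commute)
qed

lemma halfspace_net_norm:
  assumes "(w, b) \<in> halfspace_net m"
  shows "1/2 \<le> norm w" "norm w \<le> 2"
  using assms by (auto simp: halfspace_net_def)

lemma floor_mem_symmetric_interval:
  fixes y :: real
  assumes "- real N \<le> y" "y \<le> real N"
  shows "\<lfloor>y\<rfloor> \<in> {- int N..int N}"
  using assms by (simp add: le_floor_iff floor_le_iff)

lemma floor_mult_div_bounds:
  fixes a d :: real
  assumes "0 < d"
  shows "\<lfloor>a * d\<rfloor> / d \<le> a" "a \<le> \<lfloor>a * d\<rfloor> / d + 1 / d"
proof -
  have "a * d \<le> \<lfloor>a * d\<rfloor> + 1" by linarith
  then have "a \<le> (\<lfloor>a * d\<rfloor> + 1) / d" using assms by (simp add: pos_le_divide_eq)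
  then show "a \<le> \<lfloor>a * d\<rfloor> / d + 1 / d" by (simp add: add_divide_distrib)
qed (use assms in \<open>simp add: pos_divide_le_eq\<close>)

text \<open>On the unit ball, rounding the normal and rounding the offset each move the defining
  inequality by at most \<open>1 / m\<close>, so the two halfspaces disagree only where
  \<open>w' \<bullet> x\<close> is within \<open>2 / m\<close> of \<open>b'\<close>. Outside the
  ball nothing is claimed, whence the complement of the ball in the bracket.\<close>

lemma halfspace_net_approx:
  fixes w :: "'a::euclidean_space"
  assumes m: "2 \<le> m" and w: "norm w = 1" and t: "0 \<le> t"
  obtains w' b' where "(w', b') \<in> halfspace_net m"
    "(halfspace w t - halfspace w' b') \<union> (halfspace w' b' - halfspace w t) \<subseteq> slab w' b' (2 / m) \<union> - cball 0 1"
proof -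
  let ?d = "real (DIM('a) * m)"
  have d: "0 < ?d" using m by simp
  define v where "v = (\<lambda>e\<in>Basis. \<lfloor>(w \<bullet> e) * ?d\<rfloor>)"
  \<comment> \<open>Larger offsets are treated as 1. On the unit ball
    \<open>w \<bullet> x \<le> 1\<close>, so every ball point outside the halfspace still satisfies
    \<open>w \<bullet> x \<le> s\<close>.\<close>
  define s where "s = min t 1"
  define i where "i = nat \<lfloor>s * m\<rfloor>"
  define w' where "w' = (\<Sum>e\<in>Basis. (real_of_int (v e) / ?d) *\<^sub>R e)"
  define b' where "b' = real i / m"
  have s: "0 \<le> s" "s \<le> 1" using t by (auto simp: s_def)
  have v: "v \<in> Basis \<rightarrow>\<^sub>E {- int (DIM('a) * m)..int (DIM('a) * m)}"
  proof (rule PiE_I)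
    fix e :: 'a assume e: "e \<in> Basis"
    have "\<bar>w \<bullet> e\<bar> \<le> 1" using Basis_le_norm[OF e, of w] w by simp
    then have "- ?d \<le> (w \<bullet> e) * ?d \<and> (w \<bullet> e) * ?d \<le> ?d"
      using d mult_right_mono[of "w \<bullet> e" 1 ?d] mult_right_mono[of "-1" "w \<bullet> e" ?d] by (auto simp: abs_le_iff)
    then have "- ?d \<le> (w \<bullet> e) * ?d" "(w \<bullet> e) * ?d \<le> ?d" by auto
    then have "\<lfloor>(w \<bullet> e) * ?d\<rfloor> \<in> {- int (DIM('a) * m)..int (DIM('a) * m)}"
      by (rule floor_mem_symmetric_interval)
    then show "v e \<in> {- int (DIM('a) * m)..int (DIM('a) * m)}" using e by (simp add: v_def)
  qed (simp add: v_def)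
  have i: "i \<in> {0..m}"
  proof -
    have "s * m \<le> m" using s mult_right_mono[of s 1 m] by simp
    then have "\<lfloor>s * m\<rfloor> \<le> int m" by (simp add: floor_le_iff)
    then show ?thesis by (simp add: i_def)
  qed
  have b': "b' \<le> s" "s \<le> b' + 1 / m"
  proof -
    have "real i \<le> s * m" "s * m \<le> real i + 1" using s unfolding i_def by (auto simp: of_nat_nat)
    then show "b' \<le> s" "s \<le> b' + 1 / m" using m by (auto simp: b'_def field_simps)
  qed
  have ww': "norm (w - w') \<le> 1 / m"
  proof -
    have "norm (w - w') \<le> (\<Sum>e\<in>Basis. \<bar>(w - w') \<bullet> e\<bar>)" by (rule norm_le_l1)
    also have "\<dots> \<le> (\<Sum>e\<in>(Basis::'a set). 1 / ?d)"
    proof (rule sum_mono)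
      fix e :: 'a assume e: "e \<in> Basis"
      have "w' \<bullet> e = real_of_int \<lfloor>(w \<bullet> e) * ?d\<rfloor> / ?d"
        using e by (simp add: w'_def v_def inner_sum_left inner_Basis if_distrib cong: if_cong)
      then have "w' \<bullet> e \<le> w \<bullet> e" "w \<bullet> e \<le> w' \<bullet> e + 1 / ?d"
        using floor_mult_div_bounds[OF d, of "w \<bullet> e"] by simp_all
      then show "\<bar>(w - w') \<bullet> e\<bar> \<le> 1 / ?d" by (simp add: inner_diff_left)
    qed
    also have "\<dots> = 1 / m" by simp
    finally show ?thesis .
  qed
  have half: "1 / real m \<le> 1/2" using m by (simp add: field_simps)
  have nw': "1/2 \<le> norm w'" "norm w' \<le> 2"
    using ww' w half norm_triangle_ineq2[of w w'] norm_triangle_ineq2[of w' w] by (auto simp: norm_minus_commute)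
  show thesis
  proof (rule that[of w' b'])
    show "(w', b') \<in> halfspace_net m"
      unfolding halfspace_net_def using nw' v i by (auto simp: w'_def b'_def intro!: image_eqI[of _ _ "(v, i)"])
    have "\<bar>w' \<bullet> x - b'\<bar> \<le> 2 / m"
      if x: "norm x \<le> 1" and ne: "(t \<le> w \<bullet> x) \<noteq> (b' \<le> w' \<bullet> x)" for x
    proof -
      have "\<bar>(w - w') \<bullet> x\<bar> \<le> norm (w - w') * norm x" by (rule Cauchy_Schwarz_ineq2)
      also have "\<dots> \<le> 1 / m * 1" by (rule mult_mono[OF ww' x]) auto
      finally have 1: "\<bar>w \<bullet> x - w' \<bullet> x\<bar> \<le> 1 / m" by (simp add: inner_diff_left)
      have "w \<bullet> x \<le> norm w * norm x" by (rule norm_cauchy_schwarz)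
      then have 2: "w \<bullet> x \<le> 1" using w x by simp
      show ?thesis
      proof (cases "t \<le> w \<bullet> x")
        case True
        then have "s = t" using 2 by (simp add: s_def)
        then show ?thesis using True ne 1 b' by (auto simp: field_simps)
      next
        case False
        then have "w \<bullet> x \<le> s" using 2 by (simp add: s_def)
        then have "w' \<bullet> x - b' \<le> 1 / m + 1 / m" using 1 b' by linarith
        then show ?thesis using False ne by (auto simp: field_simps)
      qed
    qed
    then show "(halfspace w t - halfspace w' b') \<union> (halfspace w' b' - halfspace w t) \<subseteq> slab w' b' (2 / m) \<union> - cball 0 1"
      by (fastforce simp: halfspace_def slab_def)
  qed
qed

section \<open>The expected halfspace statistic\<close>

definition pdf_measure :: "('a::euclidean_space \<Rightarrow> real) \<Rightarrow> 'a measure" where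
  "pdf_measure p = density lborel (\<lambda>x. ennreal (p x))"

lemma sets_pdf_measure [measurable_cong, simp]: "sets (pdf_measure p) = sets borel"
  by (simp add: pdf_measure_def)

lemma space_pdf_measure [simp]: "space (pdf_measure p) = UNIV"
  by (simp add: pdf_measure_def)

lemma prob_space_pdf_measure:
  assumes "pdf_on_unit_ball p"
  shows "prob_space (pdf_measure p)"
proof
  show "emeasure (pdf_measure p) (space (pdf_measure p)) = 1"
    using assms by (simp add: pdf_measure_def pdf_on_unit_ball_def emeasure_density)
qed

text \<open>The complement of the ball carries no mass, so the brackets may contain it at no cost;
  on the slab the density is at most \<open>B\<close>.\<close>

lemma pdf_measure_slab_le:
  fixes p :: "'a::euclidean_space \<Rightarrow> real"
  assumes p: "pdf_on_unit_ball p" and B: "\<And>x. p x \<le> B" and w: "1/2 \<le> norm w" and r: "0 < r"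
  shows "measure (pdf_measure p) (slab w b r \<union> - cball 0 1) \<le> B * (measure lborel (cball (0::'a) 7) * r)"
proof -
  have [measurable]: "p \<in> borel_measurable borel" and p0: "0 \<le> p x" and supp: "x \<notin> cball 0 1 \<Longrightarrow> p x = 0" for x
    using p by (auto simp: pdf_on_unit_ball_def)
  have B0: "0 \<le> B" using p0[of undefined] B[of undefined] by simp
  have fin: "emeasure lborel (slab w b r) = ennreal (measure lborel (slab w b r))"
    using fmeasurable_lborel_bounded[of "slab w b r"] bounded_subset[OF bounded_cball slab_subset]
    by (intro emeasure_eq_ennreal_measure) (auto simp: fmeasurable_def less_top)
  have "emeasure (pdf_measure p) (slab w b r \<union> - cball 0 1)
      = (\<integral>\<^sup>+ x. ennreal (p x) * indicator (slab w b r \<union> - cball 0 1) x \<partial>lborel)"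
    unfolding pdf_measure_def by (rule emeasure_density) auto
  also have "\<dots> \<le> (\<integral>\<^sup>+ x. ennreal B * indicator (slab w b r) x \<partial>lborel)"
    by (rule nn_integral_mono) (use supp in \<open>auto simp: indicator_def ennreal_leI[OF B]\<close>)
  also have "\<dots> = ennreal B * emeasure lborel (slab w b r)"
    by (simp add: nn_integral_cmult_indicator)
  also have "\<dots> = ennreal (B * measure lborel (slab w b r))"
    by (simp add: fin ennreal_mult B0)
  also have "\<dots> \<le> ennreal (B * (measure lborel (cball (0::'a) 7) * r))"
    by (intro ennreal_leI mult_left_mono measure_slab_le w r B0)
  finally show ?thesis
    unfolding measure_def using B0 r by (intro enn2real_leI) auto
qed

text \<open>A net of mesh parameter \<open>2 ^ Suc k\<close> has at most
  \<open>(4 * DIM('a) * 2 ^ Suc k) ^ (DIM('a) + 1)\<close> members. Writing this as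
  \<open>a * b ^ k\<close> gives the first two arguments; the third is the mass bound for slabs per
  unit of half-width.\<close>

definition halfspace_chaining_constant :: "'a::euclidean_space itself \<Rightarrow> real \<Rightarrow> real" where
  "halfspace_chaining_constant _ B = chaining_constant ((8 * DIM('a)) ^ (DIM('a) + 1)) (2 ^ (DIM('a) + 1))
     (B * measure lborel (cball (0::'a) 7))"

lemma halfspace_empirical_process:
  fixes p :: "'a::euclidean_space \<Rightarrow> real"
  assumes p: "pdf_on_unit_ball p" and B: "\<And>x. p x \<le> B" and n: "0 < n"
  obtains D where "integrable (sample_measure n p) D"
    "\<And>w b X. norm w = 1 \<Longrightarrow> 0 \<le> b \<Longrightarrow>
       \<bar>empirical_process (pdf_measure p) n (indicat_real (halfspace w b)) X\<bar> \<le> D X"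
    "(LINT X|sample_measure n p. D X) \<le> halfspace_chaining_constant TYPE('a) B"
proof -
  interpret prob_space "pdf_measure p" by (rule prob_space_pdf_measure[OF p])
  have B0: "0 \<le> B" using p B[of undefined] by (auto simp: pdf_on_unit_ball_def intro: order_trans)
  \<comment> \<open>The index is \<open>Suc k\<close> because a net with parameter \<open>m\<close>
    leaves slabs of half-width \<open>2 / m\<close>, here \<open>1 / 2 ^ k\<close>. At
    \<open>k = 0\<close> this is also the smallest parameter that
    \<open>halfspace_net_approx\<close> admits.\<close>
  define G where "G k = (\<lambda>(w, b). (halfspace w b, slab w b (1 / 2 ^ k) \<union> - cball 0 1)) `
      (halfspace_net (2 ^ Suc k) :: ('a \<times> real) set)" for k
  define \<H> where "\<H> = {halfspace w b | w b. norm (w::'a) = 1 \<and> 0 \<le> b}"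
  have sample: "sample_measure n p = (\<Pi>\<^sub>M i\<in>{..<n}. pdf_measure p)"
    by (simp add: sample_measure_def pdf_measure_def)
  have d1: "1 \<le> real (DIM('a))" using DIM_positive[where 'a='a] by (simp add: Suc_le_eq)
  show thesis
  proof (rule bracketing_chaining[OF n, of "(8 * DIM('a)) ^ (DIM('a) + 1)" "2 ^ (DIM('a) + 1)"
        "B * measure lborel (cball (0::'a) 7)" G \<H>])
    show "1 \<le> real ((8 * DIM('a)) ^ (DIM('a) + 1))"
    proof -
      have "1 \<le> real (8 * DIM('a))" using d1 unfolding of_nat_mult by linarith
      then show ?thesis unfolding of_nat_power by (rule one_le_power)
    qed
    show "(1::real) \<le> 2 ^ (DIM('a) + 1)" by (rule one_le_power) simp
    show "0 \<le> B * measure lborel (cball (0::'a) 7)" using B0 by simp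
    show "finite (G k)" for k unfolding G_def by (intro finite_imageI halfspace_net_card) simp
    show "real (card (G k)) \<le> real ((8 * DIM('a)) ^ (DIM('a) + 1)) * (2 ^ (DIM('a) + 1)) ^ k" for k
    proof -
      have "card (G k) \<le> card (halfspace_net (2 ^ Suc k) :: ('a \<times> real) set)"
        unfolding G_def by (rule card_image_le[OF halfspace_net_card(1)]) simp
      also have "\<dots> \<le> (4 * DIM('a) * 2 ^ Suc k) ^ (DIM('a) + 1)"
        by (rule halfspace_net_card(2)) simp
      also have "4 * DIM('a) * 2 ^ Suc k = (8 * DIM('a)) * 2 ^ k" by simp
      also have "\<dots> ^ (DIM('a) + 1) = (8 * DIM('a)) ^ (DIM('a) + 1) * (2 ^ (DIM('a) + 1)) ^ k"
        by (simp only: power_mult_distrib power_mult[symmetric] mult.commute)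
      finally have "real (card (G k)) \<le> real ((8 * DIM('a)) ^ (DIM('a) + 1) * (2 ^ (DIM('a) + 1)) ^ k)"
        by (simp only: of_nat_le_iff)
      then show ?thesis by simp
    qed
    show "A \<in> events \<and> S \<in> events \<and> prob S \<le> B * measure lborel (cball (0::'a) 7) / 2 ^ k"
      if "(A, S) \<in> G k" for k A S
    proof -
      from that obtain w b where wb: "(w, b) \<in> halfspace_net (2 ^ Suc k)" "A = halfspace w b"
        "S = slab w b (1 / 2 ^ k) \<union> - cball 0 1"
        by (auto simp: G_def)
      show ?thesis
        using pdf_measure_slab_le[OF p B halfspace_net_norm(1)[OF wb(1)], of "1 / 2 ^ k" b] wb(2,3) by auto
    qed
    show "A \<in> events" if "A \<in> \<H>" for A using that by (auto simp: \<H>_def)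
    show "\<exists>(A', S)\<in>G k. (A - A') \<union> (A' - A) \<subseteq> S" if "A \<in> \<H>" for k A
    proof -
      from that obtain w b where wb: "norm w = 1" "0 \<le> b" "A = halfspace w b" by (auto simp: \<H>_def)
      have "2 \<le> (2::nat) ^ Suc k" by simp
      from halfspace_net_approx[OF this wb(1,2)] obtain w' b' where
        "(w', b') \<in> halfspace_net (2 ^ Suc k)"
        "(A - halfspace w' b') \<union> (halfspace w' b' - A) \<subseteq> slab w' b' (2 / real (2 ^ Suc k)) \<union> - cball 0 1"
        unfolding wb(3) by blast
      moreover have "2 / real (2 ^ Suc k) = 1 / 2 ^ k" by simp
      ultimately have "(halfspace w' b', slab w' b' (1 / 2 ^ k) \<union> - cball 0 1) \<in> G k"
        "(A - halfspace w' b') \<union> (halfspace w' b' - A) \<subseteq> slab w' b' (1 / 2 ^ k) \<union> - cball 0 1"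
        unfolding G_def by (auto intro!: image_eqI[of _ _ "(w', b')"] simp del: Un_subset_iff)
      then show ?thesis by blast
    qed
    fix D assume D: "integrable (\<Pi>\<^sub>M i\<in>{..<n}. pdf_measure p) D"
      "\<And>A X. A \<in> \<H> \<Longrightarrow> \<bar>empirical_process (pdf_measure p) n (indicat_real A) X\<bar> \<le> D X"
      "(LINT X|(\<Pi>\<^sub>M i\<in>{..<n}. pdf_measure p). D X) \<le> chaining_constant (real ((8 * DIM('a)) ^ (DIM('a) + 1)))
         (2 ^ (DIM('a) + 1)) (B * measure lborel (cball (0::'a) 7))"
    show thesis
    proof (rule that[of D])
      show "integrable (sample_measure n p) D" unfolding sample by (rule D)
      show "\<bar>empirical_process (pdf_measure p) n (indicat_real (halfspace w b)) X\<bar> \<le> D X"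
        if "norm w = 1" "0 \<le> b" for w b X
        by (rule D(2)) (use that in \<open>auto simp: \<H>_def\<close>)
      show "(LINT X|sample_measure n p. D X) \<le> halfspace_chaining_constant TYPE('a) B"
        unfolding sample halfspace_chaining_constant_def using D(3) by simp
    qed
  qed
qed

lemma integral_empirical_measure:
  fixes f :: "'a::euclidean_space \<Rightarrow> real"
  assumes "0 < n" "f \<in> borel_measurable borel"
  shows "(LINT x|empirical_measure n X. f x) = (\<Sum>i<n. f (X i)) / n"
proof -
  have "X \<in> measurable (uniform_count_measure {..<n}) borel"
    by (auto simp: measurable_def sets_uniform_count_measure space_uniform_count_measure)
  then show ?thesis
    unfolding empirical_measure_def using assms
    by (subst integral_distr) (auto simp: integral_uniform_count_measure)
qed

text \<open>For every halfspace the discrepancy of the samples is at most the population discrepancy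
  plus the two sampling errors. The envelopes bound these errors uniformly, so the statistic is
  dominated pointwise by an integrable function on the product space.\<close>

lemma expected_halfspace_stat_le:
  fixes p q :: "'a::euclidean_space \<Rightarrow> real"
  assumes p: "pdf_on_unit_ball p" "\<And>x. p x \<le> B" and q: "pdf_on_unit_ball q" "\<And>x. q x \<le> B" and n: "0 < n"
    and pop: "\<And>w b. norm w = 1 \<Longrightarrow> 0 \<le> b \<Longrightarrow>
      \<bar>measure (pdf_measure p) (halfspace w b) - measure (pdf_measure q) (halfspace w b)\<bar> \<le> \<eta>"
  shows "expected_halfspace_stat n p q \<le> 2 * \<bar>halfspace_chaining_constant TYPE('a) B\<bar> / sqrt n + \<eta>"
proof -
  let ?C = "halfspace_chaining_constant TYPE('a) B"
  let ?M = "sample_measure n p" and ?N = "sample_measure n q"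
  obtain D where D: "integrable ?M D" "\<And>w b X. norm w = 1 \<Longrightarrow> 0 \<le> b \<Longrightarrow>
       \<bar>empirical_process (pdf_measure p) n (indicat_real (halfspace w b)) X\<bar> \<le> D X"
    "(LINT X|?M. D X) \<le> ?C"
    using halfspace_empirical_process[OF p n] by blast
  obtain E where E: "integrable ?N E" "\<And>w b X. norm w = 1 \<Longrightarrow> 0 \<le> b \<Longrightarrow>
       \<bar>empirical_process (pdf_measure q) n (indicat_real (halfspace w b)) X\<bar> \<le> E X"
    "(LINT X|?N. E X) \<le> ?C"
    using halfspace_empirical_process[OF q n] by blast
  have prob: "prob_space ?M" "prob_space ?N"
    unfolding sample_measure_def pdf_measure_def[symmetric]
    by (auto intro!: prob_space_PiM prob_space_pdf_measure p q)
  interpret M: prob_space ?M by (rule prob)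
  interpret N: prob_space ?N by (rule prob)
  interpret MN: pair_prob_space ?M ?N ..
  let ?S = "\<lambda>(X, Y). halfspace_stat (empirical_measure n X) (empirical_measure n Y)"
  let ?T = "\<lambda>(X, Y). (D X + E Y) / sqrt n + \<eta>"
  have dev: "(\<Sum>i<n. indicat_real (halfspace w b) (X i)) / n
      = measure (pdf_measure r) (halfspace w b) + empirical_process (pdf_measure r) n (indicat_real (halfspace w b)) X / sqrt n"
    for w b X and r :: "'a \<Rightarrow> real"
    using n by (simp add: empirical_process_def sum_subtractf field_simps)
  have le: "?S z \<le> ?T z" for z
  proof -
    obtain X Y where z: "z = (X, Y)" by (cases z)
    have ne: "sphere 0 1 \<times> {0..} \<noteq> ({} :: ('a \<times> real) set)"
      using vector_choose_size[of 1] by fastforce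
    have "halfspace_stat (empirical_measure n X) (empirical_measure n Y) \<le> (D X + E Y) / sqrt n + \<eta>"
      unfolding halfspace_stat_def
    proof (rule cSUP_least[OF ne])
      fix z :: "'a \<times> real" assume "z \<in> sphere 0 1 \<times> {0..}"
      then obtain w b where z: "z = (w, b)" and wb: "norm w = 1" "0 \<le> b" by auto
      have H: "{x. w \<bullet> x - b \<ge> 0} = halfspace w b" by (simp add: halfspace_def)
      let ?d = "\<lambda>r Z. empirical_process (pdf_measure r) n (indicat_real (halfspace w b)) Z / sqrt n"
      have 1: "\<bar>?d p X\<bar> \<le> D X / sqrt n" "\<bar>?d q Y\<bar> \<le> E Y / sqrt n"
        using D(2)[OF wb, of X] E(2)[OF wb, of Y] n by (auto simp: divide_right_mono)
      have eq: "(LINT x|empirical_measure n X. indicat_real {x. w \<bullet> x - b \<ge> 0} x)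
            = measure (pdf_measure p) (halfspace w b) + ?d p X"
          "(LINT y|empirical_measure n Y. indicat_real {y. w \<bullet> y - b \<ge> 0} y)
            = measure (pdf_measure q) (halfspace w b) + ?d q Y"
        unfolding H by (simp_all only: integral_empirical_measure[OF n borel_measurable_indicator[OF sets_halfspace]] dev)
      have "\<bar>(LINT x|empirical_measure n X. indicat_real {x. w \<bullet> x - b \<ge> 0} x)
            - (LINT y|empirical_measure n Y. indicat_real {y. w \<bullet> y - b \<ge> 0} y)\<bar> \<le> (D X + E Y) / sqrt n + \<eta>"
        unfolding eq add_divide_distrib using 1 pop[OF wb] by linarith
      then show "(case z of (w, b) \<Rightarrow> \<bar>(LINT x|empirical_measure n X. indicat_real {x. w \<bullet> x - b \<ge> 0} x)
            - (LINT y|empirical_measure n Y. indicat_real {y. w \<bullet> y - b \<ge> 0} y)\<bar>) \<le> (D X + E Y) / sqrt n + \<eta>"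
        by (simp only: z prod.case)
    qed
    then show ?thesis by (simp add: z)
  qed
  have fst: "integrable (?M \<Otimes>\<^sub>M ?N) (\<lambda>z. D (fst z))" "(\<integral>z. D (fst z) \<partial>(?M \<Otimes>\<^sub>M ?N)) = (LINT X|?M. D X)"
  proof -
    have d: "distr (?M \<Otimes>\<^sub>M ?N) ?M fst = ?M" by (rule N.distr_pair_fst)
    show "integrable (?M \<Otimes>\<^sub>M ?N) (\<lambda>z. D (fst z))"
      using D(1) by (subst integrable_distr_eq[symmetric, of fst _ ?M]) (auto simp: d)
    show "(\<integral>z. D (fst z) \<partial>(?M \<Otimes>\<^sub>M ?N)) = (LINT X|?M. D X)"
      using D(1) by (subst (2) d[symmetric], subst integral_distr) auto
  qed
  have snd: "integrable (?M \<Otimes>\<^sub>M ?N) (\<lambda>z. E (snd z))" "(\<integral>z. E (snd z) \<partial>(?M \<Otimes>\<^sub>M ?N)) = (LINT X|?N. E X)"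
  proof -
    have d: "distr (?M \<Otimes>\<^sub>M ?N) ?N snd = ?N" 
    proof (rule measure_eqI)
      fix A assume "A \<in> sets (distr (?M \<Otimes>\<^sub>M ?N) ?N snd)"
      then have A: "A \<in> sets ?N" by simp
      have "snd -` A \<inter> space (?M \<Otimes>\<^sub>M ?N) = space ?M \<times> A"
        using sets.sets_into_space[OF A] by (auto simp: space_pair_measure)
      then show "emeasure (distr (?M \<Otimes>\<^sub>M ?N) ?N snd) A = emeasure ?N A"
        using A by (simp add: emeasure_distr N.emeasure_pair_measure_Times M.emeasure_space_1)
    qed simp
    show "integrable (?M \<Otimes>\<^sub>M ?N) (\<lambda>z. E (snd z))"
      using E(1) by (subst integrable_distr_eq[symmetric, of snd _ ?N]) (auto simp: d)
    show "(\<integral>z. E (snd z) \<partial>(?M \<Otimes>\<^sub>M ?N)) = (LINT X|?N. E X)"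
      using E(1) by (subst (2) d[symmetric], subst integral_distr) auto
  qed
  have T: "integrable (?M \<Otimes>\<^sub>M ?N) ?T" "integral\<^sup>L (?M \<Otimes>\<^sub>M ?N) ?T = ((LINT X|?M. D X) + (LINT Y|?N. E Y)) / sqrt n + \<eta>"
    unfolding case_prod_beta using fst snd MN.prob_space by simp_all
  have \<eta>0: "0 \<le> \<eta>"
  proof -
    obtain w :: 'a where "norm w = 1" using vector_choose_size[of 1] by auto
    then show ?thesis using pop[of w 0] by simp
  qed
  show ?thesis
  proof (cases "integrable (?M \<Otimes>\<^sub>M ?N) ?S")
    case True
    have "expected_halfspace_stat n p q \<le> integral\<^sup>L (?M \<Otimes>\<^sub>M ?N) ?T"
      unfolding expected_halfspace_stat_def by (rule integral_mono[OF True T(1) le])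
    also have "\<dots> \<le> (\<bar>?C\<bar> + \<bar>?C\<bar>) / sqrt n + \<eta>"
      unfolding T(2) using D(3) E(3) by (intro add_mono divide_right_mono) auto
    finally show ?thesis by simp
  next
    \<comment> \<open>A non-integrable function has Bochner integral 0, and \<eta> is nonnegative.
      This case split stands in for a measurability proof of the statistic.\<close>
    case False
    then have "expected_halfspace_stat n p q = 0"
      unfolding expected_halfspace_stat_def by (rule not_integrable_integral_eq)
    then show ?thesis using \<eta>0 by simp
  qed
qed

section \<open>Polynomial bumps and their Fourier transforms\<close>

text \<open>A truncated polynomial has only finite smoothness across 0 and 1, but any prescribed
  order can be reached through the zeros of \<open>P\<close>. The class is closed under
  \<open>pderiv\<close>, so integration by parts stays inside it.\<close>

definition poly_bump :: "real poly \<Rightarrow> real \<Rightarrow> real" where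
  "poly_bump P t = indicat_real {0..1} t * poly P t"

lemma borel_measurable_poly [measurable]: "(\<lambda>x::real. poly P x) \<in> borel_measurable borel"
  by (intro borel_measurable_continuous_onI continuous_intros)

lemma borel_measurable_poly_bump [measurable]: "poly_bump P \<in> borel_measurable borel"
  unfolding poly_bump_def by measurable

lemma poly_bump_bounded:
  obtains S where "0 < S" "\<And>t. \<bar>poly_bump P t\<bar> \<le> S"
proof -
  have "compact (poly P ` {0..1})"
    by (intro compact_continuous_image continuous_intros compact_Icc)
  then obtain S where "\<forall>y\<in>poly P ` {0..1}. norm y \<le> S"
    using compact_imp_bounded bounded_iff by metis
  then have S: "\<bar>poly P t\<bar> \<le> S" if "t \<in> {0..1}" for t using that by auto
  show thesis
  proof (rule that[of "\<bar>S\<bar> + 1"])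
    show "\<bar>poly_bump P t\<bar> \<le> \<bar>S\<bar> + 1" for t
      using S[of t] by (auto simp: poly_bump_def indicator_def)
  qed simp
qed

lemma integrable_compact_bounded:
  fixes f :: "'a::euclidean_space \<Rightarrow> real"
  assumes [measurable]: "f \<in> borel_measurable borel" and "\<And>x. \<bar>f x\<bar> \<le> S * indicator (cbox a b) x"
  shows "integrable lborel f"
proof (rule Bochner_Integration.integrable_bound)
  show "integrable lborel (\<lambda>x. S * indicat_real (cbox a b) x)"
    by (intro integrable_mult_right integrable_real_indicator) (auto simp: emeasure_lborel_cbox_finite[unfolded infinity_ennreal_def])
qed (use assms in \<open>auto intro!: AE_I2 intro: order_trans[OF _ abs_ge_self]\<close>)

lemma integrable_poly_bump: "integrable lborel (poly_bump P)"
proof -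
  obtain S where S: "0 < S" "\<And>t. \<bar>poly_bump P t\<bar> \<le> S" using poly_bump_bounded[of P] by blast
  have "\<bar>poly_bump P t\<bar> \<le> S * indicator (cbox 0 1) t" for t
    using S(1) S(2)[of t] by (cases "t \<in> {0..1}") (auto simp: poly_bump_def)
  then show ?thesis by (rule integrable_compact_bounded[OF borel_measurable_poly_bump])
qed

lemma integrable_fourier_integrand:
  fixes f :: "'a::euclidean_space \<Rightarrow> real"
  assumes f: "integrable lborel f"
  shows "integrable lborel (\<lambda>x. exp (- \<i> * of_real (x \<bullet> \<omega>)) * complex_of_real (f x))"
proof (rule Bochner_Integration.integrable_bound[OF f])
  have [measurable]: "f \<in> borel_measurable borel" using f by auto
  have "(\<lambda>x. exp (- \<i> * of_real (x \<bullet> \<omega>))) \<in> borel_measurable borel"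
    by (intro borel_measurable_continuous_onI continuous_intros)
  then show "(\<lambda>x. exp (- \<i> * of_real (x \<bullet> \<omega>)) * complex_of_real (f x)) \<in> borel_measurable lborel"
    by simp
qed (simp add: norm_mult)

lemma norm_fourier_transform_le:
  fixes f :: "'a::euclidean_space \<Rightarrow> real"
  assumes f: "integrable lborel f"
  shows "cmod (fourier_transform f \<omega>) \<le> (LINT x|lborel. \<bar>f x\<bar>)"
proof -
  have "cmod (fourier_transform f \<omega>) \<le> (LINT x|lborel. cmod (exp (- \<i> * of_real (x \<bullet> \<omega>)) * complex_of_real (f x)))"
    unfolding fourier_transform_def by (rule integral_norm_bound)
  then show ?thesis by (simp add: norm_mult)
qed

text \<open>Integration by parts on the unit interval; the two zeros of \<open>P\<close> remove the
  boundary terms.\<close>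

lemma fourier_transform_poly_bump_pderiv:
  assumes "poly P 0 = 0" "poly P 1 = 0"
  shows "fourier_transform (poly_bump (pderiv P)) \<tau> = \<i> * of_real \<tau> * fourier_transform (poly_bump P) \<tau>"
proof -
  let ?e = "\<lambda>t. exp (- \<i> * of_real (t * \<tau>))"
  let ?F = "\<lambda>t. ?e t * complex_of_real (poly P t)"
  let ?f = "\<lambda>t. ?e t * complex_of_real (poly (pderiv P) t) - \<i> * of_real \<tau> * (?e t * complex_of_real (poly P t))"
  have "(\<integral>t. indicator {0..1} t *\<^sub>R ?f t \<partial>lborel) = ?F 1 - ?F 0"
  proof (rule integral_FTC_Icc)
    show "continuous_on {0..1} ?f" by (intro continuous_intros)
    show "(?F has_vector_derivative ?f t) (at t within {0..1})" for t
    proof -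
      have P: "((\<lambda>t. complex_of_real (poly P t)) has_vector_derivative of_real (poly (pderiv P) t)) (at t within {0..1})"
        by (intro has_vector_derivative_of_real)
           (rule DERIV_subset[OF poly_DERIV], simp)
      have d: "((\<lambda>z. exp (- \<i> * (z * of_real \<tau>))) has_field_derivative - \<i> * of_real \<tau> * exp (- \<i> * (of_real t * of_real \<tau>))) (at (of_real t))"
        by (auto intro!: derivative_eq_intros)
      have "((\<lambda>z. exp (- \<i> * (z * of_real \<tau>))) \<circ> of_real has_vector_derivative
          1 * (- \<i> * of_real \<tau> * exp (- \<i> * (of_real t * of_real \<tau>)))) (at t within {0..1})"
      proof (rule field_vector_diff_chain_within)
        show "(complex_of_real has_vector_derivative 1) (at t within {0..1})"
          by (rule has_vector_derivative_eq_rhs[OF has_vector_derivative_of_real[OF DERIV_ident]]) simp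
      qed (rule has_field_derivative_at_within[OF d])
      then have e: "(?e has_vector_derivative (- \<i> * of_real \<tau> * ?e t)) (at t within {0..1})"
        by (simp add: o_def)
      show ?thesis
        using has_vector_derivative_mult[OF e P] by (simp add: algebra_simps)
    qed
  qed simp
  also have "?F 1 - ?F 0 = 0" using assms by simp
  also have "(\<integral>t. indicator {0..1} t *\<^sub>R ?f t \<partial>lborel) = (\<integral>t. ?e t * complex_of_real (poly_bump (pderiv P) t)
      - \<i> * of_real \<tau> * (?e t * complex_of_real (poly_bump P t)) \<partial>lborel)"
    by (intro Bochner_Integration.integral_cong) (auto simp: poly_bump_def indicator_def)
  also have "\<dots> = fourier_transform (poly_bump (pderiv P)) \<tau> - \<i> * of_real \<tau> * fourier_transform (poly_bump P) \<tau>"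
    unfolding fourier_transform_def inner_real_def
    using integrable_fourier_integrand[OF integrable_poly_bump, of \<tau>]
    by (subst Bochner_Integration.integral_diff) auto
  finally show ?thesis by simp
qed

text \<open>This is t * (1 - t). Divisibility by its \<open>m\<close>-th power encodes zeros of
  order \<open>m\<close> at both endpoints of the unit interval.\<close>

abbreviation unit_parabola :: "real poly" where "unit_parabola \<equiv> [:0, 1, -1:]"

lemma dvd_pderiv_power_Suc:
  fixes q P :: "real poly"
  assumes "q ^ Suc m dvd P"
  shows "q ^ m dvd pderiv P"
proof -
  obtain R where P: "P = q ^ Suc m * R" using assms by auto
  have "pderiv P = q ^ m * (q * pderiv R + smult (of_nat (Suc m)) (R * pderiv q))"
    unfolding P pderiv_mult pderiv_power_Suc by (simp add: algebra_simps)
  then show ?thesis by simp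
qed

text \<open>Each integration by parts gains a factor \<bar>\<tau>\<bar> and uses up one order of
  vanishing. At low frequencies this gain is worthless and the L1 norm takes over;
  \<open>1 + \<bar>\<tau>\<bar>\<close> merges both regimes.\<close>

lemma fourier_transform_poly_bump_decay:
  assumes "unit_parabola ^ m dvd P"
  obtains C where "0 < C" "\<And>\<tau>. cmod (fourier_transform (poly_bump P) \<tau>) \<le> C / (1 + \<bar>\<tau>\<bar>) ^ m"
proof -
  have "\<exists>C. \<forall>\<tau>. \<bar>\<tau>\<bar> ^ m * cmod (fourier_transform (poly_bump P) \<tau>) \<le> C" using assms
  proof (induction m arbitrary: P)
    case 0
    show ?case using norm_fourier_transform_le[OF integrable_poly_bump, of P] by auto
  next
    case (Suc m)
    obtain C where C: "\<And>\<tau>. \<bar>\<tau>\<bar> ^ m * cmod (fourier_transform (poly_bump (pderiv P)) \<tau>) \<le> C"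
      using Suc.IH[OF dvd_pderiv_power_Suc[OF Suc.prems]] by blast
    have "poly P 0 = 0" "poly P 1 = 0" using Suc.prems by auto
    note eq = fourier_transform_poly_bump_pderiv[OF this]
    have "\<bar>\<tau>\<bar> ^ Suc m * cmod (fourier_transform (poly_bump P) \<tau>) \<le> C" for \<tau>
      using C[of \<tau>] unfolding eq by (simp add: norm_mult mult_ac)
    then show ?case by blast
  qed
  then obtain C1 where C1: "\<And>\<tau>. \<bar>\<tau>\<bar> ^ m * cmod (fourier_transform (poly_bump P) \<tau>) \<le> C1" by blast
  define C0 where "C0 = (LINT t|lborel. \<bar>poly_bump P t\<bar>)"
  have C0: "cmod (fourier_transform (poly_bump P) \<tau>) \<le> C0" for \<tau>
    unfolding C0_def by (rule norm_fourier_transform_le[OF integrable_poly_bump])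
  show thesis
  proof (rule that[of "2 ^ m * (\<bar>C0\<bar> + \<bar>C1\<bar> + 1)"])
    fix \<tau> :: real
    let ?F = "cmod (fourier_transform (poly_bump P) \<tau>)"
    have "(1 + \<bar>\<tau>\<bar>) ^ m * ?F \<le> 2 ^ m * (\<bar>C0\<bar> + \<bar>C1\<bar> + 1)"
    proof (cases "\<bar>\<tau>\<bar> \<le> 1")
      case True
      have "(1 + \<bar>\<tau>\<bar>) ^ m * ?F \<le> 2 ^ m * C0"
        by (intro mult_mono power_mono C0) (use True in auto)
      also have "\<dots> \<le> 2 ^ m * (\<bar>C0\<bar> + \<bar>C1\<bar> + 1)" by (intro mult_left_mono) auto
      finally show ?thesis .
    next
      case False
      have "(1 + \<bar>\<tau>\<bar>) ^ m * ?F \<le> (2 * \<bar>\<tau>\<bar>) ^ m * ?F"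
        by (intro mult_right_mono power_mono) (use False in auto)
      also have "\<dots> = 2 ^ m * (\<bar>\<tau>\<bar> ^ m * ?F)" by (simp add: power_mult_distrib)
      also have "\<dots> \<le> 2 ^ m * (\<bar>C0\<bar> + \<bar>C1\<bar> + 1)"
        using C1[of \<tau>] by (intro mult_left_mono) auto
      finally show ?thesis .
    qed
    then show "?F \<le> 2 ^ m * (\<bar>C0\<bar> + \<bar>C1\<bar> + 1) / (1 + \<bar>\<tau>\<bar>) ^ m"
      by (subst pos_le_divide_eq) (auto simp: mult.commute intro!: zero_less_power)
  qed (simp add: add_nonneg_pos)
qed

lemma lborel_integral_prod:
  fixes f :: "'a::euclidean_space \<Rightarrow> real \<Rightarrow> 'b::{real_normed_field, banach, second_countable_topology}"
  assumes f: "\<And>b. b \<in> Basis \<Longrightarrow> integrable lborel (f b)"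
  shows "(LINT x|lborel. (\<Prod>b\<in>Basis. f b (x \<bullet> b))) = (\<Prod>b\<in>Basis. LINT t|lborel. f b t)"
proof -
  interpret product_sigma_finite "\<lambda>_::'a. lborel :: real measure" by standard
  have [measurable]: "f b \<in> borel_measurable borel" if "b \<in> Basis" for b
    using borel_measurable_integrable[OF f[OF that]] by simp
  have coord: "(\<Sum>b'\<in>Basis. y b' *\<^sub>R b') \<bullet> b = y b" if "b \<in> Basis" for y :: "'a \<Rightarrow> real" and b
    using that by (simp add: inner_sum_left inner_Basis if_distrib cong: if_cong)
  have "(LINT x|lborel. (\<Prod>b\<in>Basis. f b (x \<bullet> b)))
      = (LINT y|(\<Pi>\<^sub>M b\<in>Basis. lborel). (\<Prod>b\<in>Basis. f b ((\<Sum>b'\<in>Basis. y b' *\<^sub>R b') \<bullet> b)))"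
    by (subst lborel_eq, subst integral_distr) measurable
  also have "\<dots> = (LINT y|(\<Pi>\<^sub>M b\<in>Basis. lborel). (\<Prod>b\<in>Basis. f b (y b)))"
    by (simp add: coord)
  also have "\<dots> = (\<Prod>b\<in>Basis. LINT t|lborel. f b t)"
    by (rule product_integral_prod) (use f in auto)
  finally show ?thesis .
qed

text \<open>A tensor product, so that integrals, norms and Fourier transforms all factor into
  one-dimensional quantities. \<open>a\<close> is the lower corner and \<open>r\<close> the side
  length.\<close>

definition box_bump :: "real poly \<Rightarrow> 'a::euclidean_space \<Rightarrow> real \<Rightarrow> 'a \<Rightarrow> real" where
  "box_bump P a r x = (\<Prod>b\<in>Basis. poly_bump P ((x \<bullet> b - a \<bullet> b) / r))"

lemma borel_measurable_box_bump [measurable]: "box_bump P a r \<in> borel_measurable borel"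
  unfolding box_bump_def by measurable

lemma integrable_scaled:
  fixes f :: "real \<Rightarrow> 'b::{banach, second_countable_topology}"
  assumes "integrable lborel f" "0 < r"
  shows "integrable lborel (\<lambda>t. f ((t - c) / r))"
  using lborel_integrable_real_affine[OF assms(1), of "1/r" "-c/r"] assms(2)
  by (simp add: diff_divide_distrib)

lemma integral_scaled:
  fixes f :: "real \<Rightarrow> 'b::{banach, second_countable_topology}"
  assumes "0 < r"
  shows "(LINT t|lborel. f ((t - c) / r)) = r *\<^sub>R (LINT t|lborel. f t)"
  using lborel_integral_real_affine[of r "\<lambda>t. f ((t - c) / r)" c] assms by simp

lemma box_bump_nonzero:
  assumes "box_bump P a r x \<noteq> 0" "0 < r" "unit_parabola dvd P" "b \<in> Basis"
  shows "a \<bullet> b < x \<bullet> b" "x \<bullet> b < a \<bullet> b + r"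
proof -
  define t where "t = (x \<bullet> b - a \<bullet> b) / r"
  have "poly_bump P t \<noteq> 0" using assms by (auto simp: box_bump_def t_def)
  then have t: "0 \<le> t" "t \<le> 1" "poly P t \<noteq> 0" by (auto simp: poly_bump_def indicator_def split: if_splits)
  have "poly P 0 = 0" "poly P 1 = 0" using assms(3) by auto
  then have "t \<noteq> 0" "t \<noteq> 1" using t(3) by metis+
  then have "0 < t" "t < 1" using t by auto
  then show "a \<bullet> b < x \<bullet> b" "x \<bullet> b < a \<bullet> b + r" using assms(2) by (auto simp: t_def field_simps)
qed

text \<open>A translation only contributes a phase of modulus 1, so the modulus does not depend on
  \<open>a\<close>, and all cells have the same Sobolev energy.\<close>

lemma fourier_transform_box_bump:
  fixes a :: "'a::euclidean_space"
  assumes r: "0 < r"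
  shows "cmod (fourier_transform (box_bump P a r) \<omega>)
    = (\<Prod>b\<in>Basis. r * cmod (fourier_transform (poly_bump P) (r * (\<omega> \<bullet> b))))"
proof -
  let ?f = "\<lambda>b t. exp (- \<i> * of_real (t * (\<omega> \<bullet> b))) * complex_of_real (poly_bump P ((t - a \<bullet> b) / r))"
  have int: "integrable lborel (?f b)" for b
    using integrable_fourier_integrand[OF integrable_scaled[OF integrable_poly_bump r], of "\<omega> \<bullet> b"] by simp
  have "fourier_transform (box_bump P a r) \<omega> = (LINT x|lborel. (\<Prod>b\<in>Basis. ?f b (x \<bullet> b)))"
    unfolding fourier_transform_def box_bump_def prod.distrib exp_sum[OF finite_Basis, symmetric]
    by (subst euclidean_inner) (simp add: sum_distrib_left sum_negf)
  also have "\<dots> = (\<Prod>b\<in>Basis. LINT t|lborel. ?f b t)"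
    by (rule lborel_integral_prod) (rule int)
  finally have "cmod (fourier_transform (box_bump P a r) \<omega>) = (\<Prod>b\<in>Basis. cmod (LINT t|lborel. ?f b t))"
    by (simp add: prod_norm)
  also have "\<dots> = (\<Prod>b\<in>Basis. r * cmod (fourier_transform (poly_bump P) (r * (\<omega> \<bullet> b))))"
  proof (rule prod.cong[OF refl])
    fix b :: 'a
    let ?g = "\<lambda>u. exp (- \<i> * of_real (u * (r * (\<omega> \<bullet> b)))) * complex_of_real (poly_bump P u)"
    have "?f b t = exp (- \<i> * of_real (a \<bullet> b * (\<omega> \<bullet> b))) * ?g ((t - a \<bullet> b) / r)" for t
    proof -
      have "t * (\<omega> \<bullet> b) = a \<bullet> b * (\<omega> \<bullet> b) + (t - a \<bullet> b) / r * (r * (\<omega> \<bullet> b))"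
        using r by (simp add: field_simps)
      then show ?thesis by (simp only: of_real_add distrib_left exp_add mult.assoc)
    qed
    then have "(LINT t|lborel. ?f b t)
        = (LINT t|lborel. exp (- \<i> * of_real (a \<bullet> b * (\<omega> \<bullet> b))) * ?g ((t - a \<bullet> b) / r))"
      by (intro Bochner_Integration.integral_cong refl)
    also have "\<dots> = exp (- \<i> * of_real (a \<bullet> b * (\<omega> \<bullet> b))) * (LINT t|lborel. ?g ((t - a \<bullet> b) / r))"
      by (rule integral_mult_right_zero)
    also have "(LINT t|lborel. ?g ((t - a \<bullet> b) / r)) = r *\<^sub>R (LINT u|lborel. ?g u)"
      by (rule integral_scaled[OF r])
    also have "(LINT u|lborel. ?g u) = fourier_transform (poly_bump P) (r * (\<omega> \<bullet> b))"
      by (simp add: fourier_transform_def)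
    finally show "cmod (LINT t|lborel. ?f b t) = r * cmod (fourier_transform (poly_bump P) (r * (\<omega> \<bullet> b)))"
      using r by (simp add: norm_mult)
  qed
  finally show ?thesis .
qed

section \<open>Sobolev energy of a single scaled bump\<close>

lemma nn_integral_inverse_square:
  assumes r: "0 < r"
  shows "(\<integral>\<^sup>+ t. ennreal (1 / (1 + r * \<bar>t\<bar>)\<^sup>2) \<partial>lborel) \<le> ennreal (2 / r)"
proof -
  let ?f = "\<lambda>t. 1 / (1 + r * t)\<^sup>2"
  have pos: "0 < 1 + r * t" if "0 \<le> t" for t using r that by (simp add: add_pos_nonneg)
  have half: "(\<integral>\<^sup>+ t. ennreal (?f t) * indicator {0..} t \<partial>lborel) = ennreal (0 - (- inverse (1 + r * 0) / r))"
  proof (rule nn_integral_FTC_atLeast)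
    show "?f \<in> borel_measurable borel" by measurable
    show "((\<lambda>t. - inverse (1 + r * t) / r) has_real_derivative ?f t) (at t)" if "0 \<le> t" for t
    proof -
      have "1 + r * t \<noteq> 0" using pos[OF that] by simp
      then show ?thesis
        using r by (auto intro!: derivative_eq_intros simp: power2_eq_square divide_inverse mult_ac)
    qed
    show "((\<lambda>t. - inverse (1 + r * t) / r) \<longlongrightarrow> 0) at_top"
      using r by real_asymp
  qed (use pos in auto)
  have "(\<integral>\<^sup>+ t. ennreal (1 / (1 + r * \<bar>t\<bar>)\<^sup>2) \<partial>lborel)
      \<le> (\<integral>\<^sup>+ t. ennreal (?f t) * indicator {0..} t + ennreal (?f (0 + (-1) * t)) * indicator {0..} (0 + (-1) * t) \<partial>lborel)"
    by (rule nn_integral_mono) (auto simp: indicator_def)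
  also have "\<dots> = (\<integral>\<^sup>+ t. ennreal (?f t) * indicator {0..} t \<partial>lborel)
      + (\<integral>\<^sup>+ t. ennreal (?f (0 + (-1) * t)) * indicator {0..} (0 + (-1) * t) \<partial>lborel)"
    by (rule nn_integral_add) auto
  also have "(\<integral>\<^sup>+ t. ennreal (?f (0 + (-1) * t)) * indicator {0..} (0 + (-1) * t) \<partial>lborel)
      = (\<integral>\<^sup>+ t. ennreal (?f t) * indicator {0..} t \<partial>lborel)"
    by (subst (2) nn_integral_real_affine[where c="-1" and t=0]) auto
  finally show ?thesis unfolding half using r by (simp flip: ennreal_plus)
qed

text \<open>The square of \<open>sobolev_norm\<close>. Averages over signs and bounds for sums are
  natural for squares; the root is taken only at the end.\<close>

definition sobolev_energy :: "real \<Rightarrow> ('a::euclidean_space \<Rightarrow> real) \<Rightarrow> ennreal" where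
  "sobolev_energy \<beta> f = (\<integral>\<^sup>+ \<omega>. ennreal (norm \<omega> powr (2 * \<beta>) * (cmod (fourier_transform f \<omega>))\<^sup>2) \<partial>lborel)"

lemma one_plus_sum_le_prod:
  fixes f :: "'b \<Rightarrow> real"
  assumes "finite I" "\<And>i. i \<in> I \<Longrightarrow> 0 \<le> f i"
  shows "1 + (\<Sum>i\<in>I. f i) \<le> (\<Prod>i\<in>I. 1 + f i)"
  using assms
proof (induction I rule: finite_induct)
  case (insert i I)
  have "1 + (\<Sum>i\<in>insert i I. f i) \<le> (1 + f i) * (1 + (\<Sum>i\<in>I. f i))"
    using insert by (simp add: algebra_simps sum_nonneg)
  also have "\<dots> \<le> (1 + f i) * (\<Prod>i\<in>I. 1 + f i)"
    using insert by (intro mult_left_mono) auto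
  finally show ?case using insert by simp
qed simp

text \<open>The Sobolev weight depends on the Euclidean norm and does not factor. This majorant
  does, so that the energy integral splits over the coordinates.\<close>

lemma norm_le_prod_coordinates:
  fixes \<omega> :: "'a::euclidean_space"
  assumes r: "0 \<le> r"
  shows "r * norm \<omega> \<le> (\<Prod>b\<in>Basis. 1 + r * \<bar>\<omega> \<bullet> b\<bar>)"
proof -
  have "r * norm \<omega> \<le> r * (\<Sum>b\<in>Basis. \<bar>\<omega> \<bullet> b\<bar>)" by (rule mult_left_mono[OF norm_le_l1 r])
  also have "\<dots> \<le> 1 + (\<Sum>b\<in>Basis. r * \<bar>\<omega> \<bullet> b\<bar>)" by (simp add: sum_distrib_left)
  also have "\<dots> \<le> (\<Prod>b\<in>Basis. 1 + r * \<bar>\<omega> \<bullet> b\<bar>)"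
    by (rule one_plus_sum_le_prod) (use r in auto)
  finally show ?thesis .
qed

text \<open>After the weight is replaced by a product, each coordinate carries the power
  \<open>2 * \<beta> - 2 * m\<close> of \<open>1 + r * \<bar>\<omega> \<bullet> b\<bar>\<close>, and
  \<open>\<beta> + 1 \<le> m\<close> brings it down to the integrable power -2. The coordinate
  integral is at most \<open>(r * C)\<^sup>2 * (2 / r)\<close>, linear in \<open>r\<close>; the
  product of these gives \<open>r ^ DIM('a)\<close>.\<close>

lemma sobolev_energy_box_bump:
  assumes \<beta>: "0 < \<beta>" and m: "\<beta> + 1 \<le> real m" and P: "unit_parabola ^ m dvd P"
  obtains A where "0 < A" "\<And>(a::'a::euclidean_space) r. 0 < r \<Longrightarrow>
    sobolev_energy \<beta> (box_bump P a r) \<le> ennreal (A * r ^ DIM('a) * r powr (- 2 * \<beta>))"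
proof -
  obtain C where C: "0 < C" "\<And>\<tau>. cmod (fourier_transform (poly_bump P) \<tau>) \<le> C / (1 + \<bar>\<tau>\<bar>) ^ m"
    using fourier_transform_poly_bump_decay[OF P] by blast
  show thesis
  proof (rule that[of "(2 * C\<^sup>2) ^ DIM('a)"])
    fix a :: 'a and r :: real assume r: "0 < r"
    have pt: "norm \<omega> powr (2 * \<beta>) * (cmod (fourier_transform (box_bump P a r) \<omega>))\<^sup>2
      \<le> r powr (- 2 * \<beta>) * (\<Prod>b\<in>Basis. (r * C)\<^sup>2 * (1 / (1 + r * \<bar>\<omega> \<bullet> b\<bar>)\<^sup>2))" for \<omega> :: 'a
    proof -
      let ?s = "\<lambda>b. 1 + r * \<bar>\<omega> \<bullet> b\<bar>"
      have s1: "1 \<le> ?s b" for b using r by simp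
      have "norm \<omega> powr (2 * \<beta>) = r powr (- 2 * \<beta>) * (r * norm \<omega>) powr (2 * \<beta>)"
        using r by (simp add: powr_mult powr_minus field_simps)
      also have "\<dots> \<le> r powr (- 2 * \<beta>) * (\<Prod>b\<in>Basis. ?s b) powr (2 * \<beta>)"
        using r \<beta> by (intro mult_left_mono powr_mono2 norm_le_prod_coordinates) auto
      also have "(\<Prod>b\<in>Basis. ?s b) powr (2 * \<beta>) = (\<Prod>b\<in>Basis. ?s b powr (2 * \<beta>))"
        by (rule prod_powr_distrib)
      finally have 1: "norm \<omega> powr (2 * \<beta>) \<le> r powr (- 2 * \<beta>) * (\<Prod>b\<in>Basis. ?s b powr (2 * \<beta>))" .
      have "cmod (fourier_transform (box_bump P a r) \<omega>) \<le> (\<Prod>b\<in>Basis. r * (C / ?s b ^ m))"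
        unfolding fourier_transform_box_bump[OF r]
      proof (rule prod_mono, intro conjI mult_left_mono)
        fix b :: 'a
        show "cmod (fourier_transform (poly_bump P) (r * (\<omega> \<bullet> b))) \<le> C / ?s b ^ m"
          using C(2)[of "r * (\<omega> \<bullet> b)"] r by (simp add: abs_mult)
      qed (use r in auto)
      then have 2: "(cmod (fourier_transform (box_bump P a r) \<omega>))\<^sup>2 \<le> (\<Prod>b\<in>Basis. (r * (C / ?s b ^ m))\<^sup>2)"
        unfolding prod_power_distrib[symmetric] by (rule power_mono) simp
      have "norm \<omega> powr (2 * \<beta>) * (cmod (fourier_transform (box_bump P a r) \<omega>))\<^sup>2
        \<le> (r powr (- 2 * \<beta>) * (\<Prod>b\<in>Basis. ?s b powr (2 * \<beta>))) * (\<Prod>b\<in>Basis. (r * (C / ?s b ^ m))\<^sup>2)"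
        by (intro mult_mono 1 2) (auto intro!: mult_nonneg_nonneg prod_nonneg)
      also have "\<dots> = r powr (- 2 * \<beta>) * (\<Prod>b\<in>Basis. ?s b powr (2 * \<beta>) * (r * (C / ?s b ^ m))\<^sup>2)"
        by (simp add: prod.distrib)
      also have "\<dots> \<le> r powr (- 2 * \<beta>) * (\<Prod>b\<in>Basis. (r * C)\<^sup>2 * (1 / (?s b)\<^sup>2))"
      proof (intro mult_left_mono prod_mono conjI)
        fix b :: 'a
        have s0: "0 < ?s b" using s1[of b] by simp
        have "?s b powr (2 * \<beta>) * (r * (C / ?s b ^ m))\<^sup>2 = (r * C)\<^sup>2 * (?s b powr (2 * \<beta>) / (?s b ^ m)\<^sup>2)"
          by (simp add: power_mult_distrib power_divide)
        also have "(?s b ^ m)\<^sup>2 = ?s b powr (2 * real m)"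
          using s0 by (simp add: powr_realpow[symmetric] powr_powr powr_power mult.commute)
        also have "?s b powr (2 * \<beta>) / ?s b powr (2 * real m) = ?s b powr (2 * \<beta> - 2 * real m)"
          by (simp add: powr_diff)
        also have "\<dots> \<le> ?s b powr (- 2)" by (rule powr_mono) (use m s1 in auto)
        also have "?s b powr (- 2) = 1 / (?s b)\<^sup>2" using s0 by (simp add: powr_minus_divide)
        finally show "?s b powr (2 * \<beta>) * (r * (C / ?s b ^ m))\<^sup>2 \<le> (r * C)\<^sup>2 * (1 / (?s b)\<^sup>2)"
          by (simp add: mult_left_mono)
      qed auto
      finally show ?thesis .
    qed
    have "sobolev_energy \<beta> (box_bump P a r)
      \<le> (\<integral>\<^sup>+ \<omega>. ennreal (r powr (- 2 * \<beta>)) * (\<Prod>b\<in>(Basis::'a set). ennreal ((r * C)\<^sup>2 * (1 / (1 + r * \<bar>\<omega> \<bullet> b\<bar>)\<^sup>2))) \<partial>lborel)"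
      unfolding sobolev_energy_def
    proof (rule nn_integral_mono)
      fix \<omega> :: 'a
      show "ennreal (norm \<omega> powr (2 * \<beta>) * (cmod (fourier_transform (box_bump P a r) \<omega>))\<^sup>2)
        \<le> ennreal (r powr (- 2 * \<beta>)) * (\<Prod>b\<in>Basis. ennreal ((r * C)\<^sup>2 * (1 / (1 + r * \<bar>\<omega> \<bullet> b\<bar>)\<^sup>2)))"
        using ennreal_leI[OF pt[of \<omega>]] by (simp add: ennreal_mult prod_ennreal prod_nonneg)
    qed
    also have "\<dots> = ennreal (r powr (- 2 * \<beta>)) *
        (\<integral>\<^sup>+ \<omega>. (\<Prod>b\<in>(Basis::'a set). ennreal ((r * C)\<^sup>2 * (1 / (1 + r * \<bar>\<omega> \<bullet> b\<bar>)\<^sup>2))) \<partial>lborel)"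
      by (rule nn_integral_cmult) measurable
    also have "(\<integral>\<^sup>+ \<omega>. (\<Prod>b\<in>(Basis::'a set). ennreal ((r * C)\<^sup>2 * (1 / (1 + r * \<bar>\<omega> \<bullet> b\<bar>)\<^sup>2))) \<partial>lborel)
        = (\<Prod>b\<in>(Basis::'a set). (\<integral>\<^sup>+ t. ennreal ((r * C)\<^sup>2 * (1 / (1 + r * \<bar>t\<bar>)\<^sup>2)) \<partial>lborel))"
      by (rule nn_integral_lborel_prod) measurable
    also have "\<dots> \<le> (\<Prod>b\<in>(Basis::'a set). ennreal ((r * C)\<^sup>2 * (2 / r)))"
    proof (rule prod_mono_ennreal)
      have "(\<integral>\<^sup>+ t. ennreal ((r * C)\<^sup>2 * (1 / (1 + r * \<bar>t\<bar>)\<^sup>2)) \<partial>lborel)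
          = ennreal ((r * C)\<^sup>2) * (\<integral>\<^sup>+ t. ennreal (1 / (1 + r * \<bar>t\<bar>)\<^sup>2) \<partial>lborel)"
        unfolding ennreal_mult'[OF zero_le_power2] by (rule nn_integral_cmult) measurable
      also have "\<dots> \<le> ennreal ((r * C)\<^sup>2) * ennreal (2 / r)"
        by (intro mult_left_mono nn_integral_inverse_square r) simp
      finally show "(\<integral>\<^sup>+ t. ennreal ((r * C)\<^sup>2 * (1 / (1 + r * \<bar>t\<bar>)\<^sup>2)) \<partial>lborel) \<le> ennreal ((r * C)\<^sup>2 * (2 / r))"
        using r by (simp only: ennreal_mult'[OF zero_le_power2])
    qed
    also have "\<dots> = ennreal ((2 * C\<^sup>2) ^ DIM('a) * r ^ DIM('a))"
    proof -
      have "(r * C)\<^sup>2 * (2 / r) = 2 * C\<^sup>2 * r" using r by (simp add: power2_eq_square)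
      then show ?thesis using r by (simp add: ennreal_power power_mult_distrib)
    qed
    finally have "sobolev_energy \<beta> (box_bump P a r)
      \<le> ennreal (r powr (- 2 * \<beta>)) * ennreal ((2 * C\<^sup>2) ^ DIM('a) * r ^ DIM('a))"
      by (simp add: mult_left_mono)
    then show "sobolev_energy \<beta> (box_bump P a r) \<le> ennreal ((2 * C\<^sup>2) ^ DIM('a) * r ^ DIM('a) * r powr (- 2 * \<beta>))"
      using r by (simp add: ennreal_mult[symmetric] mult_ac)
  qed (use C in simp)
qed

section \<open>Random signs\<close>

text \<open>Extensional functions form a finite set, so expectations over random signs become finite
  sums divided by \<open>2 ^ card J\<close>.\<close>

definition signs :: "'j set \<Rightarrow> ('j \<Rightarrow> real) set" where
  "signs J = (J \<rightarrow>\<^sub>E {-1, 1})"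

lemma finite_signs: "finite J \<Longrightarrow> finite (signs J)"
  by (auto simp: signs_def intro!: finite_PiE)

lemma card_signs: "finite J \<Longrightarrow> card (signs J) = 2 ^ card J"
  by (simp add: signs_def card_PiE numeral_2_eq_2)

lemma signs_abs: "\<sigma> \<in> signs J \<Longrightarrow> j \<in> J \<Longrightarrow> \<bar>\<sigma> j\<bar> = 1"
  by (auto simp: signs_def PiE_def Pi_def)

lemma sum_signs_insert:
  fixes F :: "('j \<Rightarrow> real) \<Rightarrow> 'b::comm_monoid_add"
  assumes "j \<notin> J"
  shows "(\<Sum>\<sigma>\<in>signs (insert j J). F \<sigma>) = (\<Sum>\<sigma>\<in>signs J. F (\<sigma>(j := -1)) + F (\<sigma>(j := 1)))"
proof -
  have "(\<Sum>\<sigma>\<in>signs (insert j J). F \<sigma>) = (\<Sum>(y, \<sigma>)\<in>{-1, 1} \<times> signs J. F (\<sigma>(j := y)))"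
    unfolding signs_def PiE_insert_eq
    by (subst sum.reindex[OF inj_combinator[OF assms]]) (simp add: case_prod_beta o_def)
  also have "\<dots> = (\<Sum>y\<in>{-1, 1}. \<Sum>\<sigma>\<in>signs J. F (\<sigma>(j := y)))"
    by (rule sum.cartesian_product[symmetric])
  also have "\<dots> = (\<Sum>\<sigma>\<in>signs J. F (\<sigma>(j := -1)) + F (\<sigma>(j := 1)))"
    by (simp add: sum.distrib)
  finally show ?thesis .
qed

text \<open>Induction on \<open>J\<close>: for the two values of the newly inserted sign, the mixed
  terms cancel by the parallelogram law.\<close>

lemma sum_signs_square:
  fixes z :: "'j \<Rightarrow> complex"
  assumes "finite J"
  shows "(\<Sum>\<sigma>\<in>signs J. (cmod (\<Sum>j\<in>J. of_real (\<sigma> j) * z j))\<^sup>2) = 2 ^ card J * (\<Sum>j\<in>J. (cmod (z j))\<^sup>2)"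
  using assms
proof (induction J rule: finite_induct)
  case (insert j J)
  have upd: "(\<Sum>i\<in>J. of_real ((\<sigma>(j := y)) i) * z i) = (\<Sum>i\<in>J. of_real (\<sigma> i) * z i)" for \<sigma> y
    using insert.hyps by (intro sum.cong) auto
  have par: "(cmod (v - u))\<^sup>2 + (cmod (u + v))\<^sup>2 = 2 * (cmod v)\<^sup>2 + 2 * (cmod u)\<^sup>2" for u v
    unfolding cmod_power2 by (simp add: power2_eq_square algebra_simps)
  have "(\<Sum>\<sigma>\<in>signs (insert j J). (cmod (\<Sum>i\<in>insert j J. of_real (\<sigma> i) * z i))\<^sup>2)
      = (\<Sum>\<sigma>\<in>signs J. 2 * (cmod (\<Sum>i\<in>J. of_real (\<sigma> i) * z i))\<^sup>2 + 2 * (cmod (z j))\<^sup>2)"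
    unfolding sum_signs_insert[OF insert.hyps(2)] sum.insert[OF insert.hyps] upd
    by (simp add: par)
  also have "\<dots> = 2 * (2 ^ card J * (\<Sum>i\<in>J. (cmod (z i))\<^sup>2)) + 2 ^ card J * (2 * (cmod (z j))\<^sup>2)"
    using insert by (simp add: sum.distrib card_signs flip: sum_distrib_left)
  finally show ?case using insert by (simp add: algebra_simps)
qed (simp add: signs_def)

text \<open>The sub-Gaussian bound for one sign, with a cruder exponent than the optimal half
  square: for small arguments from the quadratic bound of \<open>exp\<close>, for large ones because
  then \<bar>x\<bar> is at most its square.\<close>

lemma exp_plus_exp_minus_le:
  fixes x :: real
  shows "exp x + exp (- x) \<le> 2 * exp (x\<^sup>2)"
proof (cases "\<bar>x\<bar> \<le> 1")
  case True
  have "exp x + exp (- x) \<le> 2 * (1 + x\<^sup>2)"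
    using exp_le_quadratic[of x] exp_le_quadratic[of "- x"] True by simp
  also have "\<dots> \<le> 2 * exp (x\<^sup>2)" by (intro mult_left_mono exp_ge_add_one_self) simp
  finally show ?thesis .
next
  case False
  then have "\<bar>x\<bar> * 1 \<le> \<bar>x\<bar> * \<bar>x\<bar>" by (intro mult_left_mono) auto
  then have "\<bar>x\<bar> \<le> x\<^sup>2" by (simp add: power2_eq_square)
  then have "x \<le> x\<^sup>2" "- x \<le> x\<^sup>2" by auto
  then have "exp x \<le> exp (x\<^sup>2)" "exp (- x) \<le> exp (x\<^sup>2)" by auto
  then show ?thesis by linarith
qed

text \<open>Independence of the signs: the sum over all choices of a product is a product of
  two-term sums. This is the source of the square-root cancellation.\<close>

lemma sum_signs_exp:
  fixes a :: "'j \<Rightarrow> real"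
  assumes "finite J"
  shows "(\<Sum>\<sigma>\<in>signs J. exp (\<Sum>j\<in>J. \<sigma> j * a j)) \<le> 2 ^ card J * exp (\<Sum>j\<in>J. (a j)\<^sup>2)"
proof -
  have "(\<Sum>\<sigma>\<in>signs J. exp (\<Sum>j\<in>J. \<sigma> j * a j)) = (\<Sum>\<sigma>\<in>signs J. \<Prod>j\<in>J. exp (\<sigma> j * a j))"
    by (simp add: exp_sum assms)
  also have "\<dots> = (\<Prod>j\<in>J. \<Sum>y\<in>{-1, 1}. exp (y * a j))"
    unfolding signs_def by (rule prod_sum_PiE[symmetric]) (use assms in auto)
  also have "\<dots> \<le> (\<Prod>j\<in>J. 2 * exp ((a j)\<^sup>2))"
    by (rule prod_mono) (use exp_plus_exp_minus_le[of "a j" for j] in \<open>auto simp: add.commute\<close>)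
  also have "\<dots> = 2 ^ card J * exp (\<Sum>j\<in>J. (a j)\<^sup>2)"
    by (simp add: prod.distrib exp_sum assms)
  finally show ?thesis .
qed

text \<open>The potential \<Phi> adds the normalised cost \<open>S\<close> to the normalised
  exponentials of all linear forms. Each part averages at most 1/2, so some choice of signs has
  potential at most 1. All summands are nonnegative, hence every bound holds for this choice
  simultaneously.\<close>

lemma exists_good_signs:
  fixes S :: "('j \<Rightarrow> real) \<Rightarrow> real" and a :: "'h \<Rightarrow> 'j \<Rightarrow> real"
  assumes J: "finite J" and N: "finite N" "real (card N) \<le> B" "0 < B"
    and S: "\<And>\<sigma>. \<sigma> \<in> signs J \<Longrightarrow> 0 \<le> S \<sigma>" "(\<Sum>\<sigma>\<in>signs J. S \<sigma>) \<le> 2 ^ card J * A" "0 < A"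
    and V: "\<And>h. h \<in> N \<Longrightarrow> (\<Sum>j\<in>J. (a h j)\<^sup>2) \<le> V" and l: "0 < l"
  obtains \<sigma> where "\<sigma> \<in> signs J" "S \<sigma> \<le> 2 * A"
    "\<And>h. h \<in> N \<Longrightarrow> \<bar>\<Sum>j\<in>J. \<sigma> j * a h j\<bar> \<le> ln (4 * B) / l + l * V"
proof -
  \<comment> \<open>Two exponentials for each of at most \<open>B\<close> forms give an average of
    at most \<open>2 * B * exp (l\<^sup>2 * V)\<close>. The further factor 2 reserves half of the
    budget for \<open>S\<close>.\<close>
  define Q where "Q = 4 * B * exp (l\<^sup>2 * V)"
  have Q: "0 < Q" using N by (simp add: Q_def)
  define s where "s \<sigma> h = l * (\<Sum>j\<in>J. \<sigma> j * a h j)" for \<sigma> :: "'j \<Rightarrow> real" and h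
  define \<Phi> where "\<Phi> \<sigma> = S \<sigma> / (2 * A) + (\<Sum>h\<in>N. exp (s \<sigma> h) + exp (- s \<sigma> h)) / Q" for \<sigma>
  have one: "(\<Sum>\<sigma>\<in>signs J. exp (t * (\<Sum>j\<in>J. \<sigma> j * a h j))) \<le> 2 ^ card J * exp (l\<^sup>2 * V)"
    if "h \<in> N" "t\<^sup>2 = l\<^sup>2" for h t
  proof -
    have "(\<Sum>\<sigma>\<in>signs J. exp (t * (\<Sum>j\<in>J. \<sigma> j * a h j))) = (\<Sum>\<sigma>\<in>signs J. exp (\<Sum>j\<in>J. \<sigma> j * (t * a h j)))"
      by (simp add: sum_distrib_left mult_ac)
    also have "\<dots> \<le> 2 ^ card J * exp (\<Sum>j\<in>J. (t * a h j)\<^sup>2)" by (rule sum_signs_exp[OF J])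
    also have "(\<Sum>j\<in>J. (t * a h j)\<^sup>2) = l\<^sup>2 * (\<Sum>j\<in>J. (a h j)\<^sup>2)"
      using that(2) by (simp add: power_mult_distrib sum_distrib_left)
    also have "2 ^ card J * exp \<dots> \<le> 2 ^ card J * exp (l\<^sup>2 * V)"
      using V[OF that(1)] by (simp add: mult_left_mono)
    finally show ?thesis .
  qed
  have pair: "(\<Sum>\<sigma>\<in>signs J. exp (s \<sigma> h) + exp (- s \<sigma> h)) \<le> 2 * (2 ^ card J * exp (l\<^sup>2 * V))" if "h \<in> N" for h
    using one[OF that, of l] one[OF that, of "- l"] unfolding s_def by (simp add: sum.distrib)
  have "(\<Sum>\<sigma>\<in>signs J. \<Sum>h\<in>N. exp (s \<sigma> h) + exp (- s \<sigma> h)) = (\<Sum>h\<in>N. \<Sum>\<sigma>\<in>signs J. exp (s \<sigma> h) + exp (- s \<sigma> h))"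
    by (rule sum.swap)
  also have "\<dots> \<le> (\<Sum>h\<in>N. 2 * (2 ^ card J * exp (l\<^sup>2 * V)))"
    by (rule sum_mono) (rule pair)
  also have "\<dots> = real (card N) * (2 * (2 ^ card J * exp (l\<^sup>2 * V)))" by simp
  also have "\<dots> \<le> B * (2 * (2 ^ card J * exp (l\<^sup>2 * V)))"
    by (rule mult_right_mono) (use N in auto)
  also have "\<dots> = 2 ^ card J * (Q / 2)" by (simp add: Q_def)
  finally have "(\<Sum>\<sigma>\<in>signs J. \<Sum>h\<in>N. exp (s \<sigma> h) + exp (- s \<sigma> h)) / Q \<le> 2 ^ card J * (Q / 2) / Q"
    using Q by (intro divide_right_mono) auto
  then have 1: "(\<Sum>\<sigma>\<in>signs J. \<Sum>h\<in>N. exp (s \<sigma> h) + exp (- s \<sigma> h)) / Q \<le> 2 ^ card J / 2" using Q by simp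
  have 2: "(\<Sum>\<sigma>\<in>signs J. S \<sigma>) / (2 * A) \<le> 2 ^ card J / 2"
    using S(2,3) by (simp add: field_simps)
  have total: "(\<Sum>\<sigma>\<in>signs J. \<Phi> \<sigma>) \<le> real (card (signs J)) * 1"
  proof -
    have "(\<Sum>\<sigma>\<in>signs J. \<Phi> \<sigma>) = (\<Sum>\<sigma>\<in>signs J. S \<sigma>) / (2 * A)
        + (\<Sum>\<sigma>\<in>signs J. \<Sum>h\<in>N. exp (s \<sigma> h) + exp (- s \<sigma> h)) / Q"
      unfolding \<Phi>_def sum.distrib[of "\<lambda>\<sigma>. S \<sigma> / (2 * A)"] sum_divide_distrib ..
    then show ?thesis using 1 2 by (simp only: card_signs[OF J] of_nat_power of_nat_numeral mult_1_right)
  qed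
  have "\<exists>\<sigma>\<in>signs J. \<Phi> \<sigma> \<le> 1"
  proof (rule ccontr)
    assume "\<not> ?thesis"
    then have gt: "1 < \<Phi> \<sigma>" if "\<sigma> \<in> signs J" for \<sigma> using that by auto
    have "signs J \<noteq> {}" using card_signs[OF J] by (metis card.empty power_not_zero zero_neq_numeral)
    then have "(\<Sum>\<sigma>\<in>signs J. 1) < (\<Sum>\<sigma>\<in>signs J. \<Phi> \<sigma>)"
      by (intro sum_strict_mono gt finite_signs J) auto
    then show False using total by simp
  qed
  then obtain \<sigma> where \<sigma>: "\<sigma> \<in> signs J" "\<Phi> \<sigma> \<le> 1" by blast
  have pos: "0 \<le> (\<Sum>h\<in>N. exp (s \<sigma> h) + exp (- s \<sigma> h)) / Q" "0 \<le> S \<sigma> / (2 * A)"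
    using Q S(1)[OF \<sigma>(1)] S(3) by (auto intro!: divide_nonneg_pos sum_nonneg add_nonneg_nonneg)
  show thesis
  proof (rule that[OF \<sigma>(1)])
    have "S \<sigma> / (2 * A) \<le> 1" using \<sigma>(2) pos unfolding \<Phi>_def by linarith
    then show "S \<sigma> \<le> 2 * A" using S(3) by (simp add: field_simps)
    fix h assume h: "h \<in> N"
    have "(\<Sum>h\<in>N. exp (s \<sigma> h) + exp (- s \<sigma> h)) / Q \<le> 1" using \<sigma>(2) pos unfolding \<Phi>_def by linarith
    then have le: "(\<Sum>h\<in>N. exp (s \<sigma> h) + exp (- s \<sigma> h)) \<le> Q" using Q by (simp add: field_simps)
    have "exp \<bar>s \<sigma> h\<bar> \<le> exp (s \<sigma> h) + exp (- s \<sigma> h)" by (auto simp: abs_if)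
    also have "\<dots> \<le> (\<Sum>h\<in>N. exp (s \<sigma> h) + exp (- s \<sigma> h))"
      by (rule member_le_sum[OF h]) (use N in \<open>auto intro: add_nonneg_nonneg\<close>)
    also have "\<dots> \<le> Q" by (rule le)
    finally have "\<bar>s \<sigma> h\<bar> \<le> ln Q" using Q by (simp add: ln_ge_iff)
    also have "ln Q = ln (4 * B) + l\<^sup>2 * V" using N by (simp add: Q_def ln_mult)
    finally have "l * \<bar>\<Sum>j\<in>J. \<sigma> j * a h j\<bar> \<le> ln (4 * B) + l\<^sup>2 * V"
      using l by (simp add: s_def abs_mult)
    then show "\<bar>\<Sum>j\<in>J. \<sigma> j * a h j\<bar> \<le> ln (4 * B) / l + l * V"
      using l by (simp add: field_simps power2_eq_square)
  qed
qed

section \<open>Averaging the Sobolev energy over the signs\<close>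

lemma borel_measurable_fourier_transform [measurable]:
  fixes f :: "'a::euclidean_space \<Rightarrow> real"
  assumes [measurable]: "f \<in> borel_measurable borel"
  shows "fourier_transform f \<in> borel_measurable borel"
proof -
  have [measurable]: "(\<lambda>z::'a \<times> 'a. exp (- \<i> * complex_of_real (snd z \<bullet> fst z))) \<in> borel_measurable (borel \<Otimes>\<^sub>M borel)"
    unfolding borel_prod by (intro borel_measurable_continuous_onI continuous_intros)
  show ?thesis
    unfolding fourier_transform_def[abs_def]
    by (rule lborel.borel_measurable_lebesgue_integral) (simp add: case_prod_beta)
qed

lemma fourier_transform_sum:
  fixes h :: "'j \<Rightarrow> 'a::euclidean_space \<Rightarrow> real"
  assumes "\<And>j. j \<in> J \<Longrightarrow> integrable lborel (h j)"
  shows "fourier_transform (\<lambda>x. \<Sum>j\<in>J. c j * h j x) \<omega> = (\<Sum>j\<in>J. of_real (c j) * fourier_transform (h j) \<omega>)"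
proof -
  let ?e = "\<lambda>x. exp (- \<i> * complex_of_real (x \<bullet> \<omega>))"
  have "fourier_transform (\<lambda>x. \<Sum>j\<in>J. c j * h j x) \<omega>
      = (LINT x|lborel. (\<Sum>j\<in>J. of_real (c j) * (?e x * of_real (h j x))))"
    unfolding fourier_transform_def by (simp add: sum_distrib_left mult_ac)
  also have "\<dots> = (\<Sum>j\<in>J. (LINT x|lborel. of_real (c j) * (?e x * of_real (h j x))))"
    by (rule Bochner_Integration.integral_sum) (intro integrable_mult_right integrable_fourier_integrand assms)
  finally show ?thesis by (simp add: fourier_transform_def)
qed

text \<open>Disjoint supports give no orthogonality for a fractional weight on the Fourier side. The
  identity for random signs supplies it on average, frequency by frequency.\<close>

lemma sum_signs_sobolev_energy:
  fixes h :: "'j \<Rightarrow> 'a::euclidean_space \<Rightarrow> real"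
  assumes J: "finite J" and int: "\<And>j. j \<in> J \<Longrightarrow> integrable lborel (h j)"
  shows "(\<Sum>\<sigma>\<in>signs J. sobolev_energy \<beta> (\<lambda>x. \<Sum>j\<in>J. \<sigma> j * h j x))
    = 2 ^ card J * (\<Sum>j\<in>J. sobolev_energy \<beta> (h j))"
proof -
  let ?F = "\<lambda>j. fourier_transform (h j)"
  have [measurable]: "?F j \<in> borel_measurable borel" if "j \<in> J" for j
    using borel_measurable_integrable[OF int[OF that]] by (intro borel_measurable_fourier_transform) simp
  have "(\<Sum>\<sigma>\<in>signs J. sobolev_energy \<beta> (\<lambda>x. \<Sum>j\<in>J. \<sigma> j * h j x))
    = (\<Sum>\<sigma>\<in>signs J. \<integral>\<^sup>+ \<omega>. ennreal (norm \<omega> powr (2 * \<beta>) * (cmod (\<Sum>j\<in>J. of_real (\<sigma> j) * ?F j \<omega>))\<^sup>2) \<partial>lborel)"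
    unfolding sobolev_energy_def by (simp add: fourier_transform_sum[OF int])
  also have "\<dots> = (\<integral>\<^sup>+ \<omega>. (\<Sum>\<sigma>\<in>signs J. ennreal (norm \<omega> powr (2 * \<beta>) * (cmod (\<Sum>j\<in>J. of_real (\<sigma> j) * ?F j \<omega>))\<^sup>2)) \<partial>lborel)"
    by (rule nn_integral_sum[symmetric]) measurable
  also have "\<dots> = (\<integral>\<^sup>+ \<omega>. ennreal (2 ^ card J) * (\<Sum>j\<in>J. ennreal (norm \<omega> powr (2 * \<beta>) * (cmod (?F j \<omega>))\<^sup>2)) \<partial>lborel)"
    by (simp add: sum_ennreal sum_signs_square[OF J] sum_nonneg mult_ac flip: ennreal_mult sum_distrib_left)
  also have "\<dots> = ennreal (2 ^ card J) * (\<Sum>j\<in>J. \<integral>\<^sup>+ \<omega>. ennreal (norm \<omega> powr (2 * \<beta>) * (cmod (?F j \<omega>))\<^sup>2) \<partial>lborel)"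
    by (subst nn_integral_cmult, measurable) (subst nn_integral_sum, measurable)
  also have "ennreal (2 ^ card J) = 2 ^ card J" by (simp flip: ennreal_power)
  finally show ?thesis unfolding sobolev_energy_def .
qed

section \<open>Perturbations on a grid\<close>

text \<open>At most one summand is nonzero, so any \<open>g\<close> fixing 0 passes through the sum.
  It is used for the absolute value and the square.\<close>

lemma sum_disjoint_support:
  fixes u :: "'j \<Rightarrow> 'b::comm_monoid_add" and g :: "'b \<Rightarrow> 'c::comm_monoid_add"
  assumes J: "finite J" and disj: "\<And>i j. i \<in> J \<Longrightarrow> j \<in> J \<Longrightarrow> u i \<noteq> 0 \<Longrightarrow> u j \<noteq> 0 \<Longrightarrow> i = j"
    and g: "g 0 = 0"
  shows "g (\<Sum>j\<in>J. u j) = (\<Sum>j\<in>J. g (u j))"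
proof (cases "\<forall>j\<in>J. u j = 0")
  case True
  then show ?thesis by (simp add: g)
next
  case False
  then obtain j where j: "j \<in> J" "u j \<noteq> 0" by blast
  have z: "u i = 0" if "i \<in> J - {j}" for i using disj[of i j] j that by blast
  have "(\<Sum>j\<in>J. u j) = u j" using z by (simp add: sum.remove[OF J j(1)])
  moreover have "(\<Sum>j\<in>J. g (u j)) = g (u j)" using z by (simp add: sum.remove[OF J j(1)] g)
  ultimately show ?thesis by simp
qed

definition grid :: "nat \<Rightarrow> ('a::euclidean_space \<Rightarrow> nat) set" where
  "grid L = Basis \<rightarrow>\<^sub>E {..<L}"

lemma finite_grid: "finite (grid L)"
  by (auto simp: grid_def intro!: finite_PiE)

lemma card_grid: "card (grid L :: ('a::euclidean_space \<Rightarrow> nat) set) = L ^ DIM('a)"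
  by (simp add: grid_def card_PiE)

definition cell_corner :: "real \<Rightarrow> ('a::euclidean_space \<Rightarrow> nat) \<Rightarrow> 'a" where
  "cell_corner r j = (\<Sum>b\<in>Basis. (r * real (j b)) *\<^sub>R b)"

lemma cell_corner_inner: "b \<in> Basis \<Longrightarrow> cell_corner r j \<bullet> b = r * real (j b)"
  by (simp add: cell_corner_def inner_sum_left inner_Basis if_distrib cong: if_cong)

text \<open>Open boxes are pairwise disjoint, and they still contain every point where a bump is
  nonzero, because bumps vanish on the faces.\<close>

definition cell :: "real \<Rightarrow> ('a::euclidean_space \<Rightarrow> nat) \<Rightarrow> 'a set" where
  "cell r j = box (cell_corner r j) (cell_corner r j + r *\<^sub>R One)"

lemma mem_cell: "x \<in> cell r j \<longleftrightarrow> (\<forall>b\<in>Basis. r * real (j b) < x \<bullet> b \<and> x \<bullet> b < r * real (j b) + r)"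
  by (auto simp: cell_def mem_box cell_corner_inner inner_add_left)

lemma sets_cell [measurable]: "cell r j \<in> sets borel"
  by (simp add: cell_def)

lemma measure_cell: "0 \<le> r \<Longrightarrow> measure lborel (cell r j :: 'a::euclidean_space set) = r ^ DIM('a)"
  unfolding cell_def by (subst measure_lborel_box) (auto simp: inner_add_left)

lemma cell_unique:
  fixes r :: real
  assumes r: "0 < r" and ij: "i \<in> grid L" "j \<in> grid L" and x: "x \<in> cell r i" "x \<in> cell r j"
  shows "i = j"
proof (rule PiE_ext[OF ij[unfolded grid_def]])
  fix b :: 'a assume b: "b \<in> Basis"
  have "r * real (i b) < r * real (j b) + r" "r * real (j b) < r * real (i b) + r"
    using x b by (auto simp: mem_cell intro: less_trans)
  then have "r * real (i b) < r * (real (j b) + 1)" "r * real (j b) < r * (real (i b) + 1)"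
    by (simp_all add: distrib_left)
  then show "i b = j b" using r by (simp add: mult_less_cancel_left_pos)
qed

lemma cell_norm:
  fixes r :: real and x :: "'a::euclidean_space"
  assumes r: "0 < r" "real L * r = 1 / (2 * DIM('a))" and j: "j \<in> grid L" and x: "x \<in> cell r j"
  shows "b \<in> Basis \<Longrightarrow> 0 < x \<bullet> b \<and> x \<bullet> b < 1 / (2 * DIM('a))" "norm x \<le> 1"
proof -
  show *: "0 < x \<bullet> b \<and> x \<bullet> b < 1 / (2 * DIM('a))" if b: "b \<in> Basis" for b
  proof -
    have "j b < L" using j b by (auto simp: grid_def)
    then have "(real (j b) + 1) * r \<le> real L * r" using r by (intro mult_right_mono) auto
    moreover have "(real (j b) + 1) * r = r * real (j b) + r" by (simp add: algebra_simps)
    moreover have "r * real (j b) < x \<bullet> b \<and> x \<bullet> b < r * real (j b) + r" using x b by (simp add: mem_cell)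
    moreover have "0 \<le> r * real (j b)" using r by simp
    ultimately show ?thesis using r(2) by linarith
  qed
  have "norm x \<le> (\<Sum>b\<in>Basis. \<bar>x \<bullet> b\<bar>)" by (rule norm_le_l1)
  also have "\<dots> \<le> (\<Sum>b\<in>(Basis::'a set). 1 / (2 * DIM('a)))"
    by (rule sum_mono) (use * in \<open>auto simp: abs_le_iff less_imp_le\<close>)
  also have "\<dots> \<le> 1" by simp
  finally show "norm x \<le> 1" .
qed

lemma cell_diameter:
  fixes r :: real and x y :: "'a::euclidean_space"
  assumes "x \<in> cell r j" "y \<in> cell r j"
  shows "norm (x - y) \<le> DIM('a) * r"
proof -
  have "norm (x - y) \<le> (\<Sum>b\<in>Basis. \<bar>(x - y) \<bullet> b\<bar>)" by (rule norm_le_l1)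
  also have "\<dots> \<le> (\<Sum>b\<in>(Basis::'a set). r)"
    by (rule sum_mono) (use assms in \<open>force simp: mem_cell inner_diff_left abs_le_iff\<close>)
  finally show ?thesis by simp
qed

lemma box_bump_support:
  fixes r :: real
  assumes "0 < r" "unit_parabola dvd P" "box_bump P (cell_corner r j) r x \<noteq> 0"
  shows "x \<in> cell r j"
  using box_bump_nonzero[OF assms(3,1,2)] by (auto simp: mem_cell cell_corner_inner)

lemma box_bump_le:
  assumes "\<And>t. \<bar>poly_bump P t\<bar> \<le> S"
  shows "\<bar>box_bump P a r (x::'a::euclidean_space)\<bar> \<le> S ^ DIM('a)"
proof -
  have "\<bar>box_bump P a r x\<bar> = (\<Prod>b\<in>Basis. \<bar>poly_bump P ((x \<bullet> b - a \<bullet> b) / r)\<bar>)"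
    by (simp add: box_bump_def abs_prod)
  also have "\<dots> \<le> (\<Prod>b\<in>(Basis::'a set). S)" by (rule prod_mono) (use assms in auto)
  finally show ?thesis by simp
qed

lemma nn_integral_box_bump:
  fixes r :: real and g :: "real \<Rightarrow> real" and a :: "'a::euclidean_space"
  assumes r: "0 < r" and [measurable]: "g \<in> borel_measurable borel" and g0: "\<And>t. 0 \<le> g t"
    and int: "integrable lborel (\<lambda>t. g (poly_bump P t))"
  shows "(\<integral>\<^sup>+ x. ennreal (\<Prod>b\<in>Basis. g (poly_bump P ((x \<bullet> b - a \<bullet> b) / r))) \<partial>lborel)
    = ennreal ((r * (LINT t|lborel. g (poly_bump P t))) ^ DIM('a))"
proof -
  have "(\<integral>\<^sup>+ x. ennreal (\<Prod>b\<in>Basis. g (poly_bump P ((x \<bullet> b - a \<bullet> b) / r))) \<partial>lborel)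
      = (\<integral>\<^sup>+ x. (\<Prod>b\<in>Basis. ennreal (g (poly_bump P ((x \<bullet> b - a \<bullet> b) / r)))) \<partial>lborel)"
    by (simp add: prod_ennreal g0)
  also have "\<dots> = (\<Prod>b\<in>(Basis::'a set). \<integral>\<^sup>+ t. ennreal (g (poly_bump P ((t - a \<bullet> b) / r))) \<partial>lborel)"
    by (rule nn_integral_lborel_prod) auto
  also have "\<dots> = (\<Prod>b\<in>(Basis::'a set). ennreal (r * (LINT t|lborel. g (poly_bump P t))))"
  proof (rule prod.cong[OF refl])
    fix b :: 'a
    have "(\<integral>\<^sup>+ t. ennreal (g (poly_bump P ((t - a \<bullet> b) / r))) \<partial>lborel)
        = ennreal (LINT t|lborel. g (poly_bump P ((t - a \<bullet> b) / r)))"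
      by (rule nn_integral_eq_integral[OF integrable_scaled[OF int r]]) (simp add: g0)
    then show "(\<integral>\<^sup>+ t. ennreal (g (poly_bump P ((t - a \<bullet> b) / r))) \<partial>lborel)
        = ennreal (r * (LINT t|lborel. g (poly_bump P t)))"
      using integral_scaled[OF r, of "\<lambda>t. g (poly_bump P t)"] by simp
  qed
  also have "\<dots> = ennreal ((r * (LINT t|lborel. g (poly_bump P t))) ^ DIM('a))"
    using r g0 by (simp add: ennreal_power integral_nonneg)
  finally show ?thesis .
qed

definition bump_mass :: "real poly \<Rightarrow> real" where
  "bump_mass P = (LINT t|lborel. \<bar>poly_bump P t\<bar>)"

definition bump_energy :: "real poly \<Rightarrow> real" where
  "bump_energy P = (LINT t|lborel. (poly_bump P t)\<^sup>2)"

lemma integrable_poly_bump_square: "integrable lborel (\<lambda>t. (poly_bump P t)\<^sup>2)"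
proof -
  have "(\<lambda>t. (poly_bump P t)\<^sup>2) = poly_bump (P\<^sup>2)"
    by (auto simp: poly_bump_def indicator_def)
  then show ?thesis using integrable_poly_bump[of "P\<^sup>2"] by simp
qed

text \<open>A nonzero polynomial has finitely many roots, so its bump cannot vanish almost
  everywhere. Positivity is what allows normalising a density and bounding the perturbation norms
  from below.\<close>

lemma bump_pos:
  assumes P: "P \<noteq> 0"
  shows "0 < bump_mass P" "0 < bump_energy P"
proof -
  have no: False if "AE t in lborel. poly_bump P t = 0"
  proof -
    have "finite {t. poly P t = 0}" using P by (rule poly_roots_finite)
    then have "AE t in lborel. t \<notin> {t. poly P t = 0}"
      by (intro AE_not_in finite_imp_null_set_lborel)
    with that have "AE t in lborel. t \<notin> {0..1::real}"
      by eventually_elim (auto simp: poly_bump_def)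
    then have "emeasure lborel {0..1::real} = 0"
      by (subst (asm) AE_iff_measurable[of "{0..1}"]) auto
    then show False by simp
  qed
  have m0: "0 \<le> bump_mass P" "0 \<le> bump_energy P"
    by (auto simp: bump_mass_def bump_energy_def intro!: integral_nonneg)
  have "bump_mass P \<noteq> 0"
    using no integral_nonneg_eq_0_iff_AE[OF integrable_abs[OF integrable_poly_bump[of P]]]
    unfolding bump_mass_def by auto
  then show "0 < bump_mass P" using m0 by simp
  have "bump_energy P \<noteq> 0"
    using no integral_nonneg_eq_0_iff_AE[OF integrable_poly_bump_square[of P]]
    unfolding bump_energy_def by auto
  then show "0 < bump_energy P" using m0 by simp
qed

lemma
  fixes a :: "'a::euclidean_space"
  assumes r: "0 < r"
  shows nn_integral_abs_box_bump:
      "(\<integral>\<^sup>+ x. ennreal \<bar>box_bump P a r x\<bar> \<partial>lborel) = ennreal ((r * bump_mass P) ^ DIM('a))"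
    and nn_integral_box_bump_square:
      "(\<integral>\<^sup>+ x. ennreal ((box_bump P a r x)\<^sup>2) \<partial>lborel) = ennreal ((r * bump_energy P) ^ DIM('a))"
  using nn_integral_box_bump[OF r, of abs P a] nn_integral_box_bump[OF r, of "\<lambda>t. t\<^sup>2" P a]
    integrable_abs[OF integrable_poly_bump[of P]] integrable_poly_bump_square[of P]
  by (simp_all add: box_bump_def abs_prod prod_power_distrib bump_mass_def bump_energy_def)

lemma integrable_box_bump:
  fixes r :: real
  assumes r: "0 < r"
  shows "integrable lborel (box_bump P a r)"
  using nn_integral_abs_box_bump[OF r, of P a] by (intro integrableI_bounded) auto

lemma integral_box_bump:
  fixes r :: real and a :: "'a::euclidean_space"
  assumes r: "0 < r"
  shows "(LINT x|lborel. box_bump P a r x) = (r * (LINT t|lborel. poly_bump P t)) ^ DIM('a)"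
proof -
  have "(LINT x|lborel. box_bump P a r x) = (\<Prod>b\<in>(Basis::'a set). LINT t|lborel. poly_bump P ((t - a \<bullet> b) / r))"
    unfolding box_bump_def by (rule lborel_integral_prod) (rule integrable_scaled[OF integrable_poly_bump r])
  then show ?thesis by (simp add: integral_scaled[OF r, of "poly_bump P"])
qed

definition perturbation :: "real poly \<Rightarrow> nat \<Rightarrow> real \<Rightarrow> (('a::euclidean_space \<Rightarrow> nat) \<Rightarrow> real) \<Rightarrow> 'a \<Rightarrow> real" where
  "perturbation P L r \<sigma> x = (\<Sum>j\<in>grid L. \<sigma> j * box_bump P (cell_corner r j) r x)"

lemma borel_measurable_perturbation [measurable]: "perturbation P L r \<sigma> \<in> borel_measurable borel"
  unfolding perturbation_def by measurable

lemma integrable_perturbation: "0 < r \<Longrightarrow> integrable lborel (perturbation P L r \<sigma>)"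
  unfolding perturbation_def
  by (intro Bochner_Integration.integrable_sum integrable_mult_right integrable_box_bump)

lemma perturbation_apply:
  fixes r :: real and g :: "real \<Rightarrow> real"
  assumes r: "0 < r" and P: "unit_parabola dvd P" and g: "g 0 = 0"
  shows "g (perturbation P L r \<sigma> x) = (\<Sum>j\<in>grid L. g (\<sigma> j * box_bump P (cell_corner r j) r x))"
  unfolding perturbation_def
proof (rule sum_disjoint_support[OF finite_grid])
  fix i j assume ij: "i \<in> grid L" "j \<in> grid L"
    "\<sigma> i * box_bump P (cell_corner r i) r x \<noteq> 0" "\<sigma> j * box_bump P (cell_corner r j) r x \<noteq> 0"
  then show "i = j"
    using cell_unique[OF r ij(1,2)] box_bump_support[OF r P] by auto
qed (rule g)

lemma perturbation_cases:
  fixes r :: real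
  assumes r: "0 < r" and P: "unit_parabola dvd P" and nz: "perturbation P L r \<sigma> x \<noteq> 0"
  obtains j where "j \<in> grid L" "x \<in> cell r j" "perturbation P L r \<sigma> x = \<sigma> j * box_bump P (cell_corner r j) r x"
proof -
  obtain j where j: "j \<in> grid L" "\<sigma> j * box_bump P (cell_corner r j) r x \<noteq> 0"
    using nz unfolding perturbation_def by (meson sum.neutral)
  then have x: "x \<in> cell r j" using box_bump_support[OF r P] by auto
  have "\<sigma> i * box_bump P (cell_corner r i) r x = 0" if "i \<in> grid L - {j}" for i
    using that cell_unique[OF r _ j(1) _ x, of i] box_bump_support[OF r P, of i x] by auto
  then have "(\<Sum>i\<in>grid L - {j}. \<sigma> i * box_bump P (cell_corner r i) r x) = 0" by (rule sum.neutral[OF ballI])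
  then have "perturbation P L r \<sigma> x = \<sigma> j * box_bump P (cell_corner r j) r x"
    unfolding perturbation_def by (simp add: sum.remove[OF finite_grid j(1)])
  then show thesis using that j x by blast
qed

lemma perturbation_le:
  fixes r :: real and x :: "'a::euclidean_space"
  assumes r: "0 < r" and P: "unit_parabola dvd P" and \<sigma>: "\<sigma> \<in> signs (grid L)"
    and S: "\<And>t. \<bar>poly_bump P t\<bar> \<le> S" "0 \<le> S"
  shows "\<bar>perturbation P L r \<sigma> x\<bar> \<le> S ^ DIM('a)"
proof (cases "perturbation P L r \<sigma> x = 0")
  case False
  obtain j where "j \<in> grid L" "perturbation P L r \<sigma> x = \<sigma> j * box_bump P (cell_corner r j) r x"
    using perturbation_cases[OF r P False] by blast
  then show ?thesis
    using box_bump_le[of P S "cell_corner r j" r x] S(1) signs_abs[OF \<sigma>] by (simp add: abs_mult)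
qed (use S in simp)

text \<open>Disjoint cells and signs of modulus 1 make both integrals independent of \<sigma>. There
  are \<open>L ^ DIM('a)\<close> equal contributions proportional to \<open>r ^ DIM('a)\<close>, so
  only the total side \<open>L * r\<close> matters, and that is kept fixed later.\<close>

lemma nn_integral_perturbation:
  fixes r :: real
  assumes r: "0 < r" and P: "unit_parabola dvd P" and \<sigma>: "\<sigma> \<in> signs (grid L :: ('a::euclidean_space \<Rightarrow> nat) set)"
  shows "(\<integral>\<^sup>+ x. ennreal \<bar>perturbation P L r \<sigma> x\<bar> \<partial>lborel) = ennreal ((real L * r * bump_mass P) ^ DIM('a))"
    and "(\<integral>\<^sup>+ x. ennreal ((perturbation P L r \<sigma> x)\<^sup>2) \<partial>lborel) = ennreal ((real L * r * bump_energy P) ^ DIM('a))"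
proof -
  let ?h = "\<lambda>j::'a \<Rightarrow> nat. box_bump P (cell_corner r j) r"
  have n0: "0 \<le> bump_mass P" "0 \<le> bump_energy P"
    by (auto simp: bump_mass_def bump_energy_def intro!: integral_nonneg)
  have sq: "(\<sigma> j * y)\<^sup>2 = y\<^sup>2" "\<bar>\<sigma> j * y\<bar> = \<bar>y\<bar>" if "j \<in> grid L" for j y
    using signs_abs[OF \<sigma> that] by (simp_all add: power_mult_distrib abs_mult flip: power2_abs[of "\<sigma> j"])
  have "(\<integral>\<^sup>+ x. ennreal \<bar>perturbation P L r \<sigma> x\<bar> \<partial>lborel) = (\<integral>\<^sup>+ x. (\<Sum>j\<in>grid L. ennreal \<bar>?h j x\<bar>) \<partial>lborel)"
    unfolding perturbation_apply[where g=abs, OF r P abs_zero] by (simp add: sq sum_ennreal)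
  also have "\<dots> = (\<Sum>j\<in>grid L. \<integral>\<^sup>+ x. ennreal \<bar>?h j x\<bar> \<partial>lborel)"
    by (rule nn_integral_sum) measurable
  also have "\<dots> = ennreal (real (L ^ DIM('a)) * (r * bump_mass P) ^ DIM('a))"
    unfolding nn_integral_abs_box_bump[OF r] by (simp add: card_grid ennreal_mult n0 r less_imp_le ennreal_of_nat_eq_real_of_nat)
  finally show "(\<integral>\<^sup>+ x. ennreal \<bar>perturbation P L r \<sigma> x\<bar> \<partial>lborel) = ennreal ((real L * r * bump_mass P) ^ DIM('a))"
    by (simp add: power_mult_distrib mult.assoc)
  have "(\<integral>\<^sup>+ x. ennreal ((perturbation P L r \<sigma> x)\<^sup>2) \<partial>lborel) = (\<integral>\<^sup>+ x. (\<Sum>j\<in>grid L. ennreal ((?h j x)\<^sup>2)) \<partial>lborel)"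
    unfolding perturbation_apply[where g="\<lambda>t. t\<^sup>2", OF r P zero_power2] by (simp add: sq sum_ennreal)
  also have "\<dots> = (\<Sum>j\<in>grid L. \<integral>\<^sup>+ x. ennreal ((?h j x)\<^sup>2) \<partial>lborel)"
    by (rule nn_integral_sum) measurable
  also have "\<dots> = ennreal (real (L ^ DIM('a)) * (r * bump_energy P) ^ DIM('a))"
    unfolding nn_integral_box_bump_square[OF r] by (simp add: card_grid ennreal_mult n0 r less_imp_le ennreal_of_nat_eq_real_of_nat)
  finally show "(\<integral>\<^sup>+ x. ennreal ((perturbation P L r \<sigma> x)\<^sup>2) \<partial>lborel) = ennreal ((real L * r * bump_energy P) ^ DIM('a))"
    by (simp add: power_mult_distrib mult.assoc)
qed

lemma integral_perturbation:
  fixes r :: real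
  assumes r: "0 < r" and z: "(LINT t|lborel. poly_bump P t) = 0"
  shows "(LINT x|lborel. perturbation P L r \<sigma> (x::'a::euclidean_space)) = 0"
proof -
  have "(LINT x|lborel. perturbation P L r \<sigma> x)
      = (\<Sum>j\<in>grid L. (LINT x|lborel. \<sigma> j * box_bump P (cell_corner r j) r (x::'a)))"
    unfolding perturbation_def
    by (rule Bochner_Integration.integral_sum) (intro integrable_mult_right integrable_box_bump r)
  also have "\<dots> = 0" by (simp add: integral_box_bump[OF r] z power_0_left)
  finally show ?thesis .
qed

section \<open>Halfspace integrals of the perturbation and their variance\<close>

definition halfspace_integral :: "('a::euclidean_space \<Rightarrow> real) \<Rightarrow> 'a \<Rightarrow> real \<Rightarrow> real" where
  "halfspace_integral f w b = (LINT x|lborel. indicat_real (halfspace w b) x * f x)"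

lemma integrable_indicator_mult:
  fixes f :: "'a::euclidean_space \<Rightarrow> real"
  assumes "integrable lborel f" "H \<in> sets borel"
  shows "integrable lborel (\<lambda>x. indicat_real H x * f x)"
  using integrable_mult_indicator[of H lborel f] assms by simp

lemma halfspace_integral_perturbation:
  fixes r :: real
  assumes r: "0 < r"
  shows "halfspace_integral (perturbation P L r \<sigma>) w b
    = (\<Sum>j\<in>grid L. \<sigma> j * halfspace_integral (box_bump P (cell_corner r j) r) w b)"
proof -
  have "halfspace_integral (perturbation P L r \<sigma>) w b = (LINT x|lborel.
      (\<Sum>j\<in>grid L. \<sigma> j * (indicat_real (halfspace w b) x * box_bump P (cell_corner r j) r x)))"
    unfolding halfspace_integral_def perturbation_def by (simp add: sum_distrib_left mult_ac)
  also have "\<dots> = (\<Sum>j\<in>grid L. (LINT x|lborel. \<sigma> j * (indicat_real (halfspace w b) x * box_bump P (cell_corner r j) r x)))"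
    by (rule Bochner_Integration.integral_sum)
       (intro integrable_mult_right integrable_indicator_mult integrable_box_bump r sets_halfspace)
  finally show ?thesis by (simp add: halfspace_integral_def)
qed

text \<open>Bumps have mean zero, so only the cells that are cut by the hyperplane contribute. They lie in
  a slab of width comparable to \<open>r\<close>, hence there are only about \<open>r / r ^ d\<close> of them.\<close>

lemma halfspace_integral_box_bump_variance:
  fixes r :: real and w :: "'a::euclidean_space"
  assumes r: "0 < r" "real L * r = 1 / (2 * DIM('a))" and P: "unit_parabola dvd P"
    and z: "(LINT t|lborel. poly_bump P t) = 0" and w: "1/2 \<le> norm w" "norm w \<le> 2"
  shows "(\<Sum>j\<in>grid L. (halfspace_integral (box_bump P (cell_corner r j) r) w b)\<^sup>2)
    \<le> measure lborel (cball (0::'a) 7) * (2 * DIM('a)) * (bump_mass P ^ DIM('a))\<^sup>2 * r ^ (DIM('a) + 1)"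
proof -
  let ?h = "\<lambda>j::'a \<Rightarrow> nat. box_bump P (cell_corner r j) r"
  let ?a = "\<lambda>j. halfspace_integral (?h j) w b"
  let ?V = "measure lborel (cball (0::'a) 7)"
  let ?d = "DIM('a)"
  define J where "J = {j \<in> grid L. \<exists>x\<in>cell r j. \<exists>y\<in>cell r j. b \<le> w \<bullet> x \<and> w \<bullet> y < b}"
  have J: "finite J" "J \<subseteq> grid L" using finite_grid by (auto simp: J_def intro: finite_subset)
  have zero: "?a j = 0" if j: "j \<in> grid L - J" for j
  proof -
    have "(\<forall>x\<in>cell r j. b \<le> w \<bullet> x) \<or> (\<forall>x\<in>cell r j. w \<bullet> x < b)"
      using j unfolding J_def by (auto simp: not_le not_less)
    then show ?thesis
    proof
      assume inside: "\<forall>x\<in>cell r j. b \<le> w \<bullet> x"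
      have "indicat_real (halfspace w b) x * ?h j x = ?h j x" for x
        using inside box_bump_support[OF r(1) P, of j x] by (auto simp: halfspace_def indicator_def)
      then have "?a j = (LINT x|lborel. ?h j x)" by (simp only: halfspace_integral_def)
      then show ?thesis by (simp add: integral_box_bump[OF r(1)] z power_0_left)
    next
      assume outside: "\<forall>x\<in>cell r j. w \<bullet> x < b"
      have "indicat_real (halfspace w b) x * ?h j x = 0" for x
        using outside box_bump_support[OF r(1) P, of j x] by (fastforce simp: halfspace_def indicator_def not_less)
      then show ?thesis by (simp only: halfspace_integral_def integral_zero)
    qed
  qed
  have a_le: "\<bar>?a j\<bar> \<le> (r * bump_mass P) ^ ?d" for j
  proof -
    have int: "integrable lborel (?h j)" by (rule integrable_box_bump[OF r(1)])
    have "\<bar>?a j\<bar> \<le> (LINT x|lborel. \<bar>indicat_real (halfspace w b) x * ?h j x\<bar>)"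
      unfolding halfspace_integral_def by (rule integral_abs_bound)
    also have "\<dots> \<le> (LINT x|lborel. \<bar>?h j x\<bar>)"
      by (rule integral_mono[OF integrable_abs[OF integrable_indicator_mult[OF int sets_halfspace]] integrable_abs[OF int]])
         (simp add: indicator_def)
    also have "\<dots> = enn2real (\<integral>\<^sup>+ x. ennreal \<bar>?h j x\<bar> \<partial>lborel)"
      by (rule integral_eq_nn_integral) auto
    also have "\<dots> = (r * bump_mass P) ^ ?d"
      unfolding nn_integral_abs_box_bump[OF r(1)]
      using r by (simp add: bump_mass_def integral_nonneg)
    finally show ?thesis .
  qed
  \<comment> \<open>A cut cell contains points on both sides of the hyperplane and has diameter at
    most \<open>DIM('a) * r\<close>; the extra factor 2 is the bound for \<open>norm w\<close>.
    Disjoint cells inside one slab can then be counted by volume.\<close>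
  have sub: "(\<Union>j\<in>J. cell r j) \<subseteq> slab w b (2 * ?d * r)"
  proof (rule UN_least)
    fix j assume j: "j \<in> J"
    then obtain u v where uv: "u \<in> cell r j" "v \<in> cell r j" "b \<le> w \<bullet> u" "w \<bullet> v < b" by (auto simp: J_def)
    show "cell r j \<subseteq> slab w b (2 * ?d * r)"
    proof
      fix x assume x: "x \<in> cell r j"
      have near: "\<bar>w \<bullet> x - w \<bullet> y\<bar> \<le> 2 * ?d * r" if "y \<in> cell r j" for y
      proof -
        have "\<bar>w \<bullet> (x - y)\<bar> \<le> norm w * norm (x - y)" by (rule Cauchy_Schwarz_ineq2)
        also have "\<dots> \<le> 2 * (?d * r)" by (intro mult_mono w cell_diameter[OF x that]) auto
        finally show ?thesis by (simp add: inner_diff_right mult_ac)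
      qed
      have "\<bar>w \<bullet> x - b\<bar> \<le> 2 * ?d * r" using near[OF uv(1)] near[OF uv(2)] uv(3,4) by linarith
      then show "x \<in> slab w b (2 * ?d * r)"
        using cell_norm(2)[OF r _ x] j J(2) by (auto simp: slab_def)
    qed
  qed
  have fin: "cell r j \<in> fmeasurable lborel" for j :: "'a \<Rightarrow> nat"
    by (rule fmeasurable_lborel_bounded) (auto simp: cell_def)
  have "real (card J) * r ^ ?d = (\<Sum>j\<in>J. measure lborel (cell r j))"
    using r by (simp add: measure_cell)
  also have "\<dots> = measure lborel (\<Union>j\<in>J. cell r j)"
  proof (rule measure_UNION'[symmetric, OF J(1) fin])
    show "pairwise (\<lambda>i j. disjnt (cell r i) (cell r j)) J"
      using cell_unique[OF r(1)] J(2) unfolding pairwise_def disjnt_def by blast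
  qed
  also have "\<dots> \<le> measure lborel (slab w b (2 * ?d * r))"
    by (rule measure_mono_fmeasurable[OF sub])
       (use J(1) in \<open>auto intro!: fmeasurable_lborel_bounded bounded_subset[OF bounded_cball slab_subset]\<close>)
  also have "\<dots> \<le> ?V * (2 * ?d * r)" by (rule measure_slab_le[OF w(1)]) (use r in simp)
  finally have cardJ: "real (card J) * r ^ ?d \<le> ?V * (2 * ?d * r)" .
  have "(\<Sum>j\<in>grid L. (?a j)\<^sup>2) = (\<Sum>j\<in>J. (?a j)\<^sup>2)"
    by (rule sum.mono_neutral_right[OF finite_grid J(2)]) (use zero in auto)
  also have "\<dots> \<le> (\<Sum>j\<in>J. ((r * bump_mass P) ^ ?d)\<^sup>2)"
    by (rule sum_mono) (use a_le in \<open>auto intro: power2_le_iff_abs_le[THEN iffD2, OF order_trans[OF abs_ge_zero]]\<close>)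
  also have "\<dots> = (real (card J) * r ^ ?d) * ((bump_mass P ^ ?d)\<^sup>2 * r ^ ?d)"
    by (simp add: power_mult_distrib power2_eq_square)
  also have "\<dots> \<le> (?V * (2 * ?d * r)) * ((bump_mass P ^ ?d)\<^sup>2 * r ^ ?d)"
    by (rule mult_right_mono[OF cardJ]) (use r in auto)
  finally show ?thesis by (simp add: mult_ac)
qed

section \<open>Choice of the signs\<close>

text \<open>The signs are chosen for a net whose fineness depends on \<open>L\<close>, while
  \<open>A\<close> and \<open>D\<close> do not. Passing from the net to all halfspaces costs the
  supremum of the perturbation times the volume of a thin slab.\<close>

lemma exists_perturbation:
  assumes \<beta>: "0 < \<beta>" and m: "\<beta> + 1 \<le> real m" and P: "unit_parabola ^ m dvd P" "P \<noteq> 0"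
    and z: "(LINT t|lborel. poly_bump P t) = 0"
  obtains A D where "0 < A" "0 < D"
    "\<And>L r. 1 \<le> L \<Longrightarrow> r = 1 / (2 * real DIM('a::euclidean_space) * real L) \<Longrightarrow> \<exists>\<sigma>\<in>signs (grid L).
       sobolev_energy \<beta> (perturbation P L r \<sigma>) \<le> ennreal (A * r powr (- 2 * \<beta>)) \<and>
       (\<forall>(w::'a) b. norm w = 1 \<longrightarrow> 0 \<le> b \<longrightarrow>
          \<bar>halfspace_integral (perturbation P L r \<sigma>) w b\<bar> \<le> D * sqrt (r ^ (DIM('a) + 1) * (1 + ln (real L))))"
proof -
  let ?d = "DIM('a)"
  let ?V = "measure lborel (cball (0::'a) 7)"
  have d1: "1 \<le> real ?d" using DIM_positive[where 'a='a] by (simp add: Suc_le_eq)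
  have "m \<noteq> 0" using m \<beta> by (cases m) auto
  then have qP: "unit_parabola dvd P" using P(1) by (meson dvd_power dvd_trans neq0_conv)
  obtain A0 where A0: "0 < A0" "\<And>(a::'a) r. 0 < r \<Longrightarrow>
    sobolev_energy \<beta> (box_bump P a r) \<le> ennreal (A0 * r ^ ?d * r powr (- 2 * \<beta>))"
    using sobolev_energy_box_bump[OF \<beta> m P(1), where 'a='a] by blast
  obtain S where S: "0 < S" "\<And>t. \<bar>poly_bump P t\<bar> \<le> S" using poly_bump_bounded[of P] by blast
  define A where "A = A0 * (1 / (2 * ?d)) ^ ?d"
  define c1 where "c1 = ?V * (2 * ?d) * (bump_mass P ^ ?d)\<^sup>2"
  \<comment> \<open>The coefficient in \<open>ln (4 * B) \<le> c2 * \<Lambda>\<close>, obtained by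
    expanding the logarithm of the net cardinality and bounding each term by a multiple of
    \<Lambda>.\<close>
  define c2 where "c2 = ln 4 + (?d + 1) * (ln (4 * real ?d) + ?d * ln 2 + ?d)"
  define c3 where "c3 = 2 * (2 * real ?d) ^ ?d * S ^ ?d * ?V"
  have A: "0 < A" using A0 d1 by (simp add: A_def)
  have V: "0 < ?V" by (rule content_cball_pos) simp
  have c1: "0 < c1" using V d1 bump_pos(1)[OF P(2)] by (simp add: c1_def)
  have "1 \<le> 4 * real ?d" using d1 by linarith
  then have c2: "0 \<le> c2" unfolding c2_def by (intro add_nonneg_nonneg mult_nonneg_nonneg ln_ge_zero) auto
  have c3: "0 \<le> c3" unfolding c3_def using V S(1) by (intro mult_nonneg_nonneg) auto
  show thesis
  proof (rule that[of "2 * A" "(c2 + 1) * sqrt c1 + c3"])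
    show "0 < 2 * A" using A by simp
    show "0 < (c2 + 1) * sqrt c1 + c3" using c1 c2 c3 by (simp add: add_pos_nonneg)
    fix L :: nat and r :: real
    assume L: "1 \<le> L" and r_def: "r = 1 / (2 * real DIM('a) * real L)"
    have r: "0 < r" "real L * r = 1 / (2 * ?d)" using L d1 by (auto simp: r_def)
    have r1: "r \<le> 1" using mult_mono[of 1 "2 * real ?d" 1 "real L"] L d1 by (simp add: r_def)
    define \<Lambda> where "\<Lambda> = 1 + ln (real L)"
    have \<Lambda>: "1 \<le> \<Lambda>" using L by (simp add: \<Lambda>_def)
    let ?h = "\<lambda>j::'a \<Rightarrow> nat. box_bump P (cell_corner r j) r"
    let ?G = "grid L :: ('a \<Rightarrow> nat) set"
    let ?E = "\<lambda>\<sigma>. sobolev_energy \<beta> (perturbation P L r \<sigma> :: 'a \<Rightarrow> real)"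
    define V where "V = c1 * r ^ (?d + 1)"
    have V0: "0 < V" using c1 r by (simp add: V_def)
    \<comment> \<open>The value that balances \<open>\<Lambda> / l\<close> against
      \<open>l * V\<close>; both equal the square root of \<open>\<Lambda> * V\<close>.\<close>
    define l where "l = sqrt (\<Lambda> / V)"
    have l: "0 < l" using \<Lambda> V0 by (simp add: l_def)
    \<comment> \<open>The slab width \<open>2 / M\<close> is then of order
      \<open>r ^ DIM('a)\<close>, which is at most \<open>sqrt (r ^ (DIM('a) + 1))\<close> because
      \<open>r \<le> 1\<close>. The logarithm of the net size remains of order
      \<open>1 + ln L\<close>. The factor 2 ensures \<open>2 \<le> M\<close> even for
      \<open>L = 1\<close>.\<close>
    define M where "M = (2 * L) ^ ?d"
    define B where "B = real ((4 * ?d * M) ^ (?d + 1))"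
    have M2: "2 \<le> M"
    proof -
      have "2 * L \<le> (2 * L) ^ ?d" by (rule self_le_power) (use L in auto)
      then show ?thesis using L by (simp add: M_def)
    qed
    have total: "(\<Sum>\<sigma>\<in>signs ?G. ?E \<sigma>) \<le> ennreal (2 ^ card ?G * (A * r powr (- 2 * \<beta>)))"
    proof -
      have "(\<Sum>\<sigma>\<in>signs ?G. ?E \<sigma>) = 2 ^ card ?G * (\<Sum>j\<in>?G. sobolev_energy \<beta> (?h j))"
        unfolding perturbation_def
        by (rule sum_signs_sobolev_energy[OF finite_grid]) (rule integrable_box_bump[OF r(1)])
      also have "\<dots> \<le> 2 ^ card ?G * (\<Sum>j\<in>?G. ennreal (A0 * r ^ ?d * r powr (- 2 * \<beta>)))"
        by (intro mult_left_mono sum_mono A0 r) simp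
      also have "\<dots> = ennreal (2 ^ card ?G * (real (L ^ ?d) * (A0 * r ^ ?d * r powr (- 2 * \<beta>))))"
        using A0 r by (simp add: card_grid ennreal_mult ennreal_of_nat_eq_real_of_nat flip: ennreal_power)
      also have "real (L ^ ?d) * (A0 * r ^ ?d * r powr (- 2 * \<beta>)) = A0 * (real L * r) ^ ?d * r powr (- 2 * \<beta>)"
        by (simp add: power_mult_distrib)
      finally show ?thesis by (simp only: r(2) A_def)
    qed
    \<comment> \<open>\<open>exists_good_signs\<close> works with real costs, so each energy must be
      known to be finite before \<open>enn2real\<close> is applied; finiteness comes from the
      total.\<close>
    have fin: "?E \<sigma> < top" if "\<sigma> \<in> signs ?G" for \<sigma>
    proof -
      have "?E \<sigma> \<le> (\<Sum>\<sigma>\<in>signs ?G. ?E \<sigma>)"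
        by (rule member_le_sum[OF that]) (auto intro: finite_signs finite_grid)
      also have "\<dots> < top" using total by (rule order_le_less_trans) simp
      finally show ?thesis .
    qed
    have sumE: "(\<Sum>\<sigma>\<in>signs ?G. enn2real (?E \<sigma>)) \<le> 2 ^ card ?G * (A * r powr (- 2 * \<beta>))"
    proof -
      have "(\<Sum>\<sigma>\<in>signs ?G. enn2real (?E \<sigma>)) = enn2real (\<Sum>\<sigma>\<in>signs ?G. ?E \<sigma>)"
        by (subst enn2real_sum) (use fin in \<open>auto simp: o_def\<close>)
      also have "\<dots> \<le> 2 ^ card ?G * (A * r powr (- 2 * \<beta>))"
        by (rule enn2real_leI[OF _ total]) (use A in simp)
      finally show ?thesis .
    qed
    obtain \<sigma> where \<sigma>: "\<sigma> \<in> signs ?G" "enn2real (?E \<sigma>) \<le> 2 * (A * r powr (- 2 * \<beta>))"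
      and net: "\<And>h. h \<in> halfspace_net M \<Longrightarrow>
        \<bar>\<Sum>j\<in>?G. \<sigma> j * (case h of (w, b) \<Rightarrow> halfspace_integral (?h j) w b)\<bar> \<le> ln (4 * B) / l + l * V"
    proof (rule exists_good_signs[where J="?G" and N="halfspace_net M" and B=B and S="\<lambda>\<sigma>. enn2real (?E \<sigma>)"
          and A="A * r powr (- 2 * \<beta>)" and a="\<lambda>h j. (case h of (w, b) \<Rightarrow> halfspace_integral (?h j) w b)"
          and V=V and l=l])
      show "finite ?G" by (rule finite_grid)
      show "finite (halfspace_net M :: ('a \<times> real) set)" by (rule halfspace_net_card) (use M2 in simp)
      show "real (card (halfspace_net M :: ('a \<times> real) set)) \<le> B"
        unfolding B_def of_nat_le_iff by (rule halfspace_net_card) (use M2 in simp)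
      show "0 < B" using M2 by (simp add: B_def)
      show "(\<Sum>\<sigma>\<in>signs ?G. enn2real (?E \<sigma>)) \<le> 2 ^ card ?G * (A * r powr (- 2 * \<beta>))" by (rule sumE)
      show "0 < A * r powr (- 2 * \<beta>)" using A r by simp
      show "(\<Sum>j\<in>?G. (case h of (w, b) \<Rightarrow> halfspace_integral (?h j) w b)\<^sup>2) \<le> V"
        if "h \<in> halfspace_net M" for h
      proof -
        obtain w b where h: "h = (w, b)" by (cases h)
        show ?thesis
          using halfspace_integral_box_bump_variance[OF r qP z, of w b] halfspace_net_norm[of w b M] that
          unfolding h V_def c1_def by simp
      qed
    qed (use l in auto)
    let ?f = "perturbation P L r \<sigma>"
    have energy: "?E \<sigma> \<le> ennreal (2 * A * r powr (- 2 * \<beta>))"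
      using \<sigma>(2) fin[OF \<sigma>(1)] by (metis ennreal_enn2real ennreal_leI mult.assoc)
    have lnB: "ln (4 * B) \<le> c2 * \<Lambda>"
    proof -
      have "ln (4 * B) = ln 4 + (?d + 1) * (ln (4 * real ?d) + ?d * ln 2 + ?d * ln (real L))"
      proof -
        have L0: "0 < real L" and d0: "0 < 4 * real ?d" using L d1 by auto
        have "B = (4 * real ?d * (2 * real L) ^ ?d) ^ (?d + 1)" by (simp add: B_def M_def)
        then have "ln B = real (?d + 1) * ln (4 * real ?d * (2 * real L) ^ ?d)"
          by (simp only: ln_realpow)
        also have "ln (4 * real ?d * (2 * real L) ^ ?d) = ln (4 * real ?d) + ln ((2 * real L) ^ ?d)"
          by (rule ln_mult_pos) (use L0 d0 in auto)
        also have "ln ((2 * real L) ^ ?d) = ?d * ln (2 * real L)" by (rule ln_realpow)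
        also have "ln (2 * real L) = ln 2 + ln (real L)" by (rule ln_mult_pos) (use L0 in auto)
        finally have "ln B = (?d + 1) * (ln (4 * real ?d) + ?d * ln 2 + ?d * ln (real L))"
          by (simp add: algebra_simps)
        moreover have "ln (4 * B) = ln 4 + ln B" by (rule ln_mult_pos) (use M2 in \<open>auto simp: B_def\<close>)
        ultimately show ?thesis by simp
      qed
      also have "\<dots> \<le> ln 4 * \<Lambda> + (?d + 1) * (ln (4 * real ?d) * \<Lambda> + ?d * ln 2 * \<Lambda> + ?d * \<Lambda>)"
      proof -
        have "x \<le> x * \<Lambda>" if "0 \<le> x" for x using mult_left_mono[OF \<Lambda> that] by simp
        moreover have "ln (real L) \<le> \<Lambda>" by (simp add: \<Lambda>_def)
        moreover have ln4d: "ln (4 * real ?d) \<le> ln (4 * real ?d) * \<Lambda>"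
          using mult_left_mono[OF \<Lambda> ln_ge_zero[OF \<open>1 \<le> 4 * real ?d\<close>]] by (simp only: mult_1_right)
        ultimately show ?thesis using d1 by (intro add_mono mult_left_mono ln4d) auto
      qed
      also have "\<dots> = c2 * \<Lambda>" by (simp add: c2_def algebra_simps)
      finally show ?thesis .
    qed
    define R where "R = sqrt (r ^ (?d + 1) * \<Lambda>)"
    have lV: "l * V = sqrt c1 * R"
    proof -
      have "l * V = sqrt (\<Lambda> / V) * (sqrt V * sqrt V)" using V0 by (simp add: l_def)
      also have "\<dots> = sqrt (\<Lambda> / V * V * V)" by (simp only: real_sqrt_mult mult.assoc)
      also have "\<Lambda> / V * V * V = c1 * (r ^ (?d + 1) * \<Lambda>)" using V0 by (simp add: V_def)
      finally show ?thesis by (simp only: R_def real_sqrt_mult)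
    qed
    have \<Lambda>l: "\<Lambda> / l = l * V"
    proof -
      have "l * l = \<Lambda> / V" using \<Lambda> V0 by (simp add: l_def)
      then have "l * V * l = \<Lambda>" using V0 by (simp add: field_simps)
      then show ?thesis using l by (simp add: field_simps)
    qed
    have net': "ln (4 * B) / l + l * V \<le> (c2 + 1) * sqrt c1 * R"
    proof -
      have "ln (4 * B) / l \<le> c2 * \<Lambda> / l" using lnB l by (simp add: divide_right_mono)
      also have "\<dots> = c2 * (sqrt c1 * R)" by (simp only: \<Lambda>l lV times_divide_eq_right[symmetric])
      finally show ?thesis unfolding lV by (simp add: algebra_simps)
    qed
    have slab_err: "S ^ ?d * (?V * (2 / M)) \<le> c3 * R"
    proof -
      have "r ^ ?d \<le> R"
      proof (unfold R_def, rule real_le_rsqrt)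
        have "(r ^ ?d)\<^sup>2 = r ^ (?d + ?d)" by (simp add: power2_eq_square power_add)
        also have "\<dots> \<le> r ^ (?d + 1)" by (rule power_decreasing) (use r r1 d1 in auto)
        also have "\<dots> \<le> r ^ (?d + 1) * \<Lambda>" using mult_left_mono[OF \<Lambda>, of "r ^ (?d + 1)"] r by simp
        finally show "(r ^ ?d)\<^sup>2 \<le> r ^ (?d + 1) * \<Lambda>" .
      qed
      moreover have "2 / M \<le> 2 * (2 * ?d) ^ ?d * r ^ ?d"
      proof -
        have "1 / (2 * real L) \<le> 2 * ?d * r" using L d1 by (simp add: r_def field_simps)
        then have "(1 / (2 * real L)) ^ ?d \<le> (2 * ?d * r) ^ ?d" by (rule power_mono) simp
        then show ?thesis by (simp add: M_def power_one_over power_mult_distrib)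
      qed
      ultimately have "2 / M \<le> 2 * (2 * ?d) ^ ?d * R"
        by (meson mult_left_mono order_trans zero_le_numeral zero_le_power mult_nonneg_nonneg of_nat_0_le_iff)
      then have "S ^ ?d * (?V * (2 / M)) \<le> S ^ ?d * (?V * (2 * (2 * ?d) ^ ?d * R))"
        using S(1) by (intro mult_left_mono) auto
      then show ?thesis by (simp add: c3_def mult_ac)
    qed
    have "\<bar>halfspace_integral ?f w b\<bar> \<le> ((c2 + 1) * sqrt c1 + c3) * R"
      if wb: "norm w = 1" "0 \<le> b" for w :: 'a and b
    proof -
      obtain w' b' where n: "(w', b') \<in> halfspace_net M" and diff:
        "(halfspace w b - halfspace w' b') \<union> (halfspace w' b' - halfspace w b) \<subseteq> slab w' b' (2 / M) \<union> - cball 0 1"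
        using halfspace_net_approx[OF M2 wb] by blast
      have int: "integrable lborel ?f" by (rule integrable_perturbation[OF r(1)])
      have 1: "\<bar>halfspace_integral ?f w' b'\<bar> \<le> (c2 + 1) * sqrt c1 * R"
        using net[OF n] net' unfolding halfspace_integral_perturbation[OF r(1)] by simp
      have supp: "?f x = 0" if "x \<notin> cball 0 1" for x
      proof (rule ccontr)
        assume "?f x \<noteq> 0"
        then obtain j where "j \<in> grid L" "x \<in> cell r j" using perturbation_cases[OF r(1) qP] by metis
        then show False using cell_norm(2)[OF r] that by force
      qed
      \<comment> \<open>The two halfspaces may also differ outside the ball, but there the
        perturbation vanishes, so only the slab part of the bracket remains.\<close>
      have ptw: "\<bar>(indicat_real (halfspace w b) x - indicat_real (halfspace w' b') x) * ?f x\<bar>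
          \<le> S ^ ?d * indicat_real (slab w' b' (2 / M)) x" for x
      proof (cases "x \<in> cball 0 1")
        case True
        have le: "\<bar>?f x\<bar> \<le> S ^ ?d" by (rule perturbation_le[OF r(1) qP \<sigma>(1) S(2)]) (use S(1) in simp)
        show ?thesis
        proof (cases "x \<in> halfspace w b \<longleftrightarrow> x \<in> halfspace w' b'")
          case True
          then have "indicat_real (halfspace w b) x = indicat_real (halfspace w' b') x" by (simp add: indicator_def)
          then show ?thesis using S(1) by simp
        next
          case False
          then have "x \<in> slab w' b' (2 / M)" using diff True by blast
          then show ?thesis using False le by (auto simp: abs_mult indicator_def)
        qed
      qed (use supp S(1) in simp)
      have "halfspace_integral ?f w b - halfspace_integral ?f w' b'
          = (LINT x|lborel. (indicat_real (halfspace w b) x - indicat_real (halfspace w' b') x) * ?f x)"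
        unfolding halfspace_integral_def left_diff_distrib
        by (rule Bochner_Integration.integral_diff[symmetric])
           (auto intro!: integrable_indicator_mult[OF int])
      also have "\<bar>\<dots>\<bar> \<le> (LINT x|lborel. \<bar>(indicat_real (halfspace w b) x - indicat_real (halfspace w' b') x) * ?f x\<bar>)"
        by (rule integral_abs_bound)
      also have "\<dots> \<le> (LINT x|lborel. S ^ ?d * indicat_real (slab w' b' (2 / M)) x)"
      proof (rule integral_mono[OF _ _ ptw])
        show "integrable lborel (\<lambda>x. \<bar>(indicat_real (halfspace w b) x - indicat_real (halfspace w' b') x) * ?f x\<bar>)"
          unfolding left_diff_distrib
          by (intro integrable_abs Bochner_Integration.integrable_diff integrable_indicator_mult int sets_halfspace)
        have "slab w' b' (2 / M) \<in> fmeasurable lborel"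
          by (rule fmeasurable_lborel_bounded) (auto intro: bounded_subset[OF bounded_cball slab_subset])
        then show "integrable lborel (\<lambda>x. S ^ ?d * indicat_real (slab w' b' (2 / M)) x)"
          by (intro integrable_mult_right integrable_real_indicator) (auto simp: fmeasurable_def)
      qed
      also have "\<dots> = S ^ ?d * measure lborel (slab w' b' (2 / M))" by simp
      also have "\<dots> \<le> S ^ ?d * (?V * (2 / M))"
        using S(1) M2 by (intro mult_left_mono measure_slab_le halfspace_net_norm(1)[OF n]) auto
      finally have 2: "\<bar>halfspace_integral ?f w b - halfspace_integral ?f w' b'\<bar> \<le> c3 * R"
        using slab_err by linarith
      show ?thesis unfolding distrib_right[of "(c2 + 1) * sqrt c1"] using 1 2 by linarith
    qed
    then show "\<exists>\<sigma>\<in>signs (grid L).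
       sobolev_energy \<beta> (perturbation P L r \<sigma>) \<le> ennreal (2 * A * r powr (- 2 * \<beta>)) \<and>
       (\<forall>(w::'a) b. norm w = 1 \<longrightarrow> 0 \<le> b \<longrightarrow> \<bar>halfspace_integral (perturbation P L r \<sigma>) w b\<bar>
          \<le> ((c2 + 1) * sqrt c1 + c3) * sqrt (r ^ (DIM('a) + 1) * (1 + ln (real L))))"
      using energy \<sigma>(1) unfolding R_def \<Lambda>_def by blast
  qed
qed

section \<open>Passing to Sobolev norms and to the measures of halfspaces\<close>

lemma sobolev_energy_add_le:
  fixes u v :: "'a::euclidean_space \<Rightarrow> real"
  assumes u: "integrable lborel u" and v: "integrable lborel v"
  shows "sobolev_energy \<beta> (\<lambda>x. u x + c * v x) \<le> 2 * sobolev_energy \<beta> u + ennreal (2 * c\<^sup>2) * sobolev_energy \<beta> v"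
proof -
  have [measurable]: "u \<in> borel_measurable borel" "v \<in> borel_measurable borel" using u v by auto
  have ft: "fourier_transform (\<lambda>x. u x + c * v x) \<omega> = fourier_transform u \<omega> + of_real c * fourier_transform v \<omega>" for \<omega>
    unfolding fourier_transform_def
    using integrable_fourier_integrand[OF u, of \<omega>] integrable_fourier_integrand[OF v, of \<omega>]
    by (simp add: distrib_left mult.left_commute)
  have par: "(cmod (a + of_real c * b))\<^sup>2 \<le> 2 * (cmod a)\<^sup>2 + 2 * c\<^sup>2 * (cmod b)\<^sup>2" for a b
  proof -
    have "cmod (a + of_real c * b) \<le> cmod a + \<bar>c\<bar> * cmod b"
      using norm_triangle_ineq[of a "of_real c * b"] by (simp add: norm_mult)
    then have "(cmod (a + of_real c * b))\<^sup>2 \<le> (cmod a + \<bar>c\<bar> * cmod b)\<^sup>2" by (rule power_mono) simp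
    also have "\<dots> \<le> 2 * (cmod a)\<^sup>2 + 2 * (\<bar>c\<bar> * cmod b)\<^sup>2"
      using sum_squares_bound[of "cmod a" "\<bar>c\<bar> * cmod b"] unfolding power2_sum by linarith
    finally show ?thesis by (simp add: power_mult_distrib)
  qed
  have "sobolev_energy \<beta> (\<lambda>x. u x + c * v x)
    \<le> (\<integral>\<^sup>+ \<omega>. 2 * ennreal (norm \<omega> powr (2 * \<beta>) * (cmod (fourier_transform u \<omega>))\<^sup>2)
        + ennreal (2 * c\<^sup>2) * ennreal (norm \<omega> powr (2 * \<beta>) * (cmod (fourier_transform v \<omega>))\<^sup>2) \<partial>lborel)"
    unfolding sobolev_energy_def
  proof (rule nn_integral_mono)
    fix \<omega> :: 'a
    have "norm \<omega> powr (2 * \<beta>) * (cmod (fourier_transform (\<lambda>x. u x + c * v x) \<omega>))\<^sup>2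
        \<le> norm \<omega> powr (2 * \<beta>) * (2 * (cmod (fourier_transform u \<omega>))\<^sup>2 + 2 * c\<^sup>2 * (cmod (fourier_transform v \<omega>))\<^sup>2)"
      unfolding ft by (intro mult_left_mono par) simp
    also have "\<dots> = 2 * (norm \<omega> powr (2 * \<beta>) * (cmod (fourier_transform u \<omega>))\<^sup>2)
        + 2 * c\<^sup>2 * (norm \<omega> powr (2 * \<beta>) * (cmod (fourier_transform v \<omega>))\<^sup>2)"
      by (simp add: algebra_simps)
    finally have "ennreal (norm \<omega> powr (2 * \<beta>) * (cmod (fourier_transform (\<lambda>x. u x + c * v x) \<omega>))\<^sup>2)
        \<le> ennreal (2 * (norm \<omega> powr (2 * \<beta>) * (cmod (fourier_transform u \<omega>))\<^sup>2)
        + 2 * c\<^sup>2 * (norm \<omega> powr (2 * \<beta>) * (cmod (fourier_transform v \<omega>))\<^sup>2))"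
      by (rule ennreal_leI)
    also have "\<dots> = ennreal 2 * ennreal (norm \<omega> powr (2 * \<beta>) * (cmod (fourier_transform u \<omega>))\<^sup>2)
        + ennreal (2 * c\<^sup>2) * ennreal (norm \<omega> powr (2 * \<beta>) * (cmod (fourier_transform v \<omega>))\<^sup>2)"
      by (subst ennreal_plus, simp, simp) (subst (1 2) ennreal_mult, auto)
    finally show "ennreal (norm \<omega> powr (2 * \<beta>) * (cmod (fourier_transform (\<lambda>x. u x + c * v x) \<omega>))\<^sup>2)
        \<le> 2 * ennreal (norm \<omega> powr (2 * \<beta>) * (cmod (fourier_transform u \<omega>))\<^sup>2)
        + ennreal (2 * c\<^sup>2) * ennreal (norm \<omega> powr (2 * \<beta>) * (cmod (fourier_transform v \<omega>))\<^sup>2)"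
      by simp
  qed
  also have "\<dots> = 2 * sobolev_energy \<beta> u + ennreal (2 * c\<^sup>2) * sobolev_energy \<beta> v"
    unfolding sobolev_energy_def by (simp add: nn_integral_add nn_integral_cmult)
  finally show ?thesis .
qed

text \<open>The summand 1 provides the strict inequality, also when the energy attains its
  bound.\<close>

lemma sobolev_norm_less:
  assumes "sobolev_energy \<beta> f \<le> ennreal E" "0 \<le> E"
  shows "sobolev_norm \<beta> f < ennreal (sqrt E + 1)"
proof -
  have e: "sobolev_norm \<beta> f = ennreal_sqrt (sobolev_energy \<beta> f)"
    by (simp add: sobolev_norm_def sobolev_energy_def)
  have nt: "sobolev_energy \<beta> f \<noteq> top" using assms(1) by (auto simp: top_unique)
  have "enn2real (sobolev_energy \<beta> f) \<le> E" using assms by (intro enn2real_leI) auto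
  then have "sobolev_norm \<beta> f \<le> ennreal (sqrt E)"
    unfolding e ennreal_sqrt_def using nt by (simp add: ennreal_leI)
  also have "\<dots> < ennreal (sqrt E + 1)" using assms(2) by (intro ennreal_lessI add_nonneg_pos) auto
  finally show ?thesis .
qed

lemma measure_pdf_measure:
  assumes p: "pdf_on_unit_ball p"
  shows "integrable lborel p" "measure (pdf_measure p) (halfspace w b) = halfspace_integral p w b"
proof -
  have [measurable]: "p \<in> borel_measurable borel" and p0: "\<And>x. 0 \<le> p x" and p1: "(\<integral>\<^sup>+ x. ennreal (p x) \<partial>lborel) = 1"
    using p by (auto simp: pdf_on_unit_ball_def)
  show int: "integrable lborel p" by (rule integrableI_nonneg) (use p0 p1 in auto)
  have "emeasure (pdf_measure p) (halfspace w b) = (\<integral>\<^sup>+ x. ennreal (indicat_real (halfspace w b) x * p x) \<partial>lborel)"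
    unfolding pdf_measure_def by (subst emeasure_density) (auto intro!: nn_integral_cong simp: indicator_def)
  also have "\<dots> = ennreal (halfspace_integral p w b)"
    unfolding halfspace_integral_def
    by (rule nn_integral_eq_integral) (auto intro!: integrable_indicator_mult[OF int] simp: p0)
  finally show "measure (pdf_measure p) (halfspace w b) = halfspace_integral p w b"
    unfolding measure_def by (simp add: halfspace_integral_def integral_nonneg p0)
qed

section \<open>The densities\<close>

text \<open>The derivative rule for the Fourier transform at frequency 0, where the transform is the
  integral.\<close>

lemma integral_poly_bump_pderiv:
  assumes "poly R 0 = 0" "poly R 1 = 0"
  shows "(LINT t|lborel. poly_bump (pderiv R) t) = 0"
proof -
  have "complex_of_real (LINT t|lborel. poly_bump (pderiv R) t) = fourier_transform (poly_bump (pderiv R)) 0"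
    by (simp add: fourier_transform_def)
  also have "\<dots> = 0" unfolding fourier_transform_poly_bump_pderiv[OF assms] by simp
  finally show ?thesis by simp
qed

lemma comparable_ennreal:
  assumes "0 < a" "0 < b" "a / b \<le> K" "b / a \<le> K"
  shows "comparable K (ennreal a) (ennreal b)"
proof -
  have "0 \<le> K" using assms by (meson divide_pos_pos less_imp_le order_trans)
  then show ?thesis
    using assms unfolding comparable_def
    by (simp add: ennreal_mult[symmetric] pos_divide_le_eq)
qed

theorem densities_with_small_halfspace_discrepancy:
  fixes \<beta> :: real
  assumes \<beta>: "0 < \<beta>"
  shows "\<exists>c>0. \<exists>K>0. \<forall>\<delta>::real. 0 < \<delta> \<and> \<delta> < 1 \<longrightarrow>
    (\<exists>c'>0. \<forall>\<epsilon>::real. 0 < \<epsilon> \<and> \<epsilon> \<le> \<delta> \<longrightarrow>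
      (\<exists>p q :: 'a::euclidean_space \<Rightarrow> real.
         pdf_on_unit_ball p \<and> pdf_on_unit_ball q \<and>
         sobolev_norm \<beta> p < ennreal c \<and> sobolev_norm \<beta> q < ennreal c \<and>
         comparable K (L1_norm (\<lambda>x. p x - q x)) (L2_norm (\<lambda>x. p x - q x)) \<and>
         comparable K (L2_norm (\<lambda>x. p x - q x)) (ennreal \<epsilon>) \<and>
         (\<forall>n::nat. 0 < n \<and>
            real n \<le> ln (1 / \<epsilon>) powi (- int DIM('a))
                       * \<epsilon> powr (- ((2 * \<beta> + real DIM('a) + 1) / \<beta>)) \<longrightarrow>
            expected_halfspace_stat n p q \<le> c' / sqrt (real n))))"
proof -
  let ?d = "DIM('a)"
  have d1: "1 \<le> real ?d" using DIM_positive[where 'a='a] by (simp add: Suc_le_eq)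
  define s where "s = 1 / (2 * real ?d)"
  have s: "0 < s" using d1 by (simp add: s_def)
  define m where "m = nat \<lceil>\<beta>\<rceil> + 1"
  have m: "\<beta> + 1 \<le> real m" "1 \<le> m" using \<beta> by (auto simp: m_def of_nat_nat)
  define Q where "Q = unit_parabola ^ m"
  \<comment> \<open>The derivative of the next higher power has mean zero and still vanishes to
    order \<open>m\<close> at both endpoints, so cancellation and Fourier decay come
    together.\<close>
  define P where "P = pderiv (unit_parabola ^ Suc m)"
  have P: "unit_parabola ^ m dvd P" unfolding P_def by (rule dvd_pderiv_power_Suc) simp
  have P0: "P \<noteq> 0" by (simp add: P_def pderiv_eq_0_iff degree_power_eq del: power_Suc)
  have qP: "unit_parabola dvd P" "unit_parabola dvd Q"
    using P m(2) unfolding Q_def by (auto intro: dvd_trans[OF dvd_power] dvd_power)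
  have z: "(LINT t|lborel. poly_bump P t) = 0"
    unfolding P_def by (rule integral_poly_bump_pderiv) simp_all
  have polyQ: "poly Q t = (t * (1 - t)) ^ m" for t by (simp add: Q_def poly_power)
  have Q0: "Q \<noteq> 0" by (simp add: Q_def)
  obtain SP where SP: "0 < SP" "\<And>t. \<bar>poly_bump P t\<bar> \<le> SP" using poly_bump_bounded[of P] by blast
  obtain SQ where SQ: "0 < SQ" "\<And>t. \<bar>poly_bump Q t\<bar> \<le> SQ" using poly_bump_bounded[of Q] by blast
  obtain A D where A: "0 < A" and D: "0 < D" and
    pert: "\<And>L r. 1 \<le> L \<Longrightarrow> r = 1 / (2 * real ?d * real L) \<Longrightarrow> \<exists>\<sigma>\<in>signs (grid L).
       sobolev_energy \<beta> (perturbation P L r \<sigma>) \<le> ennreal (A * r powr (- 2 * \<beta>)) \<and>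
       (\<forall>(w::'a) b. norm w = 1 \<longrightarrow> 0 \<le> b \<longrightarrow>
          \<bar>halfspace_integral (perturbation P L r \<sigma>) w b\<bar> \<le> D * sqrt (r ^ (?d + 1) * (1 + ln (real L))))"
    using exists_perturbation[OF \<beta> m(1) P P0 z, where 'a='a] by blast
  obtain AQ where AQ: "0 < AQ" "\<And>(a::'a) r. 0 < r \<Longrightarrow>
    sobolev_energy \<beta> (box_bump Q a r) \<le> ennreal (AQ * r ^ ?d * r powr (- 2 * \<beta>))"
    using sobolev_energy_box_bump[OF \<beta> m(1) dvd_refl, folded Q_def, where 'a='a] by blast

  \<comment> \<open>The support of \<open>p\<close> is the box from \<open>- s\<close> to
    \<open>2 * s\<close> in every coordinate, which has l1 radius 1 and so lies in the unit ball.
    The perturbation lives in the middle third \<open>0 < x \<bullet> b < s\<close>, where t * (1 -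
    t) is at least 2/9; this gives the lower bound \<open>lo\<close>.\<close>
  define a0 :: 'a where "a0 = - s *\<^sub>R One"
  have a0: "a0 \<bullet> b = - s" if "b \<in> Basis" for b using that by (simp add: a0_def)
  have s3: "0 < 3 * s" using s by simp
  define u where "u = box_bump Q a0 (3 * s)"
  define Z where "Z = 1 / (3 * s * bump_mass Q) ^ ?d"
  define p where "p x = Z * u x" for x
  define lo where "lo = Z * ((2/9) ^ m) ^ ?d"
  have Z: "0 < Z" using s bump_pos(1)[OF Q0] by (simp add: Z_def)
  have lo: "0 < lo" using Z by (simp add: lo_def)
  have bump_nonneg: "0 \<le> poly_bump Q t" for t
    by (auto simp: poly_bump_def polyQ indicator_def)
  have u_nonneg: "0 \<le> u x" for x unfolding u_def box_bump_def by (intro prod_nonneg bump_nonneg)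
  have int_u: "integrable lborel u" unfolding u_def by (rule integrable_box_bump[OF s3])
  have [measurable]: "u \<in> borel_measurable borel" unfolding u_def by measurable
  have int_p: "integrable lborel p" unfolding p_def using int_u by simp
  have [measurable]: "p \<in> borel_measurable borel" unfolding p_def by measurable
  have p_nonneg: "0 \<le> p x" for x using Z u_nonneg by (simp add: p_def)
  have p_one: "(\<integral>\<^sup>+ x. ennreal (p x) \<partial>lborel) = 1"
  proof -
    have "(\<integral>\<^sup>+ x. ennreal (p x) \<partial>lborel) = ennreal Z * (\<integral>\<^sup>+ x. ennreal \<bar>u x\<bar> \<partial>lborel)"
      unfolding p_def using Z u_nonneg by (simp add: ennreal_mult nn_integral_cmult)
    also have "\<dots> = ennreal (Z * (3 * s * bump_mass Q) ^ ?d)"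
      unfolding u_def nn_integral_abs_box_bump[OF s3] using Z by (simp add: ennreal_mult')
    also have "Z * (3 * s * bump_mass Q) ^ ?d = 1" using s bump_pos(1)[OF Q0] by (simp add: Z_def)
    finally show ?thesis by simp
  qed
  have p_supp: "p x = 0" if "x \<notin> cball 0 1" for x
  proof (rule ccontr)
    assume "p x \<noteq> 0"
    then have nz: "box_bump Q a0 (3 * s) x \<noteq> 0" by (auto simp: p_def u_def)
    have "\<bar>x \<bullet> b\<bar> \<le> 2 * s" if b: "b \<in> Basis" for b
      using box_bump_nonzero[OF nz s3 qP(2) b] a0[OF b] s by auto
    then have "(\<Sum>b\<in>Basis. \<bar>x \<bullet> b\<bar>) \<le> (\<Sum>b\<in>(Basis::'a set). 2 * s)" by (rule sum_mono)
    also have "\<dots> = 1" by (simp add: s_def)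
    finally show False using norm_le_l1[of x] that by simp
  qed
  have pdf_p: "pdf_on_unit_ball p"
    unfolding pdf_on_unit_ball_def using p_nonneg p_one p_supp by auto
  have p_le: "p x \<le> Z * SQ ^ ?d" for x
    unfolding p_def u_def using box_bump_le[OF SQ(2), of a0 "3 * s" x] Z by (intro mult_left_mono) auto
  have p_ge: "lo \<le> p x" if x: "\<And>b. b \<in> Basis \<Longrightarrow> 0 < x \<bullet> b \<and> x \<bullet> b < s" for x
  proof -
    have "(\<Prod>b\<in>(Basis::'a set). (2/9) ^ m) \<le> u x"
      unfolding u_def box_bump_def
    proof (rule prod_mono, intro conjI)
      fix b :: 'a assume b: "b \<in> Basis"
      define t where "t = (x \<bullet> b - a0 \<bullet> b) / (3 * s)"
      have t: "1/3 \<le> t" "t \<le> 2/3" using x[OF b] a0[OF b] s by (auto simp: t_def field_simps)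
      have "0 \<le> (t - 1/3) * (2/3 - t)" using t by (intro mult_nonneg_nonneg) auto
      also have "(t - 1/3) * (2/3 - t) = t * (1 - t) - 2/9" by (simp add: field_simps)
      finally have "2/9 \<le> t * (1 - t)" by simp
      then have "(2/9) ^ m \<le> (t * (1 - t)) ^ m" by (rule power_mono) simp
      then show "(2/9) ^ m \<le> poly_bump Q ((x \<bullet> b - a0 \<bullet> b) / (3 * s))"
        using t unfolding t_def[symmetric] by (simp add: poly_bump_def polyQ)
    qed simp
    then show ?thesis unfolding lo_def p_def using Z by (simp add: mult_left_mono)
  qed
  define E0 where "E0 = 2 * Z\<^sup>2 * (AQ * (3 * s) ^ ?d * (3 * s) powr (- 2 * \<beta>))"
  have E0: "0 \<le> E0" using AQ s by (simp add: E0_def)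
  have energy_p: "sobolev_energy \<beta> p \<le> ennreal E0"
  proof -
    have "sobolev_energy \<beta> (\<lambda>x. 0 + Z * u x) \<le> 2 * sobolev_energy \<beta> (\<lambda>_::'a. 0) + ennreal (2 * Z\<^sup>2) * sobolev_energy \<beta> u"
      by (rule sobolev_energy_add_le) (auto simp: int_u)
    also have "sobolev_energy \<beta> (\<lambda>_::'a. 0) = 0" by (simp add: sobolev_energy_def fourier_transform_def)
    also have "2 * 0 + ennreal (2 * Z\<^sup>2) * sobolev_energy \<beta> u
        \<le> ennreal (2 * Z\<^sup>2) * ennreal (AQ * (3 * s) ^ ?d * (3 * s) powr (- 2 * \<beta>))"
      unfolding u_def using AQ(2)[OF s3, of a0] by (simp add: mult_left_mono)
    finally show ?thesis unfolding p_def E0_def by (simp add: ennreal_mult')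
  qed

  \<comment> \<open>With this height the perturbation is at most \<open>lo\<close> for every
    \<open>\<epsilon> < 1\<close>, so \<open>q\<close> stays nonnegative.\<close>
  define \<kappa> where "\<kappa> = lo / SP ^ ?d"
  have \<kappa>: "0 < \<kappa>" using lo SP by (simp add: \<kappa>_def)
  \<comment> \<open>The energy of a sum costs a factor 2. The last factor is the bound for
    \<open>\<epsilon>\<^sup>2 * r powr (- 2 * \<beta>)\<close> that follows from the choice of
    \<open>L\<close>.\<close>
  define E1 where "E1 = 2 * E0 + 2 * \<kappa>\<^sup>2 * (A * (2 * ?d) powr (2 * \<beta>))"
  have E1: "0 \<le> E1" "E0 \<le> E1" using E0 A by (auto simp: E1_def)
  define n1 where "n1 = \<kappa> * (s * bump_mass P) ^ ?d"
  define n2 where "n2 = \<kappa> * sqrt ((s * bump_energy P) ^ ?d)"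
  have n12: "0 < n1" "0 < n2" using \<kappa> s bump_pos[OF P0] by (auto simp: n1_def n2_def)
  \<comment> \<open>Since \<open>L * r = s\<close> exactly, the L1 and L2 norms of
    \<open>p - q\<close> will be exactly \<open>n1 * \<epsilon>\<close> and
    \<open>n2 * \<epsilon>\<close>. \<open>K\<close> exceeds every quotient that the comparisons
    need.\<close>
  define K where "K = n1 / n2 + n2 / n1 + n2 + 1 / n2"
  have K: "0 < K" "n1 / n2 \<le> K" "n2 / n1 \<le> K" "n2 \<le> K" "1 / n2 \<le> K"
    using n12 by (auto simp: K_def intro!: add_pos_pos add_nonneg_nonneg)
  define Bd where "Bd = Z * SQ ^ ?d + lo"
  define C where "C = halfspace_chaining_constant TYPE('a) Bd"
  have main: "\<exists>c'>0. \<forall>\<epsilon>::real. 0 < \<epsilon> \<and> \<epsilon> \<le> \<delta> \<longrightarrow>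
      (\<exists>p q :: 'a \<Rightarrow> real.
         pdf_on_unit_ball p \<and> pdf_on_unit_ball q \<and>
         sobolev_norm \<beta> p < ennreal (sqrt E1 + 1) \<and> sobolev_norm \<beta> q < ennreal (sqrt E1 + 1) \<and>
         comparable K (L1_norm (\<lambda>x. p x - q x)) (L2_norm (\<lambda>x. p x - q x)) \<and>
         comparable K (L2_norm (\<lambda>x. p x - q x)) (ennreal \<epsilon>) \<and>
         (\<forall>n::nat. 0 < n \<and>
            real n \<le> ln (1 / \<epsilon>) powi (- int ?d) * \<epsilon> powr (- ((2 * \<beta> + real ?d + 1) / \<beta>)) \<longrightarrow>
            expected_halfspace_stat n p q \<le> c' / sqrt (real n)))"
    if \<delta>: "0 < \<delta>" "\<delta> < 1" for \<delta> :: real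
  proof -
    define \<Lambda>0 where "\<Lambda>0 = ln (1 / \<delta>)"
    have \<Lambda>0: "0 < \<Lambda>0" using \<delta> by (simp add: \<Lambda>0_def)
    \<comment> \<open>The value at \<open>\<Lambda>0\<close> of
      \<open>(1 + \<Lambda> / \<beta>) / \<Lambda> ^ DIM('a)\<close>. Both terms are nonincreasing
      in \<Lambda> because the dimension is at least 1, so \<open>M\<close> bounds the expression
      for all \<open>\<epsilon> \<le> \<delta>\<close>.\<close>
    define M where "M = 1 / \<Lambda>0 ^ ?d + 1 / (\<beta> * \<Lambda>0 ^ (?d - 1))"
    have M: "0 \<le> M" using \<Lambda>0 \<beta> by (simp add: M_def)
    define c' where "c' = 2 * \<bar>C\<bar> + \<kappa> * D * sqrt M + 1"
    have c': "0 < c'" unfolding c'_def using \<kappa> D M by (intro add_nonneg_pos add_nonneg_nonneg) auto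
    have "\<exists>p q :: 'a \<Rightarrow> real.
         pdf_on_unit_ball p \<and> pdf_on_unit_ball q \<and>
         sobolev_norm \<beta> p < ennreal (sqrt E1 + 1) \<and> sobolev_norm \<beta> q < ennreal (sqrt E1 + 1) \<and>
         comparable K (L1_norm (\<lambda>x. p x - q x)) (L2_norm (\<lambda>x. p x - q x)) \<and>
         comparable K (L2_norm (\<lambda>x. p x - q x)) (ennreal \<epsilon>) \<and>
         (\<forall>n::nat. 0 < n \<and>
            real n \<le> ln (1 / \<epsilon>) powi (- int ?d) * \<epsilon> powr (- ((2 * \<beta> + real ?d + 1) / \<beta>)) \<longrightarrow>
            expected_halfspace_stat n p q \<le> c' / sqrt (real n))"
      if \<epsilon>: "0 < \<epsilon>" "\<epsilon> \<le> \<delta>" for \<epsilon> :: real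
    proof -
      \<comment> \<open>\<open>L\<close> is within a factor 2 of \<open>X\<close>. The bound
        \<open>L \<le> X\<close> keeps the Sobolev energy of \<open>q\<close> under control, and
        \<open>X \<le> 2 * L\<close> keeps the cells small enough for the discrepancy.\<close>
      define X where "X = \<epsilon> powr (- 1 / \<beta>)"
      define L where "L = nat \<lfloor>X\<rfloor>"
      define r where "r = 1 / (2 * real ?d * real L)"
      have \<epsilon>1: "\<epsilon> < 1" using \<epsilon> \<delta> by simp
      have X1: "1 \<le> X" unfolding X_def using \<epsilon> \<epsilon>1 \<beta> powr_mono'[of "- 1 / \<beta>" 0 \<epsilon>] by simp
      have L: "1 \<le> L" "real L \<le> X" "X \<le> 2 * real L"
      proof -
        show L1: "1 \<le> L" unfolding L_def by (rule le_nat_floor) (use X1 in simp)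
        have "real L = of_int \<lfloor>X\<rfloor>" using X1 by (simp add: L_def)
        then have fl: "real L \<le> X" "X < real L + 1" by linarith+
        show "real L \<le> X" by (rule fl(1))
        show "X \<le> 2 * real L" using fl(2) L1 by linarith
      qed
      have r: "0 < r" "real L * r = s" using L(1) d1 by (auto simp: r_def s_def)
      have r': "real L * r = 1 / real (2 * ?d)" using r(2) by (simp add: s_def)
      obtain \<sigma> where \<sigma>: "\<sigma> \<in> signs (grid L)"
        and energy: "sobolev_energy \<beta> (perturbation P L r \<sigma> :: 'a \<Rightarrow> real) \<le> ennreal (A * r powr (- 2 * \<beta>))"
        and disc: "\<And>(w::'a) b. norm w = 1 \<Longrightarrow> 0 \<le> b \<Longrightarrow>
          \<bar>halfspace_integral (perturbation P L r \<sigma>) w b\<bar> \<le> D * sqrt (r ^ (?d + 1) * (1 + ln (real L)))"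
        using pert[OF L(1) r_def] by blast
      define f where "f = (perturbation P L r \<sigma> :: 'a \<Rightarrow> real)"
      have [measurable]: "f \<in> borel_measurable borel" unfolding f_def by measurable
      have int_f: "integrable lborel f" unfolding f_def by (rule integrable_perturbation[OF r(1)])
      define q where "q x = p x + (\<kappa> * \<epsilon>) * f x" for x
      have [measurable]: "q \<in> borel_measurable borel" unfolding q_def by measurable
      have \<kappa>\<epsilon>: "0 < \<kappa> * \<epsilon>" using \<kappa> \<epsilon> by simp
      have f_le: "\<bar>(\<kappa> * \<epsilon>) * f x\<bar> \<le> lo" for x
      proof -
        have "\<bar>f x\<bar> \<le> SP ^ ?d"
          unfolding f_def by (rule perturbation_le[OF r(1) qP(1) \<sigma> SP(2)]) (use SP(1) in simp)
        then have "(\<kappa> * \<epsilon>) * \<bar>f x\<bar> \<le> (\<kappa> * 1) * SP ^ ?d"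
          using \<kappa> \<epsilon> \<epsilon>1 by (intro mult_mono) auto
        also have "\<dots> = lo" using SP by (simp add: \<kappa>_def)
        finally show ?thesis using \<kappa> \<epsilon>(1) by (simp add: abs_mult)
      qed
      have f_supp: "0 < x \<bullet> b \<and> x \<bullet> b < s" "norm x \<le> 1" if "f x \<noteq> 0" "b \<in> Basis" for x b
      proof -
        obtain j where "j \<in> grid L" "x \<in> cell r j"
          using perturbation_cases[OF r(1) qP(1)] \<open>f x \<noteq> 0\<close> unfolding f_def by metis
        then show "0 < x \<bullet> b \<and> x \<bullet> b < s" "norm x \<le> 1"
          using cell_norm[OF r(1) r'] \<open>b \<in> Basis\<close> by (auto simp: s_def)
      qed
      have q_nonneg: "0 \<le> q x" for x
      proof (cases "f x = 0")
        case False
        have "lo \<le> p x" by (rule p_ge) (use f_supp(1)[OF False] in blast)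
        then show ?thesis using f_le[of x] unfolding q_def by linarith
      qed (simp add: q_def p_nonneg)
      have q_supp: "q x = 0" if "x \<notin> cball 0 1" for x
        using p_supp[OF that] f_supp(2)[of x "SOME b. b \<in> Basis"] that by (auto simp: q_def SOME_Basis)
      have int_q: "integrable lborel q" unfolding q_def using int_p int_f by simp
      have pdf_q: "pdf_on_unit_ball q"
      proof -
        have "(LINT x|lborel. p x) = 1"
          using nn_integral_eq_integral[OF int_p] p_nonneg p_one
          by (simp add: ennreal_eq_1 flip: ennreal_1)
        moreover have "(LINT x|lborel. f x) = 0" unfolding f_def by (rule integral_perturbation[OF r(1) z])
        ultimately have "(LINT x|lborel. q x) = 1" unfolding q_def using int_p int_f by simp
        then have "(\<integral>\<^sup>+ x. ennreal (q x) \<partial>lborel) = 1"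
          using nn_integral_eq_integral[OF int_q] q_nonneg by simp
        then show ?thesis unfolding pdf_on_unit_ball_def using q_nonneg q_supp by auto
      qed
      have sob_p: "sobolev_norm \<beta> p < ennreal (sqrt E1 + 1)"
        by (rule sobolev_norm_less) (use energy_p E1 in \<open>auto intro: order_trans ennreal_leI\<close>)
      have sob_q: "sobolev_norm \<beta> q < ennreal (sqrt E1 + 1)"
      proof (rule sobolev_norm_less[OF _ E1(1)])
        have rX: "\<epsilon>\<^sup>2 * r powr (- 2 * \<beta>) \<le> (2 * ?d) powr (2 * \<beta>)"
        proof -
          have "r powr (- 2 * \<beta>) = (2 * ?d * real L) powr (2 * \<beta>)"
            unfolding r_def using L(1) d1 by (simp add: powr_minus powr_divide)
          also have "\<dots> = (2 * ?d) powr (2 * \<beta>) * real L powr (2 * \<beta>)" by (simp add: powr_mult)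
          also have "\<dots> \<le> (2 * ?d) powr (2 * \<beta>) * X powr (2 * \<beta>)"
            using L \<beta> by (intro mult_left_mono powr_mono2) auto
          also have "X powr (2 * \<beta>) = \<epsilon> powr (- 2)" using \<beta> by (simp add: X_def powr_powr)
          also have "\<dots> = 1 / \<epsilon>\<^sup>2" using \<epsilon> by (simp add: powr_minus_divide)
          finally show ?thesis using \<epsilon> by (simp add: field_simps)
        qed
        have "sobolev_energy \<beta> q \<le> 2 * sobolev_energy \<beta> p + ennreal (2 * (\<kappa> * \<epsilon>)\<^sup>2) * sobolev_energy \<beta> f"
          unfolding q_def by (rule sobolev_energy_add_le[OF int_p int_f])
        also have "\<dots> \<le> 2 * ennreal E0 + ennreal (2 * (\<kappa> * \<epsilon>)\<^sup>2) * ennreal (A * r powr (- 2 * \<beta>))"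
          using energy_p energy unfolding f_def by (intro add_mono mult_left_mono) auto
        also have "\<dots> = ennreal (2 * E0 + 2 * (\<kappa> * \<epsilon>)\<^sup>2 * (A * r powr (- 2 * \<beta>)))"
        proof -
          have "2 * ennreal E0 = ennreal (2 * E0)" by (simp add: ennreal_mult')
          moreover have "ennreal (2 * (\<kappa> * \<epsilon>)\<^sup>2) * ennreal (A * r powr (- 2 * \<beta>))
              = ennreal (2 * (\<kappa> * \<epsilon>)\<^sup>2 * (A * r powr (- 2 * \<beta>)))"
            by (rule ennreal_mult'[symmetric]) simp
          ultimately show ?thesis using E0 A by (simp add: ennreal_plus)
        qed
        also have "\<dots> \<le> ennreal E1"
        proof (rule ennreal_leI)
          have "2 * (\<kappa> * \<epsilon>)\<^sup>2 * (A * r powr (- 2 * \<beta>)) = 2 * \<kappa>\<^sup>2 * A * (\<epsilon>\<^sup>2 * r powr (- 2 * \<beta>))"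
            by (simp add: power_mult_distrib)
          also have "\<dots> \<le> 2 * \<kappa>\<^sup>2 * A * (2 * ?d) powr (2 * \<beta>)" using A by (intro mult_left_mono rX) auto
          finally show "2 * E0 + 2 * (\<kappa> * \<epsilon>)\<^sup>2 * (A * r powr (- 2 * \<beta>)) \<le> E1" by (simp add: E1_def)
        qed
        finally show "sobolev_energy \<beta> q \<le> ennreal E1" .
      qed
      have pq: "p x - q x = - ((\<kappa> * \<epsilon>) * f x)" for x by (simp add: q_def)
      have L1: "L1_norm (\<lambda>x. p x - q x) = ennreal (n1 * \<epsilon>)"
      proof -
        have "L1_norm (\<lambda>x. p x - q x) = ennreal (\<kappa> * \<epsilon>) * (\<integral>\<^sup>+ x. ennreal \<bar>f x\<bar> \<partial>lborel)"
          unfolding L1_norm_def pq using \<kappa> \<epsilon>(1) by (simp add: abs_mult ennreal_mult nn_integral_cmult)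
        then show ?thesis
          unfolding f_def nn_integral_perturbation(1)[OF r(1) qP(1) \<sigma>] r(2)
          using \<kappa>\<epsilon> by (simp add: n1_def mult_ac flip: ennreal_mult')
      qed
      have L2: "L2_norm (\<lambda>x. p x - q x) = ennreal (n2 * \<epsilon>)"
      proof -
        have "(\<integral>\<^sup>+ x. ennreal (\<bar>p x - q x\<bar>\<^sup>2) \<partial>lborel) = ennreal ((\<kappa> * \<epsilon>)\<^sup>2) * (\<integral>\<^sup>+ x. ennreal ((f x)\<^sup>2) \<partial>lborel)"
          unfolding pq by (simp add: power_mult_distrib[of "\<kappa> * \<epsilon>"] ennreal_mult nn_integral_cmult)
        also have "\<dots> = ennreal ((\<kappa> * \<epsilon>)\<^sup>2 * (s * bump_energy P) ^ ?d)"
          unfolding f_def nn_integral_perturbation(2)[OF r(1) qP(1) \<sigma>] r(2)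
          by (rule ennreal_mult'[symmetric]) simp
        finally have "(\<integral>\<^sup>+ x. ennreal (\<bar>p x - q x\<bar>\<^sup>2) \<partial>lborel) = ennreal ((\<kappa> * \<epsilon>)\<^sup>2 * (s * bump_energy P) ^ ?d)" .
        then show ?thesis
          unfolding L2_norm_def ennreal_sqrt_def using \<kappa>\<epsilon> s bump_pos(2)[OF P0] \<kappa> \<epsilon>
          by (simp add: real_sqrt_mult n2_def mult_ac)
      qed
      have comp1: "comparable K (ennreal (n1 * \<epsilon>)) (ennreal (n2 * \<epsilon>))"
        by (rule comparable_ennreal) (use n12 \<epsilon> K in auto)
      have comp2: "comparable K (ennreal (n2 * \<epsilon>)) (ennreal \<epsilon>)"
        by (rule comparable_ennreal) (use n12 \<epsilon> K in auto)
      have stat: "expected_halfspace_stat n p q \<le> c' / sqrt (real n)"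
        if n: "0 < n" and n_le: "real n \<le> ln (1 / \<epsilon>) powi (- int ?d) * \<epsilon> powr (- ((2 * \<beta> + real ?d + 1) / \<beta>))" for n
      proof -
        define \<Lambda> where "\<Lambda> = ln (1 / \<epsilon>)"
        have \<Lambda>: "\<Lambda>0 \<le> \<Lambda>" "0 < \<Lambda>" using \<Lambda>0 \<epsilon> \<delta> by (auto simp: \<Lambda>_def \<Lambda>0_def ln_div)
        define R where "R = r ^ (?d + 1) * (1 + ln (real L))"
        have R0: "0 \<le> R" using r(1) L(1) by (simp add: R_def)
        have lnL: "ln (real L) \<le> \<Lambda> / \<beta>"
        proof -
          have "ln (real L) \<le> ln X" using L by simp
          also have "\<dots> = \<Lambda> / \<beta>" using \<epsilon> by (simp add: X_def ln_powr \<Lambda>_def ln_div)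
          finally show ?thesis .
        qed
        have r_le: "r \<le> \<epsilon> powr (1 / \<beta>)"
        proof -
          have "X \<le> 2 * real ?d * real L" using L(3) d1 mult_right_mono[of 1 "real ?d" "2 * real L"] by simp
          then have "r \<le> 1 / X" unfolding r_def using X1 by (intro frac_le) auto
          also have "1 / X = \<epsilon> powr (1 / \<beta>)" by (simp add: X_def powr_minus_divide)
          finally show ?thesis .
        qed
        have "r ^ (?d + 1) \<le> (\<epsilon> powr (1 / \<beta>)) ^ (?d + 1)" by (rule power_mono[OF r_le]) (use r in simp)
        also have "\<dots> = (\<epsilon> powr (1 / \<beta>)) powr real (?d + 1)"
          by (rule powr_realpow[symmetric]) (use \<epsilon> in simp)
        also have "\<dots> = \<epsilon> powr (1 / \<beta> * real (?d + 1))" by (rule powr_powr)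
        also have "1 / \<beta> * real (?d + 1) = (real ?d + 1) / \<beta>" by simp
        finally have rp: "r ^ (?d + 1) \<le> \<epsilon> powr ((real ?d + 1) / \<beta>)" .
        have "\<epsilon>\<^sup>2 * R * real n \<le> \<epsilon>\<^sup>2 * (\<epsilon> powr ((real ?d + 1) / \<beta>) * (1 + \<Lambda> / \<beta>)) *
            (1 / \<Lambda> ^ ?d * \<epsilon> powr (- ((2 * \<beta> + real ?d + 1) / \<beta>)))"
        proof (intro mult_mono)
          show "R \<le> \<epsilon> powr ((real ?d + 1) / \<beta>) * (1 + \<Lambda> / \<beta>)"
            unfolding R_def using rp lnL L(1) by (intro mult_mono) auto
          show "real n \<le> 1 / \<Lambda> ^ ?d * \<epsilon> powr (- ((2 * \<beta> + real ?d + 1) / \<beta>))"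
            using n_le by (simp add: \<Lambda>_def power_int_minus divide_inverse)
        qed (use R0 \<Lambda> \<beta> in auto)
        also have "\<dots> = (\<epsilon>\<^sup>2 * \<epsilon> powr ((real ?d + 1) / \<beta>) * \<epsilon> powr (- ((2 * \<beta> + real ?d + 1) / \<beta>))) * ((1 + \<Lambda> / \<beta>) / \<Lambda> ^ ?d)"
          by simp
        also have "\<epsilon>\<^sup>2 * \<epsilon> powr ((real ?d + 1) / \<beta>) * \<epsilon> powr (- ((2 * \<beta> + real ?d + 1) / \<beta>)) = 1"
        proof -
          have e2: "\<epsilon>\<^sup>2 = \<epsilon> powr 2" using \<epsilon> by simp
          have "2 + (real ?d + 1) / \<beta> + - ((2 * \<beta> + real ?d + 1) / \<beta>) = 0" using \<beta> by (simp add: field_simps)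
          then show ?thesis unfolding e2 powr_add[symmetric] using \<epsilon> by simp
        qed
        also have "1 * ((1 + \<Lambda> / \<beta>) / \<Lambda> ^ ?d) = 1 / \<Lambda> ^ ?d + 1 / (\<beta> * \<Lambda> ^ (?d - 1))"
        proof -
          have "\<Lambda> ^ ?d = \<Lambda> * \<Lambda> ^ (?d - 1)" using d1 by (simp add: power_eq_if)
          then show ?thesis using \<Lambda> \<beta> by (simp add: field_simps)
        qed
        also have "\<dots> \<le> M"
          unfolding M_def using \<Lambda> \<Lambda>0 \<beta> by (intro add_mono divide_left_mono mult_left_mono power_mono) auto
        finally have nM: "\<epsilon>\<^sup>2 * R * real n \<le> M" .
        have "\<epsilon> * sqrt R * sqrt n = sqrt (\<epsilon>\<^sup>2 * R * real n)" using \<epsilon> by (simp add: real_sqrt_mult)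
        also have "\<dots> \<le> sqrt M" using nM by simp
        finally have \<epsilon>R: "\<epsilon> * sqrt R \<le> sqrt M / sqrt n" using n by (simp add: field_simps)
        have "expected_halfspace_stat n p q \<le> 2 * \<bar>C\<bar> / sqrt n + \<kappa> * D * (sqrt M / sqrt n)"
          unfolding C_def
        proof (rule expected_halfspace_stat_le[OF pdf_p _ pdf_q _ n])
          show "p x \<le> Bd" for x using p_le[of x] lo by (simp add: Bd_def)
          show "q x \<le> Bd" for x using p_le[of x] f_le[of x] unfolding Bd_def q_def by linarith
          fix w :: 'a and b :: real assume wb: "norm w = 1" "0 \<le> b"
          have "halfspace_integral q w b = halfspace_integral p w b + (\<kappa> * \<epsilon>) * halfspace_integral f w b"
          proof -
            have "halfspace_integral q w b = (LINT x|lborel. indicat_real (halfspace w b) x * p x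
                + (\<kappa> * \<epsilon>) * (indicat_real (halfspace w b) x * f x))"
              unfolding halfspace_integral_def q_def by (simp add: algebra_simps)
            also have "\<dots> = halfspace_integral p w b + (\<kappa> * \<epsilon>) * halfspace_integral f w b"
              unfolding halfspace_integral_def
              by (subst Bochner_Integration.integral_add)
                 (auto intro!: integrable_mult_right integrable_indicator_mult int_p int_f)
            finally show ?thesis .
          qed
          then have "\<bar>measure (pdf_measure p) (halfspace w b) - measure (pdf_measure q) (halfspace w b)\<bar>
              = (\<kappa> * \<epsilon>) * \<bar>halfspace_integral f w b\<bar>"
            using \<kappa> \<epsilon>(1) by (simp add: measure_pdf_measure(2)[OF pdf_p] measure_pdf_measure(2)[OF pdf_q] abs_mult)
          also have "\<dots> \<le> (\<kappa> * \<epsilon>) * (D * sqrt R)"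
            using disc[OF wb] \<kappa>\<epsilon> unfolding f_def R_def by (intro mult_left_mono) auto
          also have "\<dots> = \<kappa> * D * (\<epsilon> * sqrt R)" by simp
          also have "\<dots> \<le> \<kappa> * D * (sqrt M / sqrt n)" using \<kappa> D by (intro mult_left_mono \<epsilon>R) auto
          finally show "\<bar>measure (pdf_measure p) (halfspace w b) - measure (pdf_measure q) (halfspace w b)\<bar>
              \<le> \<kappa> * D * (sqrt M / sqrt n)" .
        qed
        also have "\<dots> = (2 * \<bar>C\<bar> + \<kappa> * D * sqrt M) / sqrt n" by (simp add: add_divide_distrib)
        also have "\<dots> \<le> c' / sqrt n" unfolding c'_def by (intro divide_right_mono) auto
        finally show ?thesis .
      qed
      show ?thesis
        using pdf_p pdf_q sob_p sob_q comp1 comp2 stat unfolding L1[symmetric] L2[symmetric] by blast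
    qed
    then show ?thesis using c' by blast
  qed
  show ?thesis
    using K(1) E1(1) main by (intro exI[of _ "sqrt E1 + 1"] exI[of _ K] conjI) (auto intro: add_nonneg_pos)
qed

theorem proposition8:
  fixes \<beta> :: real
  assumes "\<beta> > 0"
  shows "\<exists>c>0. \<exists>K>0. \<forall>\<delta>::real. 0 < \<delta> \<and> \<delta> < 1 \<longrightarrow>
    (\<exists>c'>0. \<forall>\<epsilon>::real. 0 < \<epsilon> \<and> \<epsilon> \<le> \<delta> \<longrightarrow>
      (\<exists>p q :: real ^ 'd \<Rightarrow> real.
         pdf_on_unit_ball p \<and> pdf_on_unit_ball q \<and>
         sobolev_norm \<beta> p < ennreal c \<and> sobolev_norm \<beta> q < ennreal c \<and>
         comparable K (L1_norm (\<lambda>x. p x - q x)) (L2_norm (\<lambda>x. p x - q x)) \<and>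
         comparable K (L2_norm (\<lambda>x. p x - q x)) (ennreal \<epsilon>) \<and>
         (\<forall>n::nat. 0 < n \<and>
            real n \<le> ln (1 / \<epsilon>) powi (- int CARD('d))
                       * \<epsilon> powr (- ((2 * \<beta> + real CARD('d) + 1) / \<beta>)) \<longrightarrow>
            expected_halfspace_stat n p q \<le> c' / sqrt (real n))))"
proof -
  have "DIM(real ^ 'd) = CARD('d)" by simp
  from densities_with_small_halfspace_discrepancy[OF assms, where 'a="real ^ 'd", unfolded this]
  show ?thesis .
qed

end
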